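(* Let $N\ge1$. (1) Let $K$ be any field of odd characteristic $p$. The algebra $A_N$ has the weak Lefschetz property if and only if $N\le 2p-2$, and it has the strong Lefschetz property if and only if $N<p$. Whenever either property holds, it is realized by $\ell=d_{11}+\cdots+d_{NN}$ (that is, $\ell$ is then a weak, respectively strong, Lefschetz element). If $N=2p-1$, the multiplication map $\ell:(A_N)_{p-1}\to(A_N)_p$ has a one-dimensional kernel. (2) If $K$ is a field of characteristic zero, then $\ell$ is strong Lefschetz in $A_N$ for every $N$.
   Context: $X=(x_{ij})_{1\le i,j\le N}$ is the generic symmetric matrix: $x_{ji}=x_{ij}$ and the $x_{ij}$, $i\le j$, are algebraically independent over the field $K$. $R=K[x_{ij}:1\le i\le j\le N]$, $S=K[d_{ij}:1\le i\le j\le N]$ (each $d_{ij}$ of degree $1$), $D_N=\det X\in R$. The variable $d_{ij}$ acts on $R$ as the ordinary partial derivative $\partial/\partial x_{ij}$ ($i\le j$); for $f\in S$, $f(\partial)$ denotes the resulting differential operator. $\mathrm{Ann}(D_N)=\{f\in S: f(\partial)D_N=0\}$ and $A_N=S/\mathrm{Ann}(D_N)$, graded by degree. For a standard graded Artinian $K$-algebra $A$, a linear form $L\in A_1$ is weak Lefschetz if multiplication $L:A_k\to A_{k+1}$ has maximal rank (i.e. rank $\min(\dim A_k,\dim A_{k+1})$) for every $k$; it is strong Lefschetz if $L^q:A_k\to A_{k+q}$ has maximal rank for every $k,q\ge0$. $A$ has the weak (strong) Lefschetz property if a weak (strong) Lefschetz linear form exists over the ground field $K$. *)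

theory Defs
  imports
    "HOL-Library.Poly_Mapping"
    "HOL-Algebra.QuotRing"
    "HOL-Algebra.Embedded_Algebras"
    "Jordan_Normal_Form.Determinant"
begin

section \<open>Lefschetz properties of a graded algebra\<close>

text \<open>
  A graded \<open>K\<close>-algebra is given by a ring \<open>A\<close>, the copy \<open>K\<close> of the ground field inside \<open>A\<close>,
  and the family \<open>G\<close> of its homogeneous components. Dimensions are those of
  \<^theory>\<open>HOL-Algebra.Embedded_Algebras\<close>; the rank of a linear map is the dimension of its image.
\<close>

definition has_maximal_rank ::
    "('a, 'b) ring_scheme \<Rightarrow> 'a set \<Rightarrow> ('a \<Rightarrow> 'a) \<Rightarrow> 'a set \<Rightarrow> 'a set \<Rightarrow> bool" where
  "has_maximal_rank A K \<phi> V W \<longleftrightarrow>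
     ring.dim A K (\<phi> ` V) = min (ring.dim A K V) (ring.dim A K W)"

definition weak_lefschetz_element ::
    "('a, 'b) ring_scheme \<Rightarrow> 'a set \<Rightarrow> (nat \<Rightarrow> 'a set) \<Rightarrow> 'a \<Rightarrow> bool" where
  "weak_lefschetz_element A K G L \<longleftrightarrow>
     L \<in> G 1 \<and> (\<forall>k. has_maximal_rank A K (\<lambda>a. L \<otimes>\<^bsub>A\<^esub> a) (G k) (G (k + 1)))"

definition strong_lefschetz_element ::
    "('a, 'b) ring_scheme \<Rightarrow> 'a set \<Rightarrow> (nat \<Rightarrow> 'a set) \<Rightarrow> 'a \<Rightarrow> bool" where
  "strong_lefschetz_element A K G L \<longleftrightarrow>
     L \<in> G 1 \<and>
     (\<forall>k q. has_maximal_rank A K (\<lambda>a. (L [^]\<^bsub>A\<^esub> (q::nat)) \<otimes>\<^bsub>A\<^esub> a) (G k) (G (k + q)))"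

definition weak_lefschetz_property ::
    "('a, 'b) ring_scheme \<Rightarrow> 'a set \<Rightarrow> (nat \<Rightarrow> 'a set) \<Rightarrow> bool" where
  "weak_lefschetz_property A K G \<longleftrightarrow> (\<exists>L. weak_lefschetz_element A K G L)"

definition strong_lefschetz_property ::
    "('a, 'b) ring_scheme \<Rightarrow> 'a set \<Rightarrow> (nat \<Rightarrow> 'a set) \<Rightarrow> bool" where
  "strong_lefschetz_property A K G \<longleftrightarrow> (\<exists>L. strong_lefschetz_element A K G L)"


section \<open>Polynomials in the entries of a symmetric matrix\<close>

text \<open>
  Polynomials with indeterminates indexed by pairs of naturals; multiplication is the convolution
  product of \<^theory>\<open>HOL-Library.Poly_Mapping\<close>. The type serves both for \<open>R\<close> (indeterminates
  \<open>x\<^sub>i\<^sub>j\<close>) and for \<open>S\<close> (indeterminates \<open>d\<^sub>i\<^sub>j\<close>). Indices run from \<open>0\<close> to \<open>N - 1\<close>.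
\<close>

type_synonym monomial = "(nat \<times> nat) \<Rightarrow>\<^sub>0 nat"
type_synonym 'k mpoly = "monomial \<Rightarrow>\<^sub>0 'k"

definition mconst :: "'k::field \<Rightarrow> 'k mpoly" where
  "mconst c = Poly_Mapping.single 0 c"

definition indet :: "nat \<times> nat \<Rightarrow> 'k::field mpoly" where
  "indet v = Poly_Mapping.single (Poly_Mapping.single v 1) 1"

definition mon_degree :: "monomial \<Rightarrow> nat" where
  "mon_degree m = (\<Sum>v\<in>Poly_Mapping.keys m. Poly_Mapping.lookup m v)"

definition sym_indices :: "nat \<Rightarrow> (nat \<times> nat) set" where
  "sym_indices N = {(i, j). i \<le> j \<and> j < N}"

definition sym_poly_ring :: "nat \<Rightarrow> 'k::field mpoly ring" where
  "sym_poly_ring N =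
     \<lparr>carrier = {f. \<forall>m\<in>Poly_Mapping.keys f. Poly_Mapping.keys m \<subseteq> sym_indices N},
      monoid.mult = (*), one = 1, ring.zero = 0, add = (+)\<rparr>"

definition sym_poly_component :: "nat \<Rightarrow> nat \<Rightarrow> 'k::field mpoly set" where
  "sym_poly_component N k =
     {f \<in> carrier (sym_poly_ring N). \<forall>m\<in>Poly_Mapping.keys f. mon_degree m = k}"

definition generic_sym_det :: "nat \<Rightarrow> 'k::field mpoly" where
  "generic_sym_det N = det (mat N N (\<lambda>(i, j). indet (min i j, max i j)))"


section \<open>Polynomials as differential operators\<close>

text \<open>
  In the summand for a monomial \<open>m\<close> not containing \<open>v\<close>, the truncated difference
  \<open>m - single v 1\<close> is harmless because the coefficient vanishes.
\<close>

definition partial :: "nat \<times> nat \<Rightarrow> 'k::field mpoly \<Rightarrow> 'k mpoly" where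
  "partial v g = (\<Sum>m\<in>Poly_Mapping.keys g.
     Poly_Mapping.single (m - Poly_Mapping.single v 1)
       (of_nat (Poly_Mapping.lookup m v) * Poly_Mapping.lookup g m))"

text \<open>The order of the fold is irrelevant, since partial derivatives commute (see below).\<close>

definition mon_diff :: "monomial \<Rightarrow> 'k::field mpoly \<Rightarrow> 'k mpoly" where
  "mon_diff m g =
     Finite_Set.fold (\<lambda>v. partial v ^^ Poly_Mapping.lookup m v) g (Poly_Mapping.keys m)"

definition poly_diff :: "'k::field mpoly \<Rightarrow> 'k mpoly \<Rightarrow> 'k mpoly" where
  "poly_diff f g =
     (\<Sum>m\<in>Poly_Mapping.keys f. mconst (Poly_Mapping.lookup f m) * mon_diff m g)"

lemma lookup_partial:
  "Poly_Mapping.lookup (partial v g) n =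
     of_nat (Poly_Mapping.lookup n v + 1) * Poly_Mapping.lookup g (n + Poly_Mapping.single v 1)"
proof -
  let ?e = "Poly_Mapping.single v (1::nat)"
  let ?t = "\<lambda>m. Poly_Mapping.lookup
     (Poly_Mapping.single (m - ?e) (of_nat (Poly_Mapping.lookup m v) * Poly_Mapping.lookup g m)) n"
  have sub: "?t m = 0" if ne: "m \<noteq> n + ?e" for m
  proof (rule ccontr)
    assume "?t m \<noteq> 0"
    then have n: "m - ?e = n" and "Poly_Mapping.lookup m v \<noteq> 0"
      by (cases "Poly_Mapping.lookup m v = 0"; auto simp: lookup_single when_def split: if_splits)+
    then have "Poly_Mapping.lookup m w = Poly_Mapping.lookup (m - ?e + ?e) w" for w
      by (auto simp: lookup_add lookup_minus lookup_single when_def)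
    then have "m = m - ?e + ?e"
      by (rule poly_mapping_eqI)
    with n ne show False
      by simp
  qed
  have "Poly_Mapping.lookup (partial v g) n = (\<Sum>m\<in>Poly_Mapping.keys g. ?t m)"
    by (simp add: partial_def lookup_sum)
  also have "\<dots> = (\<Sum>m\<in>Poly_Mapping.keys g \<inter> {n + ?e}. ?t m)"
    by (rule sum.mono_neutral_right) (use sub in auto)
  also have "\<dots> = of_nat (Poly_Mapping.lookup n v + 1) * Poly_Mapping.lookup g (n + ?e)"
  proof (cases "n + ?e \<in> Poly_Mapping.keys g")
    case True
    then have "Poly_Mapping.keys g \<inter> {n + ?e} = {n + ?e}"
      by blast
    then show ?thesis
      by (simp add: lookup_add)
  next
    case False
    then have "Poly_Mapping.keys g \<inter> {n + ?e} = {}"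
      by blast
    with False show ?thesis
      by (simp add: in_keys_iff)
  qed
  finally show ?thesis .
qed

lemma partial_commute: "partial v (partial w g) = partial w (partial v g)"
proof (cases "v = w")
  case False
  then show ?thesis
    by (intro poly_mapping_eqI) (simp add: lookup_partial lookup_add lookup_single ac_simps)
qed simp

section \<open>The algebra \<open>A\<^sub>N\<close>\<close>

definition Ann :: "nat \<Rightarrow> 'k::field mpoly set" where
  "Ann N = {f \<in> carrier (sym_poly_ring N). poly_diff f (generic_sym_det N) = 0}"

definition sym_alg :: "nat \<Rightarrow> 'k::field mpoly set ring" where
  "sym_alg N = sym_poly_ring N Quot Ann N"

definition residue_class :: "nat \<Rightarrow> 'k::field mpoly \<Rightarrow> 'k mpoly set" where
  "residue_class N f = Ann N +>\<^bsub>sym_poly_ring N\<^esub> f"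

definition ground_field :: "nat \<Rightarrow> 'k::field mpoly set set" where
  "ground_field N = residue_class N ` range mconst"

definition sym_alg_component :: "nat \<Rightarrow> nat \<Rightarrow> 'k::field mpoly set set" where
  "sym_alg_component N k = residue_class N ` sym_poly_component N k"

definition trace_form :: "nat \<Rightarrow> 'k::field mpoly set" where
  "trace_form N = residue_class N (\<Sum>i<N. indet (i, i))"

end

theory Submission
  imports Defs
begin

text \<open>
  In \<open>A\<^sub>N\<close> the relations \<open>d\<^sub>i\<^sub>j d\<^sub>i\<^sub>k = - d\<^sub>i\<^sub>i d\<^sub>j\<^sub>k\<close>, \<open>d\<^sub>i\<^sub>j\<^sup>2 = - 2 d\<^sub>i\<^sub>i d\<^sub>j\<^sub>j\<close>, \<open>d\<^sub>i\<^sub>i d\<^sub>i\<^sub>j = 0\<close>, \<open>d\<^sub>i\<^sub>i\<^sup>2 = 0\<close> reduce every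
  monomial to a multiple of \<open>\<mu> \<Prod>\<^bsub>i \<in> T\<^esub> d\<^sub>i\<^sub>i\<close>, where \<open>\<mu>\<close> is a matching and \<open>T\<close> consists of vertices not
  covered by \<open>\<mu>\<close>. Apolarity makes \<open>A\<^sub>N\<close> a direct sum, over the sets \<open>O\<close> of covered vertices, of copies of
  \<open>B\<^sub>n = K[t\<^sub>1, \<dots>, t\<^sub>n] / (t\<^sub>1\<^sup>2, \<dots>, t\<^sub>n\<^sup>2)\<close> with \<open>n = N - |O|\<close>, shifted by \<open>|O| / 2\<close>, on which \<open>\<ell>\<close> acts as
  \<open>t\<^sub>1 + \<dots> + t\<^sub>n\<close>; an induction on \<open>n\<close> determines when the powers of this form are injective or
  surjective. For \<open>N = 2p - 1\<close> the kernel in degree \<open>p - 1\<close> comes from the single summand \<open>O = \<emptyset>\<close>.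
  Conversely every linear form satisfies \<open>L\<^sup>p = 0\<close> in odd characteristic \<open>p\<close>.
\<close>

section \<open>The raising operator on functions of finite sets\<close>

text \<open>A function \<open>g\<close> on sets stands for the element of \<open>B\<^sub>n\<close>
  with coefficient \<open>g T\<close> at the product of the \<open>t\<^sub>i\<close> with
  \<open>i\<close> in \<open>T\<close>; \<open>up\<close> is then multiplication by the sum of the
  variables. The decomposition itself is never constructed, since distinct matchings with the same
  covered set can be dependent modulo the annihilator. Instead each matching is treated on its own,
  from the two sides of the pairing. For injectivity, the pairings of \<open>f\<close> with \<mu>
  times the loops on the complement of \<open>S\<close> form a function of \<open>S\<close> that the
  trace form transforms by \<open>up\<close>. For surjectivity, solutions in
  \<open>B\<^sub>n\<close> are lifted to polynomials along \<mu>. The bounds on \<open>N\<close>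
  come from the integers inverted on the way: \<open>1, ..., k + q\<close> for injectivity when
  \<open>2 * k + q \<le> N\<close>, and \<open>1, ..., N - k\<close> for surjectivity when
  \<open>N \<le> 2 * k + q\<close>. Over all \<open>k\<close> and \<open>q\<close> these reach
  \<open>N\<close>; for \<open>q = 1\<close> they stop at \<open>(N + 1) / 2\<close>. The power
  \<open>L\<^sup>p\<close> vanishes because Frobenius turns it into a combination of
  \<open>p\<close>-th powers of variables, and the cube of every variable is already zero.\<close>

definition up :: "('i set \<Rightarrow> 'k::comm_ring_1) \<Rightarrow> 'i set \<Rightarrow> 'k" where
  "up g S = (\<Sum>i\<in>S. g (S - {i}))"

lemma up_pow_Suc: "(up ^^ Suc q) g S = (\<Sum>i\<in>S. (up ^^ q) g (S - {i}))"
  by (simp add: up_def)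

text \<open>Homogeneity: \<open>q\<close> removals see only the subsets with \<open>q\<close>
  elements fewer, so a function that matters on a single level may take any values
  elsewhere.\<close>

lemma up_pow_level:
  assumes "finite S" "\<And>T. T \<subseteq> S \<Longrightarrow> card T + q = card S \<Longrightarrow> g T = h T"
  shows "(up ^^ q) g S = (up ^^ q) h S"
  using assms
proof (induction q arbitrary: S)
  case 0
  then show ?case by simp
next
  case (Suc q)
  have "(up ^^ q) g (S - {i}) = (up ^^ q) h (S - {i})" if "i \<in> S" for i
  proof (rule Suc.IH)
    fix T assume "T \<subseteq> S - {i}" "card T + q = card (S - {i})"
    moreover have "card S = Suc (card (S - {i}))"
      using that Suc.prems(1) card_Suc_Diff1[of S i] by simp
    ultimately show "g T = h T"
      using Suc.prems(2)[of T] by auto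
  qed (use Suc.prems in auto)
  then show ?case
    by (simp add: up_pow_Suc del: funpow.simps)
qed

lemma up_pow_zero [simp]: "(up ^^ q) (\<lambda>_. 0) = (\<lambda>_. 0)"
  by (induction q) (auto simp: up_def)

lemma up_pow_eq_zero:
  assumes "finite S" "\<And>T. T \<subseteq> S \<Longrightarrow> card T + q = card S \<Longrightarrow> g T = 0"
  shows "(up ^^ q) g S = 0"
  using up_pow_level[of S q g "\<lambda>_. 0"] assms by simp

lemma up_pow_add: "(up ^^ q) (\<lambda>S. g S + h S) S = (up ^^ q) g S + (up ^^ q) h S"
  by (induction q arbitrary: S) (auto simp: up_def sum.distrib)

lemma up_pow_cmult: "(up ^^ q) (\<lambda>S. c * g S) S = c * (up ^^ q) g S"
  by (induction q arbitrary: S) (auto simp: up_def sum_distrib_left)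

text \<open>Since \<open>t_x\<close> squares to zero,
  \<open>(s + t_x)^q = s^q + q t_x s^(q-1)\<close>. For \<open>q = 0\<close> the truncated exponent
  \<open>q - 1\<close> is met by the coefficient zero.\<close>

lemma up_pow_insert:
  assumes "finite S" "x \<notin> S"
  shows "(up ^^ q) g (insert x S) =
    (up ^^ q) (\<lambda>T. g (insert x T)) S + of_nat q * (up ^^ (q - 1)) g S"
  using assms
proof (induction q arbitrary: S)
  case 0
  then show ?case by simp
next
  case (Suc q)
  let ?h = "\<lambda>T. g (insert x T)"
  have "(up ^^ q) g (insert x S - {i}) =
      (up ^^ q) ?h (S - {i}) + of_nat q * (up ^^ (q - 1)) g (S - {i})" if "i \<in> S" for i
  proof -
    have "insert x S - {i} = insert x (S - {i})"
      using that Suc.prems by auto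
    then show ?thesis
      using Suc by simp
  qed
  moreover have "insert x S - {x} = S"
    using Suc.prems by auto
  ultimately have "(up ^^ Suc q) g (insert x S) = (up ^^ q) g S
      + (\<Sum>i\<in>S. (up ^^ q) ?h (S - {i}) + of_nat q * (up ^^ (q - 1)) g (S - {i}))"
    using Suc.prems by (simp add: up_pow_Suc del: funpow.simps)
  moreover have "(\<Sum>i\<in>S. of_nat q * (up ^^ (q - 1)) g (S - {i})) = of_nat q * (up ^^ q) g S"
    by (cases q) (simp_all add: up_pow_Suc sum_distrib_left del: funpow.simps)
  ultimately show ?case
    by (simp add: up_pow_Suc sum.distrib algebra_simps del: funpow.simps)
qed

text \<open>Split off one variable: the element is \<open>g + t_x h\<close>, and \<open>s\<close> is
  the sum of the other variables. The two parts of the equation read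
  \<open>s^q h + q s^(q-1) g = 0\<close> and \<open>s^q g = 0\<close>. Multiplying the first by
  \<open>s\<close> isolates \<open>h\<close>, which lives at level \<open>k - 1\<close> with
  exponent \<open>q + 1\<close>; the sum \<open>k + q\<close>, and so the range of invertible
  integers, does not change.\<close>

lemma up_pow_injective:
  fixes g :: "'i set \<Rightarrow> 'k::field"
  assumes "finite I" "2 * k + q \<le> card I"
    and "\<And>j. 0 < j \<Longrightarrow> j \<le> k + q \<Longrightarrow> of_nat j \<noteq> (0::'k)"
    and "\<And>S. S \<subseteq> I \<Longrightarrow> card S = k + q \<Longrightarrow> (up ^^ q) g S = 0"
    and "T \<subseteq> I" "card T = k"
  shows "g T = 0"
  using assms
proof (induction I arbitrary: k q g T rule: finite_induct)
  case empty
  then show ?case by simp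
next
  case (insert x I)
  show ?case
  proof (cases "q = 0")
    case True
    then show ?thesis
      using insert.prems by auto
  next
    case False
    then obtain r where q: "q = Suc r"
      by (cases q) auto
    let ?h = "\<lambda>T. g (insert x T)"
    have fin: "finite S" if "S \<subseteq> I" for S
      using that insert.hyps finite_subset by blast
    have top: "(up ^^ q) ?h S + of_nat q * (up ^^ r) g S = 0" if S: "S \<subseteq> I" "card S = k + r" for S
    proof -
      have "x \<notin> S"
        using S insert.hyps by auto
      then have "card (insert x S) = k + q"
        using S fin q by simp
      then have "(up ^^ q) g (insert x S) = 0"
        using insert.prems(3)[of "insert x S"] S by auto
      then show ?thesis
        using up_pow_insert[of S x q g] fin S \<open>x \<notin> S\<close> q by simp
    qed
    \<comment> \<open>One more multiplication by \<open>s\<close> makes the \<open>g\<close> term a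
      multiple of \<open>s^q g\<close>, whose value on sets avoiding \<open>x\<close> is zero by
      hypothesis.\<close>
    have top': "(up ^^ Suc q) ?h S = 0" if S: "S \<subseteq> I" "card S = k + q" for S
    proof -
      have "(up ^^ q) ?h (S - {i}) = - of_nat q * (up ^^ r) g (S - {i})" if "i \<in> S" for i
      proof -
        have "card (S - {i}) = k + r"
          using S that fin q by (simp add: card_Diff_singleton)
        with top[of "S - {i}"] S show ?thesis
          by (auto simp: eq_neg_iff_add_eq_0)
      qed
      then have "(up ^^ Suc q) ?h S = (\<Sum>i\<in>S. - of_nat q * (up ^^ r) g (S - {i}))"
        by (simp add: up_pow_Suc del: funpow.simps)
      also have "\<dots> = - of_nat q * (up ^^ q) g S"
        by (simp only: q up_pow_Suc sum_distrib_left)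
      also have "\<dots> = 0"
        using insert.prems(3)[of S] S by auto
      finally show ?thesis .
    qed
    have h0: "?h T = 0" if T: "T \<subseteq> I" "Suc (card T) = k" for T
    proof (rule insert.IH[of "k - 1" "Suc q" ?h T])
      show "2 * (k - 1) + Suc q \<le> card I"
        using insert.prems(1) insert.hyps T by simp
      show "(up ^^ Suc q) ?h S = 0" if "S \<subseteq> I" "card S = k - 1 + Suc q" for S
        using top'[of S] that T by simp
    qed (use insert.prems(2) T in auto)
    \<comment> \<open>With \<open>h\<close> gone, the invertible \<open>q\<close> cancels; the
      exponent drops by one and makes up for the lost variable in
      \<open>2 * k + q \<le> card I\<close>.\<close>
    have "(up ^^ r) g S = 0" if S: "S \<subseteq> I" "card S = k + r" for S
    proof -
      have "(up ^^ q) ?h S = 0"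
        using S h0 fin q by (intro up_pow_eq_zero) auto
      then show ?thesis
        using top[OF S] insert.prems(2)[of q] q by auto
    qed
    then have g0: "g T = 0" if "T \<subseteq> I" "card T = k" for T
      using insert.IH[of k r g T] insert.prems(1,2) insert.hyps q that by auto
    show ?thesis
    proof (cases "x \<in> T")
      case True
      then have "T - {x} \<subseteq> I" "insert x (T - {x}) = T"
        using insert.prems by auto
      moreover from this have "Suc (card (T - {x})) = k"
        using True insert.prems fin by (metis card_Suc_Diff1 finite_insert finite_subset insert.hyps(1))
      ultimately show ?thesis
        using h0[of "T - {x}"] by simp
    next
      case False
      then show ?thesis
        using g0 insert.prems by auto
    qed
  qed
qed

text \<open>The solution is sought as \<open>w + s z - q t_x z\<close>. Its product with
  \<open>(s + t_x)^q\<close> is \<open>s^q w + s^(q+1) z + q t_x s^(q-1) w\<close>, because the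
  terms with \<open>t_x z\<close> cancel. Hence the values of \<open>h\<close> on sets containing
  \<open>x\<close> determine an equation for \<open>w\<close>, and the remaining values then one for
  \<open>z\<close>, at level \<open>k - 1\<close> with exponent \<open>q + 1\<close>.\<close>

lemma up_pow_surjective:
  fixes h :: "'i set \<Rightarrow> 'k::field"
  assumes "finite I" "card I \<le> 2 * k + q"
    and "\<And>j. 0 < j \<Longrightarrow> j \<le> card I - k \<Longrightarrow> of_nat j \<noteq> (0::'k)"
  shows "\<exists>g. \<forall>S\<subseteq>I. card S = k + q \<longrightarrow> (up ^^ q) g S = h S"
  using assms
proof (induction I arbitrary: k q h rule: finite_induct)
  case empty
  show ?case
  proof (cases "k + q = 0")
    case True
    then show ?thesis by auto
  qed auto
next
  case (insert x I)
  have fin: "finite S" if "S \<subseteq> insert x I" for S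
    using that insert.hyps finite_subset by blast
  have card_le: "card S \<le> card (insert x I)" if "S \<subseteq> insert x I" for S
    using that insert.hyps by (intro card_mono) auto
  show ?case
  proof (cases "q = 0 \<or> card (insert x I) < k + q")
    case True
    then show ?thesis
    proof
      assume "q = 0"
      then show ?thesis by auto
    next
      assume "card (insert x I) < k + q"
      then show ?thesis
        using card_le by (metis not_less)
    qed
  next
    case False
    then obtain r where q: "q = Suc r"
      by (cases q) auto
    have q0: "of_nat q \<noteq> (0::'k)"
    proof -
      have "0 < q" "q \<le> card (insert x I) - k"
        using False by linarith+
      then show ?thesis
        by (rule insert.prems(2))
    qed
    obtain w where w: "\<And>S. S \<subseteq> I \<Longrightarrow> card S = k + r \<Longrightarrow> (up ^^ r) w S = h (insert x S) / of_nat q"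
      using insert.IH[of k r "\<lambda>S. h (insert x S) / of_nat q"] insert.prems insert.hyps q by auto
    obtain z where z: "\<And>S. S \<subseteq> I \<Longrightarrow> card S = k + q \<Longrightarrow> (up ^^ Suc q) z S = h S - (up ^^ q) w S"
      and z0: "k = 0 \<Longrightarrow> z = (\<lambda>_. 0)"
    proof (cases "k = 0")
      case True
      \<comment> \<open>Vacuous: for \<open>k = 0\<close> the set \<open>I\<close> has fewer than
        \<open>q\<close> elements.\<close>
      have "(up ^^ Suc q) (\<lambda>_. 0) S = h S - (up ^^ q) w S" if "S \<subseteq> I" "card S = k + q" for S
        using that insert.prems(1) insert.hyps True card_mono[of I S] by auto
      then show ?thesis
        using that by blast
    next
      case False
      then have "card I \<le> 2 * (k - 1) + Suc q" "card I - (k - 1) \<le> card (insert x I) - k"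
        and kq: "k - 1 + Suc q = k + q"
        using insert.prems(1) insert.hyps by auto
      then have "\<exists>z. \<forall>S\<subseteq>I. card S = k - 1 + Suc q \<longrightarrow> (up ^^ Suc q) z S = h S - (up ^^ q) w S"
        using insert.prems(2) by (intro insert.IH) (auto intro: order_trans)
      then obtain z where "\<forall>S\<subseteq>I. card S = k + q \<longrightarrow> (up ^^ Suc q) z S = h S - (up ^^ q) w S"
        unfolding kq by blast
      then show ?thesis
        using that[of z] False by blast
    qed
    define g where
      "g S = (if x \<in> S then - of_nat q * z (S - {x}) else w S + up z S)" for S
    have low: "(up ^^ s) g S = (up ^^ s) w S + (up ^^ Suc s) z S" if "S \<subseteq> I" for S s
    proof -
      have "(up ^^ s) g S = (up ^^ s) (\<lambda>S. w S + up z S) S"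
        using that insert.hyps fin by (intro up_pow_level) (auto simp: g_def)
      then show ?thesis
        by (simp only: up_pow_add funpow_Suc_right o_apply)
    qed
    have high: "(up ^^ s) (\<lambda>T. g (insert x T)) S = - of_nat q * (up ^^ s) z S" if "S \<subseteq> I" for S s
    proof -
      have "(up ^^ s) (\<lambda>T. g (insert x T)) S = (up ^^ s) (\<lambda>T. - of_nat q * z T) S"
      proof (rule up_pow_level)
        fix T assume "T \<subseteq> S"
        then have "x \<notin> T"
          using that insert.hyps by auto
        then show "g (insert x T) = - of_nat q * z T"
          by (simp add: g_def)
      qed (use that fin in auto)
      then show ?thesis
        by (simp only: up_pow_cmult)
    qed
    have "(up ^^ q) g S = h S" if S: "S \<subseteq> insert x I" "card S = k + q" for S
    proof (cases "x \<in> S")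
      case False
      then have "S \<subseteq> I"
        using S by auto
      then show ?thesis
        using low[of S q] z[of S] S by simp
    next
      case True
      define S' where "S' = S - {x}"
      have S': "S = insert x S'" "x \<notin> S'" "S' \<subseteq> I" "finite S'" "card S' = k + r"
        using S True fin q by (auto simp: S'_def card_Diff_singleton)
      have "(up ^^ q) g S = - of_nat q * (up ^^ q) z S' + of_nat q * ((up ^^ r) w S' + (up ^^ q) z S')"
        using up_pow_insert[of S' x q g] high[of S' q] low[of S' r] S' q by simp
      also have "\<dots> = h S"
        using w[of S'] S' q0 by (simp add: algebra_simps)
      finally show ?thesis .
    qed
    then show ?thesis
      by blast
  qed
qed

text \<open>Any two \<open>k\<close>-subsets are connected by exchanges of single elements, each of
  which lowers \<open>card (T - T')\<close> by one.\<close>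

lemma constant_on_level:
  assumes swap: "\<And>S x y. S \<subseteq> I \<Longrightarrow> Suc (card S) = k \<Longrightarrow> x \<in> I - S \<Longrightarrow> y \<in> I - S \<Longrightarrow>
      g (insert x S) = g (insert y S)"
    and "finite I" "T \<subseteq> I" "card T = k" "T' \<subseteq> I" "card T' = k"
  shows "g T = g T'"
  using assms(3-)
proof (induction "card (T - T')" arbitrary: T)
  case 0
  have fin: "finite T" "finite T'"
    using 0 assms(2) finite_subset by blast+
  then have "T \<subseteq> T'"
    using 0 by auto
  then show ?case
    using 0 fin card_subset_eq by metis
next
  case (Suc n)
  have fin: "finite T" "finite T'"
    using Suc.prems assms(2) finite_subset by blast+
  obtain x where x: "x \<in> T - T'"
    using Suc.hyps(2) by (metis card.empty ex_in_conv nat.distinct(1))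
  have "card (T' - T) = card (T - T')"
    using Suc.prems fin by (simp add: card_Diff_subset_Int Int_commute)
  then obtain y where y: "y \<in> T' - T"
    using Suc.hyps(2) by (metis card.empty ex_in_conv nat.distinct(1))
  define U where "U = insert y (T - {x})"
  have "card (T - {x}) = k - 1" "k > 0"
    using x Suc.prems fin by (auto simp: card_Diff_singleton card_gt_0_iff)
  then have "g (insert x (T - {x})) = g U"
    unfolding U_def using x y Suc.prems by (intro swap) auto
  moreover have "insert x (T - {x}) = T"
    using x by auto
  moreover have "card U = k"
    using \<open>card (T - {x}) = k - 1\<close> \<open>k > 0\<close> y fin by (simp add: U_def)
  moreover have "U - T' = (T - T') - {x}"
    using y by (auto simp: U_def)
  then have "n = card (U - T')"
    using Suc.hyps(2) x fin by (simp add: card_Diff_singleton)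
  ultimately show ?case
    using Suc.hyps(1)[of U] Suc.prems y by (auto simp: U_def)
qed

text \<open>Injectivity at this level would have to invert \<open>k + 1\<close>, which is zero in
  the intended case. The differences of \<open>g\<close> under an exchange of \<open>x\<close> and
  \<open>y\<close> lie one level lower on two fewer variables, where the integers up to
  \<open>k\<close> suffice.\<close>

lemma up_kernel_middle:
  fixes g :: "'i set \<Rightarrow> 'k::field"
  assumes I: "finite I" "card I = 2 * k + 1"
    and nz: "\<And>j. 0 < j \<Longrightarrow> j \<le> k \<Longrightarrow> of_nat j \<noteq> (0::'k)"
    and ker: "\<And>S. S \<subseteq> I \<Longrightarrow> card S = Suc k \<Longrightarrow> up g S = 0"
    and "T \<subseteq> I" "card T = k" "T' \<subseteq> I" "card T' = k"
  shows "g T = g T'"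
proof (rule constant_on_level[of I k g])
  fix S x y
  assume S: "S \<subseteq> I" "Suc (card S) = k" and xy: "x \<in> I - S" "y \<in> I - S"
  show "g (insert x S) = g (insert y S)"
  proof (cases "x = y")
    case False
    let ?h = "\<lambda>S. g (insert x S) + (- 1) * g (insert y S)"
    have "?h S = 0"
    proof (rule up_pow_injective[where I = "I - {x, y}" and k = "k - 1" and q = 1 and g = ?h])
      fix R assume R: "R \<subseteq> I - {x, y}" "card R = k - 1 + 1"
      have fin: "finite R"
        using R I finite_subset by blast
      \<comment> \<open>The kernel condition at \<open>insert z R\<close> has the same remainder
        \<open>g R\<close> for \<open>z = x\<close> and \<open>z = y\<close>, so it drops out of the
        difference.\<close>
      have "up (\<lambda>T. g (insert z T)) R = - g R" if z: "z \<in> {x, y}" for z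
      proof -
        have "z \<notin> R"
          using R z by auto
        then have "up g (insert z R) = up (\<lambda>T. g (insert z T)) R + g R"
          using up_pow_insert[OF fin, of z 1 g] by simp
        moreover have "up g (insert z R) = 0"
          using R z xy fin S by (intro ker) (auto simp: card_insert_if)
        ultimately show ?thesis
          by (simp add: eq_neg_iff_add_eq_0)
      qed
      then have "up (\<lambda>T. g (insert x T)) R = - g R" "up (\<lambda>T. g (insert y T)) R = - g R"
        by simp_all
      then show "(up ^^ 1) ?h R = 0"
        by (simp add: up_def sum_subtractf)
    next
      have "card (I - {x, y}) = card I - 2"
        using xy False I by (subst card_Diff_subset) auto
      then show "2 * (k - 1) + 1 \<le> card (I - {x, y})"
        using I S by simp
    qed (use I S xy nz in auto)
    then show ?thesis
      by simp
  qed auto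
qed (use assms in auto)

section \<open>Monomial derivatives and the apolar pairing\<close>

abbreviation xpow :: "monomial \<Rightarrow> 'k::field mpoly" where
  "xpow m \<equiv> Poly_Mapping.single m 1"

definition var_mon :: "'v \<Rightarrow> 'v \<Rightarrow>\<^sub>0 nat" where
  "var_mon v = Poly_Mapping.single v 1"

lemma lookup_var_mon: "Poly_Mapping.lookup (var_mon v) w = of_bool (v = w)"
  by (auto simp: var_mon_def lookup_single)

lemma keys_var_mon [simp]: "Poly_Mapping.keys (var_mon v) = {v}"
  by (simp add: var_mon_def)

lemma indet_eq_xpow: "indet v = xpow (var_mon v)"
  by (simp add: indet_def var_mon_def)

section \<open>Weights and factorials of exponent vectors\<close>

definition wsum :: "('v \<Rightarrow> nat) \<Rightarrow> ('v \<Rightarrow>\<^sub>0 nat) \<Rightarrow> nat" where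
  "wsum w m = (\<Sum>v\<in>Poly_Mapping.keys m. Poly_Mapping.lookup m v * w v)"

lemma wsum_superset:
  assumes "finite V" "Poly_Mapping.keys m \<subseteq> V"
  shows "wsum w m = (\<Sum>v\<in>V. Poly_Mapping.lookup m v * w v)"
  unfolding wsum_def using assms by (intro sum.mono_neutral_left) (auto simp: in_keys_iff)

lemma wsum_zero [simp]: "wsum w 0 = 0"
  by (simp add: wsum_def)

lemma wsum_add: "wsum w (m + n) = wsum w m + wsum w n"
proof -
  let ?V = "Poly_Mapping.keys m \<union> Poly_Mapping.keys n"
  have "wsum w (m + n) = (\<Sum>v\<in>?V. Poly_Mapping.lookup (m + n) v * w v)"
    by (rule wsum_superset) (use keys_add[of m n] in auto)
  moreover have "wsum w m = (\<Sum>v\<in>?V. Poly_Mapping.lookup m v * w v)"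
    "wsum w n = (\<Sum>v\<in>?V. Poly_Mapping.lookup n v * w v)"
    by (auto intro!: wsum_superset)
  ultimately show ?thesis
    by (simp add: lookup_add algebra_simps sum.distrib)
qed

lemma wsum_var_mon [simp]: "wsum w (var_mon v) = w v"
  by (simp add: wsum_def lookup_var_mon)

lemma wsum_sum: "wsum w (\<Sum>i\<in>I. f i) = (\<Sum>i\<in>I. wsum w (f i))"
  by (induction I rule: infinite_finite_induct) (auto simp: wsum_add)

lemma lookup_le_wsum: "w v > 0 \<Longrightarrow> Poly_Mapping.lookup m v \<le> wsum w m"
proof (cases "v \<in> Poly_Mapping.keys m")
  case True
  assume "w v > 0"
  then have "Poly_Mapping.lookup m v \<le> Poly_Mapping.lookup m v * w v"
    by simp
  also have "\<dots> \<le> wsum w m"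
    unfolding wsum_def by (rule member_le_sum[OF True]) auto
  finally show ?thesis .
qed (auto simp: in_keys_iff)

lemma mon_degree_eq_wsum: "mon_degree m = wsum (\<lambda>_. 1) m"
  by (simp add: mon_degree_def wsum_def)

text \<open>A diagonal variable counts twice. With this convention every monomial of the determinant
  has value 2 at each index below \<open>N\<close>.\<close>

definition wt :: "nat \<Rightarrow> monomial \<Rightarrow> nat" where
  "wt i = wsum (\<lambda>v. of_bool (fst v = i) + of_bool (snd v = i))"

lemma wt_zero [simp]: "wt i 0 = 0"
  by (simp add: wt_def)

lemma wt_add: "wt i (m + n) = wt i m + wt i n"
  by (simp add: wt_def wsum_add)

lemma wt_sum: "wt i (\<Sum>j\<in>I. f j) = (\<Sum>j\<in>I. wt i (f j))"
  by (simp add: wt_def wsum_sum)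

lemma wt_var_mon: "wt i (var_mon v) = of_bool (fst v = i) + of_bool (snd v = i)"
  by (simp add: wt_def)

lemma lookup_le_wt: "Poly_Mapping.lookup m v \<le> wt (fst v) m"
  unfolding wt_def by (rule lookup_le_wsum) simp

lemma lookup_le_wt_snd: "Poly_Mapping.lookup m v \<le> wt (snd v) m"
  unfolding wt_def by (rule lookup_le_wsum) simp

text \<open>This is the constant obtained by differentiating the monomial \<open>m\<close> along
  itself.\<close>

definition mfact :: "('v \<Rightarrow>\<^sub>0 nat) \<Rightarrow> nat" where
  "mfact m = (\<Prod>v\<in>Poly_Mapping.keys m. fact (Poly_Mapping.lookup m v))"

lemma mfact_superset:
  assumes "finite V" "Poly_Mapping.keys m \<subseteq> V"
  shows "mfact m = (\<Prod>v\<in>V. fact (Poly_Mapping.lookup m v))"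
  unfolding mfact_def using assms by (intro prod.mono_neutral_left) (auto simp: in_keys_iff)

lemma mfact_add_var_mon: "mfact (m + var_mon v) = (Poly_Mapping.lookup m v + 1) * mfact m"
proof -
  let ?V = "insert v (Poly_Mapping.keys m)"
  have "mfact (m + var_mon v) = (\<Prod>w\<in>?V. fact (Poly_Mapping.lookup (m + var_mon v) w))"
    by (rule mfact_superset) (use keys_add[of m "var_mon v"] in auto)
  also have "\<dots> = fact (Poly_Mapping.lookup (m + var_mon v) v) *
      (\<Prod>w\<in>?V - {v}. fact (Poly_Mapping.lookup (m + var_mon v) w))"
    by (subst prod.remove[of _ v]) auto
  also have "(\<Prod>w\<in>?V - {v}. fact (Poly_Mapping.lookup (m + var_mon v) w)) =
      (\<Prod>w\<in>?V - {v}. fact (Poly_Mapping.lookup m w))"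
    by (rule prod.cong) (auto simp: lookup_add lookup_var_mon)
  also have "fact (Poly_Mapping.lookup (m + var_mon v) v) * \<dots> =
      (Poly_Mapping.lookup m v + 1) * (fact (Poly_Mapping.lookup m v) * \<dots>)"
    by (simp add: lookup_add lookup_var_mon algebra_simps)
  also have "fact (Poly_Mapping.lookup m v) * (\<Prod>w\<in>?V - {v}. fact (Poly_Mapping.lookup m w)) =
      (\<Prod>w\<in>?V. fact (Poly_Mapping.lookup m w))"
    by (subst prod.remove[of ?V v]) auto
  also have "\<dots> = mfact m"
    by (rule mfact_superset[symmetric]) auto
  finally show ?thesis .
qed

lemma poly_mapping_eq_sum_single:
  "m = (\<Sum>v\<in>Poly_Mapping.keys m. Poly_Mapping.single v (Poly_Mapping.lookup m v))"
proof (rule poly_mapping_eqI)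
  fix w
  show "Poly_Mapping.lookup m w =
      Poly_Mapping.lookup (\<Sum>v\<in>Poly_Mapping.keys m. Poly_Mapping.single v (Poly_Mapping.lookup m v)) w"
    by (simp add: lookup_sum lookup_single when_def in_keys_iff)
qed

section \<open>Coefficients of iterated partial derivatives\<close>

lemma lookup_partial_pow:
  fixes g :: "'k::field mpoly"
  shows "of_nat (fact (Poly_Mapping.lookup n v)) * Poly_Mapping.lookup ((partial v ^^ c) g) n =
    of_nat (fact (Poly_Mapping.lookup n v + c)) * Poly_Mapping.lookup g (n + Poly_Mapping.single v c)"
proof (induction c arbitrary: n)
  case 0
  then show ?case by simp
next
  case (Suc c)
  let ?n = "n + Poly_Mapping.single v 1"
  have "Poly_Mapping.lookup ?n v = Suc (Poly_Mapping.lookup n v)"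
    "?n + Poly_Mapping.single v c = n + Poly_Mapping.single v (Suc c)"
    by (simp_all add: lookup_add add.assoc single_add[symmetric])
  with Suc[of ?n] show ?case
    by (simp add: lookup_partial algebra_simps del: fact_Suc) (simp add: algebra_simps)
qed

lemma lookup_fold_partial:
  fixes g :: "'k::field mpoly"
  assumes "finite V"
  shows "of_nat (\<Prod>v\<in>V. fact (Poly_Mapping.lookup n v)) *
      Poly_Mapping.lookup (Finite_Set.fold (\<lambda>v. partial v ^^ c v) g V) n =
    of_nat (\<Prod>v\<in>V. fact (Poly_Mapping.lookup n v + c v)) *
      Poly_Mapping.lookup g (n + (\<Sum>v\<in>V. Poly_Mapping.single v (c v)))"
  using assms
proof (induction V arbitrary: n rule: finite_induct)
  case empty
  then show ?case by simp
next
  case (insert v V)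
  interpret comp_fun_commute "partial :: _ \<Rightarrow> 'k mpoly \<Rightarrow> _"
    by standard (simp add: fun_eq_iff partial_commute)
  interpret P: comp_fun_commute "\<lambda>v. (partial v :: 'k mpoly \<Rightarrow> _) ^^ c v"
    by (rule comp_fun_commute_funpow)
  let ?h = "Finite_Set.fold (\<lambda>v. partial v ^^ c v) g V"
  let ?n = "n + Poly_Mapping.single v (c v)"
  have "Poly_Mapping.lookup ?n w = Poly_Mapping.lookup n w" if "w \<in> V" for w
    using insert.hyps that by (auto simp: lookup_add lookup_single when_def)
  then have IH: "of_nat (\<Prod>v\<in>V. fact (Poly_Mapping.lookup n v)) * Poly_Mapping.lookup ?h ?n =
    of_nat (\<Prod>v\<in>V. fact (Poly_Mapping.lookup n v + c v)) *
      Poly_Mapping.lookup g (?n + (\<Sum>v\<in>V. Poly_Mapping.single v (c v)))"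
    using insert.IH[of ?n] by simp
  have "of_nat (\<Prod>v\<in>insert v V. fact (Poly_Mapping.lookup n v)) *
      Poly_Mapping.lookup (Finite_Set.fold (\<lambda>v. partial v ^^ c v) g (insert v V)) n =
    of_nat (\<Prod>v\<in>V. fact (Poly_Mapping.lookup n v)) *
      (of_nat (fact (Poly_Mapping.lookup n v)) * Poly_Mapping.lookup ((partial v ^^ c v) ?h) n)"
    using insert.hyps by (simp add: algebra_simps del: of_nat_fact)
  also have "\<dots> = of_nat (fact (Poly_Mapping.lookup n v + c v)) *
      (of_nat (\<Prod>v\<in>V. fact (Poly_Mapping.lookup n v)) * Poly_Mapping.lookup ?h ?n)"
    by (simp only: lookup_partial_pow ac_simps)
  also have "\<dots> = of_nat (\<Prod>v\<in>insert v V. fact (Poly_Mapping.lookup n v + c v)) *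
      Poly_Mapping.lookup g (n + (\<Sum>v\<in>insert v V. Poly_Mapping.single v (c v)))"
    unfolding IH using insert.hyps by (simp add: algebra_simps del: of_nat_fact)
  finally show ?case .
qed

text \<open>The factorials stay on both sides because they may vanish in the field, so that the
  quotient \<open>(n + m)! / n!\<close> cannot be formed there.\<close>

lemma lookup_mon_diff:
  fixes g :: "'k::field mpoly"
  shows "of_nat (mfact n) * Poly_Mapping.lookup (mon_diff m g) n =
    of_nat (mfact (n + m)) * Poly_Mapping.lookup g (n + m)"
proof -
  let ?M = "Poly_Mapping.keys m"
  let ?N = "Poly_Mapping.keys n - ?M"
  have 1: "mfact n = (\<Prod>v\<in>?N. fact (Poly_Mapping.lookup n v)) * (\<Prod>v\<in>?M. fact (Poly_Mapping.lookup n v))"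
    by (subst prod.union_disjoint[symmetric]) (auto intro!: mfact_superset)
  have 2: "mfact (n + m) = (\<Prod>v\<in>?N. fact (Poly_Mapping.lookup n v)) *
      (\<Prod>v\<in>?M. fact (Poly_Mapping.lookup n v + Poly_Mapping.lookup m v))"
  proof -
    have "(\<Prod>v\<in>?N. fact (Poly_Mapping.lookup n v)) = (\<Prod>v\<in>?N. fact (Poly_Mapping.lookup (n + m) v) :: nat)"
      by (rule prod.cong) (auto simp: lookup_add in_keys_iff)
    moreover have "mfact (n + m) = (\<Prod>v\<in>?N \<union> ?M. fact (Poly_Mapping.lookup (n + m) v))"
      using keys_add[of n m] by (intro mfact_superset) auto
    ultimately show ?thesis
      by (subst (asm) prod.union_disjoint) (auto simp: lookup_add)
  qed
  have "of_nat (\<Prod>v\<in>?M. fact (Poly_Mapping.lookup n v)) * Poly_Mapping.lookup (mon_diff m g) n =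
    of_nat (\<Prod>v\<in>?M. fact (Poly_Mapping.lookup n v + Poly_Mapping.lookup m v)) * Poly_Mapping.lookup g (n + m)"
    using lookup_fold_partial[of ?M n "Poly_Mapping.lookup m" g]
    unfolding mon_diff_def poly_mapping_eq_sum_single[of m, symmetric] by simp
  then show ?thesis
    unfolding 1 2 of_nat_mult mult.assoc by simp
qed

lemma lookup_partial_pow_eq_0:
  "Poly_Mapping.lookup g (n + Poly_Mapping.single v c) = 0 \<Longrightarrow> Poly_Mapping.lookup ((partial v ^^ c) g) n = 0"
proof (induction c arbitrary: n)
  case (Suc c)
  have "n + Poly_Mapping.single v 1 + Poly_Mapping.single v c = n + Poly_Mapping.single v (Suc c)"
    by (simp add: add.assoc single_add[symmetric])
  then show ?case
    using Suc by (simp add: lookup_partial)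
qed simp

text \<open>Where \<open>mfact n\<close> is zero in the field the identity with factorials says
  nothing; this support statement holds in every characteristic.\<close>

lemma lookup_mon_diff_eq_0:
  fixes g :: "'k::field mpoly"
  assumes "Poly_Mapping.lookup g (n + m) = 0"
  shows "Poly_Mapping.lookup (mon_diff m g) n = 0"
proof -
  interpret comp_fun_commute "partial :: _ \<Rightarrow> 'k mpoly \<Rightarrow> _"
    by standard (simp add: fun_eq_iff partial_commute)
  interpret P: comp_fun_commute "\<lambda>v. (partial v :: 'k mpoly \<Rightarrow> _) ^^ Poly_Mapping.lookup m v"
    by (rule comp_fun_commute_funpow)
  have "Poly_Mapping.lookup (Finite_Set.fold (\<lambda>v. partial v ^^ Poly_Mapping.lookup m v) g V) n = 0"
    if "finite V" "Poly_Mapping.lookup g (n + (\<Sum>v\<in>V. Poly_Mapping.single v (Poly_Mapping.lookup m v))) = 0"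
    for V n
    using that
  proof (induction V arbitrary: n rule: finite_induct)
    case (insert v V)
    then show ?case
      by (simp add: lookup_partial_pow_eq_0 add.assoc)
  qed simp
  from this[of "Poly_Mapping.keys m" n] show ?thesis
    using assms unfolding mon_diff_def poly_mapping_eq_sum_single[of m, symmetric] by simp
qed

lemma lookup_mconst_mult: "Poly_Mapping.lookup (mconst c * f) n = c * Poly_Mapping.lookup f n"
  by (simp add: mconst_def mult_map_scale_conv_mult[symmetric] Poly_Mapping.map.rep_eq when_def)

text \<open>
  \<open>det_ev N m\<close> is the value at the origin of the derivative of \<open>D\<^sub>N\<close> along the monomial \<open>m\<close>, and
  \<open>Phi N f\<close> that of \<open>f(\<partial>) D\<^sub>N\<close>. Hence \<open>Phi N (f * g)\<close> is the apolar pairing, whose radical is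
  \<open>Ann(D\<^sub>N)\<close> when \<open>2\<close> is invertible.
\<close>

definition det_ev :: "nat \<Rightarrow> monomial \<Rightarrow> 'k::field" where
  "det_ev N m = of_nat (mfact m) * Poly_Mapping.lookup (generic_sym_det N) m"

definition Phi :: "nat \<Rightarrow> 'k::field mpoly \<Rightarrow> 'k" where
  "Phi N f = (\<Sum>m\<in>Poly_Mapping.keys f. Poly_Mapping.lookup f m * det_ev N m)"

lemma Phi_superset:
  assumes "finite M" "Poly_Mapping.keys f \<subseteq> M"
  shows "Phi N f = (\<Sum>m\<in>M. Poly_Mapping.lookup f m * det_ev N m)"
  unfolding Phi_def using assms by (intro sum.mono_neutral_left) (auto simp: in_keys_iff)

lemma Phi_zero [simp]: "Phi N 0 = 0"
  by (simp add: Phi_def)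

lemma Phi_add: "Phi N (f + g) = Phi N f + Phi N g"
proof -
  let ?M = "Poly_Mapping.keys f \<union> Poly_Mapping.keys g"
  have "Phi N (f + g) = (\<Sum>m\<in>?M. Poly_Mapping.lookup (f + g) m * det_ev N m)"
    by (rule Phi_superset) (use keys_add[of f g] in auto)
  moreover have "Phi N f = (\<Sum>m\<in>?M. Poly_Mapping.lookup f m * det_ev N m)"
    "Phi N g = (\<Sum>m\<in>?M. Poly_Mapping.lookup g m * det_ev N m)"
    by (auto intro!: Phi_superset)
  ultimately show ?thesis
    by (simp add: lookup_add algebra_simps sum.distrib)
qed

lemma Phi_sum: "Phi N (\<Sum>i\<in>I. f i) = (\<Sum>i\<in>I. Phi N (f i))"
  by (induction I rule: infinite_finite_induct) (auto simp: Phi_add)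

lemma Phi_single [simp]: "Phi N (Poly_Mapping.single m c) = c * det_ev N m"
  by (simp add: Phi_def)

lemma Phi_mconst_mult: "Phi N (mconst c * f) = c * Phi N f"
proof -
  have "Phi N (mconst c * f) = (\<Sum>m\<in>Poly_Mapping.keys f. Poly_Mapping.lookup (mconst c * f) m * det_ev N m)"
    by (rule Phi_superset) (auto simp: in_keys_iff lookup_mconst_mult)
  then show ?thesis
    by (simp add: Phi_def lookup_mconst_mult sum_distrib_left mult.assoc)
qed

lemma Phi_diff: "Phi N (f - g) = Phi N f - Phi N g"
  using Phi_add[of N "f - g" g] by simp

lemma Phi_xpow_mult:
  "Phi N (xpow n * f) = (\<Sum>m\<in>Poly_Mapping.keys f. Poly_Mapping.lookup f m * det_ev N (n + m))"
  by (subst (1) poly_mapping_eq_sum_single[of f]) (simp add: sum_distrib_left Phi_sum mult_single)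

text \<open>Differentiating \<open>f(\<partial>) D\<^sub>N\<close> along \<open>n\<close> and
  evaluating at the origin extracts its coefficient at \<open>n\<close>, up to the
  factorial.\<close>

lemma Phi_eq_pairing:
  "of_nat (mfact n) * Poly_Mapping.lookup (poly_diff f (generic_sym_det N)) n = Phi N (xpow n * f)"
proof -
  have "of_nat (mfact n) * Poly_Mapping.lookup (poly_diff f (generic_sym_det N)) n =
      (\<Sum>m\<in>Poly_Mapping.keys f. Poly_Mapping.lookup f m *
        (of_nat (mfact n) * Poly_Mapping.lookup (mon_diff m (generic_sym_det N)) n))"
    by (simp add: poly_diff_def lookup_sum lookup_mconst_mult sum_distrib_left ac_simps)
  then show ?thesis
    by (simp add: lookup_mon_diff Phi_xpow_mult det_ev_def)
qed

text \<open>The radical of the pairing. The test polynomials may involve indeterminates outside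
  \<open>sym_indices N\<close>, where \<open>det_ev\<close> vanishes anyway; this makes closure
  under all multiplications immediate.\<close>

definition nul :: "nat \<Rightarrow> 'k::field mpoly \<Rightarrow> bool" where
  "nul N f \<longleftrightarrow> (\<forall>g. Phi N (g * f) = 0)"

lemma nul_mult: "nul N f \<Longrightarrow> nul N (h * f)"
  by (simp add: nul_def mult.assoc[symmetric])

lemma nul_mult_right: "nul N f \<Longrightarrow> nul N (f * h)"
  using nul_mult by (simp add: mult.commute)

lemma nul_zero [simp]: "nul N 0"
  by (simp add: nul_def)

lemma nul_add: "nul N f \<Longrightarrow> nul N g \<Longrightarrow> nul N (f + g)"
  by (simp add: nul_def distrib_left Phi_add)

lemma nul_uminus: "nul N f \<Longrightarrow> nul N (- f)"
  using nul_mult[of N f "- 1"] by simp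

lemma nul_diff: "nul N f \<Longrightarrow> nul N g \<Longrightarrow> nul N (f - g)"
  using nul_add[of N f "- g"] nul_uminus[of N g] by simp

lemma nul_sum: "(\<And>i. i \<in> I \<Longrightarrow> nul N (f i)) \<Longrightarrow> nul N (\<Sum>i\<in>I. f i)"
  by (induction I rule: infinite_finite_induct) (auto intro: nul_add)

lemma nul_iff_xpow: "nul N f \<longleftrightarrow> (\<forall>n. Phi N (xpow n * f) = 0)"
proof
  assume *: "\<forall>n. Phi N (xpow n * f) = 0"
  show "nul N f"
    unfolding nul_def
  proof
    fix g :: "'a mpoly"
    have "g * f = (\<Sum>m\<in>Poly_Mapping.keys g. mconst (Poly_Mapping.lookup g m) * (xpow m * f))"
      by (subst poly_mapping_eq_sum_single[of g])
        (simp add: sum_distrib_right mconst_def mult.assoc[symmetric] mult_single)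
    then show "Phi N (g * f) = 0"
      using * by (simp add: Phi_sum Phi_mconst_mult)
  qed
qed (auto simp: nul_def)

lemma nul_singleI:
  "(\<And>n. det_ev N (n + m) = (0::'k::field)) \<Longrightarrow> nul N (Poly_Mapping.single m (c::'k))"
  by (auto simp: nul_iff_xpow mult_single)

section \<open>Monomial derivatives of the generic symmetric determinant\<close>

definition edge :: "nat \<Rightarrow> nat \<Rightarrow> nat \<times> nat" where
  "edge i j = (min i j, max i j)"

abbreviation edge_mon :: "nat \<Rightarrow> nat \<Rightarrow> monomial" where
  "edge_mon i j \<equiv> var_mon (edge i j)"

definition perm_mon :: "nat \<Rightarrow> (nat \<Rightarrow> nat) \<Rightarrow> monomial" where
  "perm_mon N \<pi> = (\<Sum>r<N. edge_mon r (\<pi> r))"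

lemma edge_commute: "edge i j = edge j i"
  by (auto simp: edge_def)

lemma edge_eq_iff: "edge i j = edge k l \<longleftrightarrow> i = k \<and> j = l \<or> i = l \<and> j = k"
  by (auto simp: edge_def min_def max_def split: if_splits)

lemma wt_edge_mon: "wt l (edge_mon i j) = of_bool (i = l) + of_bool (j = l)"
  by (auto simp: wt_var_mon edge_def min_def max_def)

lemma lookup_edge_eq_0:
  assumes "wt i n = 0"
  shows "Poly_Mapping.lookup n (edge i j) = 0" "Poly_Mapping.lookup n (edge j i) = 0"
  using lookup_le_wt[of n "edge i j"] lookup_le_wt_snd[of n "edge i j"] assms
  by (cases "i \<le> j"; simp add: edge_def edge_commute[of j i])+

text \<open>Each index occurs exactly once as a row and once as a column in a term of the Leibniz
  expansion.\<close>

lemma wt_perm_mon: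
  assumes "\<pi> permutes {..<N}"
  shows "wt l (perm_mon N \<pi>) = (if l < N then 2 else 0)"
proof -
  have "(\<Sum>r<N. of_bool (\<pi> r = l)) = (\<Sum>r<N. of_bool (r = l) :: nat)"
    using sum.permute[OF assms, of "\<lambda>r. of_bool (r = l) :: nat"] by (simp add: o_def)
  moreover have "(\<Sum>r<N. of_bool (r = l) :: nat) = of_bool (l < N)"
    by (simp add: of_bool_def)
  ultimately show ?thesis
    by (simp add: perm_mon_def wt_sum wt_edge_mon sum.distrib)
qed

lemma lookup_perm_mon:
  "Poly_Mapping.lookup (perm_mon N \<pi>) v = card {r. r < N \<and> edge r (\<pi> r) = v}"
proof -
  have "Poly_Mapping.lookup (perm_mon N \<pi>) v = (\<Sum>r<N. if edge r (\<pi> r) = v then 1 else 0)"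
    by (simp add: perm_mon_def lookup_sum lookup_var_mon of_bool_def)
  also have "\<dots> = card ({..<N} \<inter> {r. edge r (\<pi> r) = v})"
    by (simp add: sum.If_cases)
  also have "{..<N} \<inter> {r. edge r (\<pi> r) = v} = {r. r < N \<and> edge r (\<pi> r) = v}"
    by auto
  finally show ?thesis .
qed

lemma lookup_perm_mon_pos:
  "r < N \<Longrightarrow> Poly_Mapping.lookup (perm_mon N \<pi>) (edge r (\<pi> r)) > 0"
  by (auto simp: lookup_perm_mon card_gt_0_iff)

lemma keys_perm_mon:
  assumes "\<pi> permutes {..<N}"
  shows "Poly_Mapping.keys (perm_mon N \<pi>) \<subseteq> sym_indices N"
proof
  fix v assume "v \<in> Poly_Mapping.keys (perm_mon N \<pi>)"
  then have "{r. r < N \<and> edge r (\<pi> r) = v} \<noteq> {}"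
    unfolding in_keys_iff lookup_perm_mon by (metis card.empty)
  then obtain r where r: "r < N" "v = edge r (\<pi> r)"
    by blast
  then have "\<pi> r < N"
    using permutes_in_image[OF assms, of r] by simp
  with r show "v \<in> sym_indices N"
    by (simp add: sym_indices_def edge_def)
qed

text \<open>In a symmetric matrix a permutation and its inverse give the same term, so a coefficient
  is a signed count over a fibre of \<open>perm_mon\<close>.\<close>

lemma lookup_generic_sym_det:
  "Poly_Mapping.lookup (generic_sym_det N) m =
    (\<Sum>\<pi> | \<pi> permutes {..<N} \<and> perm_mon N \<pi> = m. of_int (sign \<pi>) :: 'k::field)"
proof -
  have prod_xpow: "(\<Prod>i\<in>I. xpow (f i)) = (xpow (\<Sum>i\<in>I. f i) :: 'k mpoly)" for f :: "nat \<Rightarrow> monomial" and I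
    by (induction I rule: infinite_finite_induct) (auto simp: mult_single)
  have "(generic_sym_det N :: 'k mpoly) = (\<Sum>\<pi> | \<pi> permutes {..<N}.
      of_int (sign \<pi>) * (\<Prod>r<N. xpow (edge_mon r (\<pi> r))))"
    unfolding generic_sym_det_def
    by (subst det_def'[of _ N])
      (auto simp: atLeast0LessThan indet_eq_xpow edge_def dest: permutes_in_image intro!: sum.cong)
  also have "\<dots> = (\<Sum>\<pi> | \<pi> permutes {..<N}. Poly_Mapping.single (perm_mon N \<pi>) (of_int (sign \<pi>)))"
    by (simp add: prod_xpow perm_mon_def[symmetric] single_of_int[symmetric] mult_single del: single_of_int)
  finally have "Poly_Mapping.lookup (generic_sym_det N) m =
      (\<Sum>\<pi> | \<pi> permutes {..<N}. if perm_mon N \<pi> = m then of_int (sign \<pi>) else 0 :: 'k)"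
    by (simp add: lookup_sum lookup_single when_def)
  also have "\<dots> = (\<Sum>\<pi> | \<pi> permutes {..<N} \<and> perm_mon N \<pi> = m. of_int (sign \<pi>))"
    by (simp add: sum.If_cases finite_permutations Collect_conj_eq)
  finally show ?thesis .
qed

lemma lookup_generic_sym_det_nonzero:
  assumes "Poly_Mapping.lookup (generic_sym_det N) m \<noteq> (0::'k::field)"
  shows "wt l m = (if l < N then 2 else 0)" "Poly_Mapping.keys m \<subseteq> sym_indices N"
proof -
  have "\<exists>\<pi>. \<pi> permutes {..<N} \<and> perm_mon N \<pi> = m"
  proof (rule ccontr)
    assume "\<not> ?thesis"
    then have "{\<pi>. \<pi> permutes {..<N} \<and> perm_mon N \<pi> = m} = {}"
      by blast
    then show False
      using assms unfolding lookup_generic_sym_det by (metis sum.empty)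
  qed
  then show "wt l m = (if l < N then 2 else 0)" "Poly_Mapping.keys m \<subseteq> sym_indices N"
    using wt_perm_mon keys_perm_mon by blast+
qed

lemma det_ev_nonzero:
  assumes "det_ev N m \<noteq> (0::'k::field)"
  shows "wt l m = (if l < N then 2 else 0)" "Poly_Mapping.keys m \<subseteq> sym_indices N"
  using assms lookup_generic_sym_det_nonzero[of N m, where 'k = 'k] by (auto simp: det_ev_def)

lemma det_ev_eq_0: "l < N \<Longrightarrow> wt l m \<noteq> 2 \<Longrightarrow> det_ev N m = (0::'k::field)"
  using det_ev_nonzero(1)[of N m l, where 'k = 'k] by auto

section \<open>Products of diagonal variables\<close>

definition loops :: "nat set \<Rightarrow> monomial" where
  "loops S = (\<Sum>i\<in>S. var_mon (i, i))"

lemma loops_empty [simp]: "loops {} = 0"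
  by (simp add: loops_def)

lemma loops_insert: "finite S \<Longrightarrow> i \<notin> S \<Longrightarrow> loops (insert i S) = loops S + var_mon (i, i)"
  by (simp add: loops_def add.commute)

lemma lookup_loops:
  "finite S \<Longrightarrow> Poly_Mapping.lookup (loops S) v = of_bool (fst v = snd v \<and> fst v \<in> S)"
  by (induction S rule: finite_induct)
    (auto simp: loops_insert lookup_add lookup_var_mon prod_eq_iff)

lemma wt_loops: "finite S \<Longrightarrow> wt i (loops S) = (if i \<in> S then 2 else 0)"
  by (induction S rule: finite_induct) (auto simp: loops_insert wt_add wt_var_mon)

lemma mon_degree_loops: "finite S \<Longrightarrow> mon_degree (loops S) = card S"
  by (induction S rule: finite_induct) (auto simp: loops_insert mon_degree_eq_wsum wsum_add)

lemma keys_loops: "S \<subseteq> {..<N} \<Longrightarrow> Poly_Mapping.keys (loops S) \<subseteq> sym_indices N"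
  using finite_subset[of S "{..<N}"] by (auto simp: in_keys_iff lookup_loops sym_indices_def)

text \<open>Only the identity permutation yields the product of all diagonal entries. This value 1
  certifies in every characteristic that the pairing is not zero.\<close>

lemma det_ev_loops: "det_ev N (loops {..<N}) = (1::'k::field)"
proof -
  have "mfact (loops S) = 1" if "finite S" for S
    using that
    by (induction S rule: finite_induct)
      (auto simp: loops_insert mfact_add_var_mon lookup_loops simp del: One_nat_def, simp add: mfact_def)
  moreover have "{\<pi>. \<pi> permutes {..<N} \<and> perm_mon N \<pi> = loops {..<N}} = {id}"
  proof (rule Set.set_eqI)
    fix \<pi> :: "nat \<Rightarrow> nat"
    have "\<pi> = id" if \<pi>: "\<pi> permutes {..<N}" "perm_mon N \<pi> = loops {..<N}"
    proof
      fix r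
      show "\<pi> r = id r"
      proof (cases "r < N")
        case True
        then have "fst (edge r (\<pi> r)) = snd (edge r (\<pi> r))"
          using lookup_perm_mon_pos[of r N \<pi>] \<pi> by (auto simp: lookup_loops split: if_splits)
        then show ?thesis
          by (auto simp: edge_def min_def max_def split: if_splits)
      next
        case False
        then show ?thesis
          using permutes_not_in[OF \<pi>(1)] by auto
      qed
    qed
    moreover have "perm_mon N id = loops {..<N}"
      by (simp add: perm_mon_def loops_def edge_def)
    ultimately show "\<pi> \<in> {\<pi>. \<pi> permutes {..<N} \<and> perm_mon N \<pi> = loops {..<N}} \<longleftrightarrow> \<pi> \<in> {id}"
      using permutes_id by auto
  qed
  ultimately show ?thesis
    by (simp add: det_ev_def lookup_generic_sym_det)
qed

text \<open>Each side is completed by the edges that the other one has lost, which avoids truncated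
  subtraction of monomials.\<close>

lemma perm_mon_swap:
  assumes "i < N" "j < N" "i \<noteq> j"
  shows "perm_mon N (\<pi> \<circ> transpose i j) + edge_mon i (\<pi> i) + edge_mon j (\<pi> j) =
    perm_mon N \<pi> + edge_mon i (\<pi> j) + edge_mon j (\<pi> i)"
proof -
  have split: "perm_mon N \<sigma> = edge_mon i (\<sigma> i) + edge_mon j (\<sigma> j) + (\<Sum>r\<in>{..<N} - {i} - {j}. edge_mon r (\<sigma> r))" for \<sigma>
    using assms by (simp add: perm_mon_def sum.remove[of _ i] sum.remove[of "{..<N} - {i}" j] add.assoc)
  have "(\<Sum>r\<in>{..<N} - {i} - {j}. edge_mon r ((\<pi> \<circ> transpose i j) r)) = (\<Sum>r\<in>{..<N} - {i} - {j}. edge_mon r (\<pi> r))"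
    by (rule sum.cong) auto
  then show ?thesis
    unfolding split[of \<pi>] split[of "\<pi> \<circ> transpose i j"] by (simp add: ac_simps)
qed

text \<open>Composition with the transposition of \<open>i\<close> and \<open>j\<close>
  short-circuits the passage \<open>j \<rightarrow> i \<rightarrow> k\<close> into
  \<open>j \<rightarrow> k\<close> and makes \<open>i\<close> a fixed point. It is an involution
  between the two index sets and reverses the sign.\<close>

lemma sum_sign_swap:
  assumes "i < N" "j < N" "i \<noteq> j"
  shows "(\<Sum>\<pi> | \<pi> permutes {..<N} \<and> perm_mon N \<pi> = n + edge_mon i j + edge_mon i k \<and> \<pi> j = i \<and> \<pi> i = k.
      of_int (sign \<pi>) :: 'k::field) =
    - (\<Sum>\<pi> | \<pi> permutes {..<N} \<and> perm_mon N \<pi> = n + edge_mon i i + edge_mon j k \<and> \<pi> i = i \<and> \<pi> j = k.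
      of_int (sign \<pi>))"
    (is "(\<Sum>\<pi>\<in>?P. _) = - (\<Sum>\<pi>\<in>?Q. _)")
proof -
  let ?t = "transpose i j"
  have t: "?t permutes {..<N}"
    using assms by (intro permutes_swap_id) auto
  have sgn: "sign (\<pi> \<circ> ?t) = - sign \<pi>" if "\<pi> permutes {..<N}" for \<pi>
  proof -
    have "permutation \<pi>" "permutation ?t"
      using that t by (auto simp: permutation_permutes)
    then show ?thesis
      using assms by (simp add: sign_compose sign_swap_id)
  qed
  have PQ: "\<pi> \<circ> ?t \<in> ?Q" if "\<pi> \<in> ?P" for \<pi>
  proof -
    from that have \<pi>: "\<pi> permutes {..<N}" "perm_mon N \<pi> = n + edge_mon i j + edge_mon i k" "\<pi> j = i" "\<pi> i = k"
      by auto
    have "perm_mon N (\<pi> \<circ> ?t) + (edge_mon i k + edge_mon i j) =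
        (n + edge_mon i i + edge_mon j k) + (edge_mon i k + edge_mon i j)"
      using perm_mon_swap[OF assms, of \<pi>] by (simp add: \<pi> ac_simps edge_commute[of j i])
    then show ?thesis
      using permutes_compose[OF t \<pi>(1)] \<pi> by (simp only: add_right_cancel) simp
  qed
  have QP: "\<pi> \<circ> ?t \<in> ?P" if "\<pi> \<in> ?Q" for \<pi>
  proof -
    from that have \<pi>: "\<pi> permutes {..<N}" "perm_mon N \<pi> = n + edge_mon i i + edge_mon j k" "\<pi> i = i" "\<pi> j = k"
      by auto
    have "perm_mon N (\<pi> \<circ> ?t) + (edge_mon i i + edge_mon j k) =
        (n + edge_mon i j + edge_mon i k) + (edge_mon i i + edge_mon j k)"
      using perm_mon_swap[OF assms, of \<pi>] by (simp add: \<pi> ac_simps edge_commute[of j i])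
    then show ?thesis
      using permutes_compose[OF t \<pi>(1)] \<pi> by (simp only: add_right_cancel) simp
  qed
  have "(\<Sum>\<pi>\<in>?P. of_int (sign \<pi>) :: 'k) = (\<Sum>\<pi>\<in>?Q. - of_int (sign \<pi>))"
  proof (rule sum.reindex_bij_witness[of _ "\<lambda>\<pi>. \<pi> \<circ> ?t" "\<lambda>\<pi>. \<pi> \<circ> ?t"])
    show "- of_int (sign (\<pi> \<circ> ?t)) = (of_int (sign \<pi>) :: 'k)" if "\<pi> \<in> ?P" for \<pi>
      using that sgn by simp
  qed (use PQ QP in \<open>auto simp only: o_assoc[symmetric] transpose_comp_involutory comp_id\<close>)
  then show ?thesis
    by (simp add: sum_negf)
qed

text \<open>
  The relations \<open>d\<^sub>i\<^sub>j d\<^sub>i\<^sub>k + d\<^sub>i\<^sub>i d\<^sub>j\<^sub>k = 0\<close> and \<open>d\<^sub>i\<^sub>j\<^sup>2 + 2 d\<^sub>i\<^sub>i d\<^sub>j\<^sub>j = 0\<close> of \<open>A\<^sub>N\<close>.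
\<close>

lemma det_ev_exchange:
  assumes ij: "i \<noteq> j" "i \<noteq> k" "i < N" "j < N" "k < N"
  shows "det_ev N (n + edge_mon i j + edge_mon i k) =
    - (if j = k then 2 else 1) * (det_ev N (n + edge_mon i i + edge_mon j k) :: 'k::field)"
    (is "det_ev N ?p = _ * det_ev N ?q")
proof (cases "wt i n = 0 \<and> (j = k \<longrightarrow> wt j n = 0)")
  case False
  \<comment> \<open>Here both monomials have a vertex of degree greater than 2, so both values are
    zero.\<close>
  then consider "wt i n \<noteq> 0" | "j = k" "wt j n \<noteq> 0"
    by (cases "j = k") auto
  then have "det_ev N ?p = (0::'k) \<and> det_ev N ?q = (0::'k)"
  proof cases
    case 1
    then have "wt i ?p \<noteq> 2" "wt i ?q \<noteq> 2"
      using ij by (simp_all add: wt_add wt_edge_mon)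
    then show ?thesis
      using det_ev_eq_0 ij by blast
  next
    case 2
    then have "wt j ?p \<noteq> 2" "wt j ?q \<noteq> 2"
      using ij by (simp_all add: wt_add wt_edge_mon)
    then show ?thesis
      using det_ev_eq_0 ij by blast
  qed
  then show ?thesis
    by simp
next
  case True
  define C :: "((nat \<Rightarrow> nat) \<Rightarrow> bool) \<Rightarrow> 'k" where
    "C P = (\<Sum>\<pi> | \<pi> permutes {..<N} \<and> P \<pi>. of_int (sign \<pi>))" for P
  have coeff: "Poly_Mapping.lookup (generic_sym_det N) m = C (\<lambda>\<pi>. perm_mon N \<pi> = m)" for m
    by (simp add: C_def lookup_generic_sym_det)
  have Ccong: "C P = C Q" if "\<And>\<pi>. \<pi> permutes {..<N} \<Longrightarrow> P \<pi> \<longleftrightarrow> Q \<pi>" for P Q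
    unfolding C_def using that by (intro sum.cong) auto
  have swap: "C (\<lambda>\<pi>. perm_mon N \<pi> = n + edge_mon i j + edge_mon i k \<and> \<pi> j = i \<and> \<pi> i = k) =
      - C (\<lambda>\<pi>. perm_mon N \<pi> = n + edge_mon i i + edge_mon j k \<and> \<pi> i = i \<and> \<pi> j = k)"
    if "i \<noteq> j" "j < N" for j k
    unfolding C_def using ij that by (intro sum_sign_swap) auto
  have n0: "Poly_Mapping.lookup n (edge i r) = 0" for r
    using True lookup_edge_eq_0 by auto
  \<comment> \<open>No edge of \<open>n\<close> meets \<open>i\<close>, so a permutation with
    monomial \<open>?p\<close> can enter and leave \<open>i\<close> only through \<open>j\<close> or
    \<open>k\<close>.\<close>
  have P_edges: "\<pi> i \<in> {j, k} \<and> (\<pi> j = i \<or> \<pi> k = i)" if \<pi>: "\<pi> permutes {..<N}" "perm_mon N \<pi> = ?p" for \<pi>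
  proof
    have "Poly_Mapping.lookup ?p (edge i (\<pi> i)) > 0"
      using lookup_perm_mon_pos[of i N \<pi>] ij \<pi> by simp
    then show "\<pi> i \<in> {j, k}"
      using n0 ij by (auto simp: lookup_add lookup_var_mon edge_eq_iff split: if_splits)
    obtain r where r: "r < N" "\<pi> r = i"
      using permutes_image[OF \<pi>(1)] ij by (metis imageE lessThan_iff)
    then have "Poly_Mapping.lookup ?p (edge i r) > 0"
      using lookup_perm_mon_pos[of r N \<pi>] \<pi> by (simp add: edge_commute)
    then have "r = j \<or> r = k"
      using n0 ij by (auto simp: lookup_add lookup_var_mon edge_eq_iff split: if_splits)
    then show "\<pi> j = i \<or> \<pi> k = i"
      using r by auto
  qed
  have Q_edges: "\<pi> i = i" if \<pi>: "\<pi> permutes {..<N}" "perm_mon N \<pi> = ?q" for \<pi>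
  proof -
    have "Poly_Mapping.lookup ?q (edge i (\<pi> i)) > 0"
      using lookup_perm_mon_pos[of i N \<pi>] ij \<pi> by simp
    then show "\<pi> i = i"
      using n0 ij by (auto simp: lookup_add lookup_var_mon edge_eq_iff split: if_splits)
  qed
  have mfq: "mfact ?q = (Poly_Mapping.lookup n (edge j k) + 1) * mfact n"
    using n0 ij by (simp only: mfact_add_var_mon lookup_add lookup_var_mon)
      (auto simp: edge_eq_iff n0)
  show ?thesis
  proof (cases "j = k")
    case jk: True
    have "wt j n = 0"
      using True jk by blast
    then have n0': "Poly_Mapping.lookup n (edge j j) = 0"
      using lookup_edge_eq_0 by blast
    have "C (\<lambda>\<pi>. perm_mon N \<pi> = ?p) = C (\<lambda>\<pi>. perm_mon N \<pi> = ?p \<and> \<pi> j = i \<and> \<pi> i = k)"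
      using P_edges jk by (intro Ccong) auto
    also have "\<dots> = - C (\<lambda>\<pi>. perm_mon N \<pi> = ?q \<and> \<pi> i = i \<and> \<pi> j = k)"
      using swap ij by blast
    also have "C (\<lambda>\<pi>. perm_mon N \<pi> = ?q \<and> \<pi> i = i \<and> \<pi> j = k) = C (\<lambda>\<pi>. perm_mon N \<pi> = ?q)"
    proof (rule Ccong)
      fix \<pi> assume \<pi>: "\<pi> permutes {..<N}"
      have "\<pi> j = j" if "perm_mon N \<pi> = ?q"
      proof -
        have "Poly_Mapping.lookup (perm_mon N \<pi>) (edge j j) \<noteq> 0"
          using that jk by (simp add: lookup_add lookup_var_mon)
        then obtain r where "edge r (\<pi> r) = edge j j"
          unfolding lookup_perm_mon by (auto simp: card_eq_0_iff)
        then show ?thesis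
          by (auto simp: edge_eq_iff)
      qed
      then show "perm_mon N \<pi> = ?q \<and> \<pi> i = i \<and> \<pi> j = k \<longleftrightarrow> perm_mon N \<pi> = ?q"
        using Q_edges[OF \<pi>] jk by auto
    qed
    finally have "C (\<lambda>\<pi>. perm_mon N \<pi> = ?p) = - C (\<lambda>\<pi>. perm_mon N \<pi> = ?q)" .
    \<comment> \<open>The exponent 2 of the edge between \<open>i\<close> and \<open>j\<close> is
      the source of the factor 2 in this case.\<close>
    moreover have "mfact ?p = 2 * mfact n"
      using n0 ij jk by (simp only: mfact_add_var_mon lookup_add lookup_var_mon) (auto simp: n0)
    ultimately show ?thesis
      unfolding det_ev_def coeff using mfq n0' jk by (simp add: algebra_simps)
  next
    case jk: False
    let ?e = "Poly_Mapping.lookup n (edge j k)"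
    \<comment> \<open>A 2-cycle through \<open>i\<close> would use one of these edges twice, while
      it has exponent 1 in \<open>?p\<close>.\<close>
    have excl: "\<not> (\<pi> j = i \<and> \<pi> i = j)" "\<not> (\<pi> k = i \<and> \<pi> i = k)" if \<pi>: "perm_mon N \<pi> = ?p" for \<pi>
    proof -
      have "\<not> (\<pi> l = i \<and> \<pi> i = l)" if l: "l \<in> {j, k}" for l
      proof
        assume "\<pi> l = i \<and> \<pi> i = l"
        then have "{i, l} \<subseteq> {r. r < N \<and> edge r (\<pi> r) = edge i l}"
          using l ij by (auto simp: edge_eq_iff)
        then have "card {i, l} \<le> Poly_Mapping.lookup (perm_mon N \<pi>) (edge i l)"
          unfolding lookup_perm_mon by (intro card_mono) auto
        moreover have "Poly_Mapping.lookup ?p (edge i l) = 1"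
          using l ij jk n0 by (auto simp: lookup_add lookup_var_mon edge_eq_iff)
        ultimately show False
          using \<pi> l ij by auto
      qed
      then show "\<not> (\<pi> j = i \<and> \<pi> i = j)" "\<not> (\<pi> k = i \<and> \<pi> i = k)"
        by auto
    qed
    \<comment> \<open>The path through \<open>i\<close> is traversed in exactly one of its two
      directions.\<close>
    have "C (\<lambda>\<pi>. perm_mon N \<pi> = ?p) =
        C (\<lambda>\<pi>. perm_mon N \<pi> = ?p \<and> \<pi> j = i \<and> \<pi> i = k) + C (\<lambda>\<pi>. perm_mon N \<pi> = ?p \<and> \<pi> k = i \<and> \<pi> i = j)"
      unfolding C_def
    proof (subst sum.union_disjoint[symmetric])
      show "{\<pi>. \<pi> permutes {..<N} \<and> perm_mon N \<pi> = ?p \<and> \<pi> j = i \<and> \<pi> i = k} \<inter>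
        {\<pi>. \<pi> permutes {..<N} \<and> perm_mon N \<pi> = ?p \<and> \<pi> k = i \<and> \<pi> i = j} = {}"
        using jk by auto
      show "(\<Sum>\<pi> | \<pi> permutes {..<N} \<and> perm_mon N \<pi> = ?p. of_int (sign \<pi>)) =
        (\<Sum>\<pi>\<in>{\<pi>. \<pi> permutes {..<N} \<and> perm_mon N \<pi> = ?p \<and> \<pi> j = i \<and> \<pi> i = k} \<union>
          {\<pi>. \<pi> permutes {..<N} \<and> perm_mon N \<pi> = ?p \<and> \<pi> k = i \<and> \<pi> i = j}. of_int (sign \<pi>) :: 'k)"
        using P_edges excl by (intro sum.cong) blast+
    qed (auto simp: finite_permutations)
    also have "C (\<lambda>\<pi>. perm_mon N \<pi> = ?p \<and> \<pi> j = i \<and> \<pi> i = k) =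
        - C (\<lambda>\<pi>. perm_mon N \<pi> = ?q \<and> \<pi> i = i \<and> \<pi> j = k)"
      using swap[of j k] ij by blast
    also have "C (\<lambda>\<pi>. perm_mon N \<pi> = ?p \<and> \<pi> k = i \<and> \<pi> i = j) =
        - C (\<lambda>\<pi>. perm_mon N \<pi> = ?q \<and> \<pi> i = i \<and> \<pi> k = j)"
      using swap[of k j] ij by (simp add: edge_commute[of k j] ac_simps)
    also have "- C (\<lambda>\<pi>. perm_mon N \<pi> = ?q \<and> \<pi> i = i \<and> \<pi> j = k) +
        - C (\<lambda>\<pi>. perm_mon N \<pi> = ?q \<and> \<pi> i = i \<and> \<pi> k = j) = - of_nat (?e + 1) * C (\<lambda>\<pi>. perm_mon N \<pi> = ?q)"
    proof -
      have C_of_bool: "C (\<lambda>\<pi>. perm_mon N \<pi> = ?q \<and> P \<pi>) =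
          (\<Sum>\<pi> | \<pi> permutes {..<N} \<and> perm_mon N \<pi> = ?q. of_nat (of_bool (P \<pi>)) * of_int (sign \<pi>))" for P
        unfolding C_def by (rule sum.mono_neutral_cong_left) (auto simp: finite_permutations)
      \<comment> \<open>Every permutation with monomial \<open>?q\<close> is reached once for each
        traversal of the edge between \<open>j\<close> and \<open>k\<close>, hence
        \<open>?e + 1\<close> times in total. The same factor in \<open>mfact ?q\<close> absorbs
        this multiplicity.\<close>
      have "of_bool (\<pi> i = i \<and> \<pi> j = k) + of_bool (\<pi> i = i \<and> \<pi> k = j) = ?e + 1"
        if \<pi>: "\<pi> permutes {..<N}" "perm_mon N \<pi> = ?q" for \<pi>
      proof -
        have "?e + 1 = Poly_Mapping.lookup ?q (edge j k)"
          using ij jk by (simp add: lookup_add lookup_var_mon edge_eq_iff)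
        also have "\<dots> = card {r. r < N \<and> edge r (\<pi> r) = edge j k}"
          using lookup_perm_mon[of N \<pi> "edge j k"] \<pi> by simp
        also have "{r. r < N \<and> edge r (\<pi> r) = edge j k} = {r. r = j \<and> \<pi> j = k} \<union> {r. r = k \<and> \<pi> k = j}"
          using ij by (auto simp: edge_eq_iff)
        also have "card \<dots> = of_bool (\<pi> j = k) + of_bool (\<pi> k = j)"
          using jk by (subst card_Un_disjoint) (auto simp: of_bool_def)
        finally show ?thesis
          using Q_edges[OF \<pi>] by simp
      qed
      then have "(\<Sum>\<pi> | \<pi> permutes {..<N} \<and> perm_mon N \<pi> = ?q.
          of_nat (of_bool (\<pi> i = i \<and> \<pi> j = k) + of_bool (\<pi> i = i \<and> \<pi> k = j)) * of_int (sign \<pi>)) =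
        (of_nat (?e + 1) * C (\<lambda>\<pi>. perm_mon N \<pi> = ?q))"
        unfolding C_def sum_distrib_left by (intro sum.cong) auto
      then have "C (\<lambda>\<pi>. perm_mon N \<pi> = ?q \<and> \<pi> i = i \<and> \<pi> j = k) +
          C (\<lambda>\<pi>. perm_mon N \<pi> = ?q \<and> \<pi> i = i \<and> \<pi> k = j) = of_nat (?e + 1) * C (\<lambda>\<pi>. perm_mon N \<pi> = ?q)"
        by (simp only: C_of_bool of_nat_add distrib_right sum.distrib)
      then show ?thesis
        by (metis (no_types) minus_add_distrib mult_minus_left)
    qed
    finally have coeff_p: "C (\<lambda>\<pi>. perm_mon N \<pi> = ?p) = - of_nat (?e + 1) * C (\<lambda>\<pi>. perm_mon N \<pi> = ?q)" .
    have "mfact ?p = mfact n"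
      using n0 ij jk by (simp only: mfact_add_var_mon lookup_add lookup_var_mon) (auto simp: n0 edge_eq_iff)
    then show ?thesis
      unfolding det_ev_def coeff coeff_p mfq using jk by (simp add: algebra_simps)
  qed
qed

section \<open>Reduction of monomials to matchings and loops\<close>

text \<open>The pairing determines the coefficients of \<open>f(\<partial>) D\<^sub>N\<close> up to
  factorials. Exponents in the determinant and its derivatives are at most 2, so these factorials
  are powers of 2 and can be cancelled.\<close>

lemma nul_iff_poly_diff:
  fixes f :: "'k::field mpoly"
  assumes two: "(2::'k) \<noteq> 0"
  shows "nul N f \<longleftrightarrow> poly_diff f (generic_sym_det N) = 0"
proof
  assume "poly_diff f (generic_sym_det N) = 0"
  then show "nul N f"
    by (simp add: nul_iff_xpow Phi_eq_pairing[symmetric])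
next
  assume nul: "nul N f"
  show "poly_diff f (generic_sym_det N) = 0"
  proof (rule poly_mapping_eqI, rule ccontr)
    fix n
    assume "Poly_Mapping.lookup (poly_diff f (generic_sym_det N)) n \<noteq> Poly_Mapping.lookup 0 n"
    then have *: "Poly_Mapping.lookup (poly_diff f (generic_sym_det N)) n \<noteq> 0"
      by simp
    have "\<exists>m. Poly_Mapping.lookup (mon_diff m (generic_sym_det N :: 'k mpoly)) n \<noteq> 0"
    proof (rule ccontr)
      assume "\<not> ?thesis"
      with * show False
        by (simp add: poly_diff_def lookup_sum lookup_mconst_mult)
    qed
    then obtain m where "Poly_Mapping.lookup (mon_diff m (generic_sym_det N :: 'k mpoly)) n \<noteq> 0"
      by blast
    then have "Poly_Mapping.lookup (generic_sym_det N) (n + m) \<noteq> (0::'k)"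
      using lookup_mon_diff_eq_0 by blast
    then have le: "wt i (n + m) \<le> 2" for i
      using lookup_generic_sym_det_nonzero(1)[of N "n + m" i, where 'k = 'k] by auto
    have "of_nat (fact (Poly_Mapping.lookup n v)) \<noteq> (0::'k)" for v
    proof -
      have "Poly_Mapping.lookup n v \<le> 2"
        using lookup_le_wt[of n v] le[of "fst v"] by (simp add: wt_add)
      then have "Poly_Mapping.lookup n v = 0 \<or> Poly_Mapping.lookup n v = 1 \<or> Poly_Mapping.lookup n v = 2"
        by auto
      then show ?thesis
        using two by (elim disjE) (simp_all add: fact_2)
    qed
    then have "of_nat (mfact n) \<noteq> (0::'k)"
      by (simp add: mfact_def)
    then show False
      using * nul Phi_eq_pairing[of n f N] by (simp add: nul_def)
  qed
qed

lemma sum_wt: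
  assumes "Poly_Mapping.keys m \<subseteq> sym_indices N"
  shows "(\<Sum>i<N. wt i m) = 2 * mon_degree m"
proof -
  have *: "(\<Sum>i<N. of_bool (fst v = i) + of_bool (snd v = i)) = (2::nat)" if "v \<in> Poly_Mapping.keys m" for v
    using that assms by (auto simp: sum.distrib sym_indices_def of_bool_def)
  have "(\<Sum>i<N. wt i m) = (\<Sum>v\<in>Poly_Mapping.keys m. \<Sum>i<N. Poly_Mapping.lookup m v * (of_bool (fst v = i) + of_bool (snd v = i)))"
    unfolding wt_def wsum_def by (rule sum.swap)
  also have "\<dots> = (\<Sum>v\<in>Poly_Mapping.keys m. Poly_Mapping.lookup m v * 2)"
    using * by (simp add: sum_distrib_left[symmetric])
  finally show ?thesis
    by (simp add: mon_degree_def sum_distrib_left mult.commute)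
qed

lemma wt_outside:
  assumes "Poly_Mapping.keys m \<subseteq> sym_indices N" "N \<le> i"
  shows "wt i m = 0"
  using assms by (force simp: wt_def wsum_def sym_indices_def)

lemma mon_degree_add: "mon_degree (m + n) = mon_degree m + mon_degree n"
  by (simp add: mon_degree_eq_wsum wsum_add)

lemma mon_degree_var_mon [simp]: "mon_degree (var_mon v) = 1"
  by (simp add: mon_degree_eq_wsum)

lemma det_ev_nonzero_degree:
  assumes "det_ev N m \<noteq> (0::'k::field)"
  shows "mon_degree m = N"
proof -
  have "(\<Sum>i<N. wt i m) = (\<Sum>i<N. 2)"
    using det_ev_nonzero(1)[OF assms] by simp
  then show ?thesis
    using sum_wt[OF det_ev_nonzero(2)[OF assms]] by simp
qed

lemma keys_add_nat: "Poly_Mapping.keys (m + n) = Poly_Mapping.keys m \<union> Poly_Mapping.keys (n :: 'v \<Rightarrow>\<^sub>0 nat)"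
  by (auto simp: in_keys_iff lookup_add)

lemma nul_xpow_heavy: "wt i m > 2 \<Longrightarrow> nul N (Poly_Mapping.single m (c::'k::field))"
proof (rule nul_singleI, rule ccontr)
  fix n
  assume "wt i m > 2" "det_ev N (n + m) \<noteq> (0::'k)"
  then show False
    using det_ev_nonzero(1)[of N "n + m" i, where 'k = 'k] by (auto simp: wt_add split: if_splits)
qed

text \<open>
  A monomial is a multigraph on the vertices \<open>0, \<dots>, N - 1\<close>, and \<open>wt i\<close> is the degree of the vertex \<open>i\<close>.
\<close>

definition matching :: "nat \<Rightarrow> monomial \<Rightarrow> bool" where
  "matching N \<mu> \<longleftrightarrow> Poly_Mapping.keys \<mu> \<subseteq> sym_indices N \<and> (\<forall>i. wt i \<mu> \<le> 1)"

definition free :: "nat \<Rightarrow> monomial \<Rightarrow> nat set" where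
  "free N \<mu> = {i. i < N \<and> wt i \<mu> = 0}"

lemma finite_free [simp]: "finite (free N \<mu>)"
  by (simp add: free_def)

lemma finite_subset_free: "S \<subseteq> free N \<mu> \<Longrightarrow> finite S"
  using finite_subset finite_free by blast

lemma card_free:
  assumes "matching N \<mu>"
  shows "2 * mon_degree \<mu> + card (free N \<mu>) = N"
proof -
  have "wt i \<mu> + of_bool (wt i \<mu> = 0) = 1" for i
  proof -
    have "wt i \<mu> \<le> 1"
      using assms by (auto simp: matching_def)
    then show ?thesis
      by (cases "wt i \<mu>") auto
  qed
  then have "(\<Sum>i<N. wt i \<mu> + of_bool (wt i \<mu> = 0)) = (\<Sum>i<N. 1)"
    by (simp only:)
  then have "(\<Sum>i<N. wt i \<mu>) + (\<Sum>i<N. of_bool (wt i \<mu> = 0)) = N"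
    unfolding sum.distrib by simp
  moreover have "(\<Sum>i<N. of_bool (wt i \<mu> = 0)) = card (free N \<mu>)"
  proof -
    have "(\<Sum>i<N. of_bool (wt i \<mu> = 0)) = card ({..<N} \<inter> {i. wt i \<mu> = 0})"
      by (simp add: of_bool_def sum.If_cases)
    also have "{..<N} \<inter> {i. wt i \<mu> = 0} = free N \<mu>"
      by (auto simp: free_def)
    finally show ?thesis .
  qed
  ultimately show ?thesis
    using sum_wt[of \<mu> N] assms by (simp add: matching_def)
qed

lemma matching_zero [simp]: "matching N 0"
  by (simp add: matching_def)

lemma free_zero [simp]: "free N 0 = {..<N}"
  by (auto simp: free_def)

lemma obtain_edge:
  assumes "Poly_Mapping.keys m \<subseteq> sym_indices N" "wt i m > 0"
  obtains j n where "j < N" "m = n + edge_mon i j"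
proof -
  obtain v where v: "v \<in> Poly_Mapping.keys m" "fst v = i \<or> snd v = i"
    using assms(2) unfolding wt_def wsum_def
    by (auto elim!: sum.not_neutral_contains_not_neutral[OF less_imp_neq[THEN not_sym]] split: if_splits)
  define j where "j = (if fst v = i then snd v else fst v)"
  have "v \<in> sym_indices N"
    using v assms by auto
  then have j: "j < N" "v = edge i j"
    using v by (auto simp: j_def edge_def sym_indices_def)
  have "m = (m - var_mon v) + var_mon v"
    using v by (intro poly_mapping_eqI) (auto simp: lookup_add lookup_minus lookup_var_mon in_keys_iff)
  then show ?thesis
    using that j by blast
qed

text \<open>Induction on the number of edges that are not loops, counted with multiplicity: an
  exchange at a vertex of degree 2 without a loop replaces two such edges by at most one.\<close>

lemma xpow_reduce:
  assumes "Poly_Mapping.keys m \<subseteq> sym_indices N"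
  shows "nul N (xpow m :: 'k::field mpoly) \<or>
    (\<exists>\<mu> T c. matching N \<mu> \<and> T \<subseteq> free N \<mu> \<and> mon_degree m = mon_degree \<mu> + card T \<and>
      nul N (xpow m - Poly_Mapping.single (\<mu> + loops T) (c::'k)))"
  using assms
proof (induction "wsum (\<lambda>v. of_bool (fst v \<noteq> snd v)) m" arbitrary: m rule: less_induct)
  case less
  \<comment> \<open>In the second case every vertex of degree 2 carries a loop and nothing else, so
    the monomial is already a matching with loops on free vertices.\<close>
  consider i where "wt i m > 2" | "\<And>i. wt i m \<le> 2" "\<And>i. wt i m = 2 \<Longrightarrow> Poly_Mapping.lookup m (i, i) \<noteq> 0"
    | i where "wt i m = 2" "Poly_Mapping.lookup m (i, i) = 0"
    by (meson not_less)
  then show ?case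
  proof cases
    case 1
    then show ?thesis
      using nul_xpow_heavy by blast
  next
    case 2
    define T where "T = {i. i < N \<and> wt i m = 2}"
    define \<mu> where "\<mu> = m - loops T"
    have fin: "finite T"
      by (simp add: T_def)
    have "Poly_Mapping.lookup (loops T) v \<le> Poly_Mapping.lookup m v" for v
      using 2(2)[of "fst v"] fin by (cases v) (auto simp: lookup_loops T_def)
    then have m: "m = \<mu> + loops T"
      by (intro poly_mapping_eqI) (simp add: \<mu>_def lookup_add lookup_minus)
    have T: "i \<in> T \<longleftrightarrow> i < N \<and> wt i m = 2" for i
      by (simp add: T_def)
    have wt_m: "wt i m = wt i \<mu> + (if i \<in> T then 2 else 0)" for i
      by (subst m) (simp add: wt_add wt_loops fin)
    have "wt i \<mu> \<le> 1" for i
    proof (cases "i \<in> T")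
      case True
      then have "wt i m = 2"
        using T by blast
      then show ?thesis
        using wt_m[of i] True by simp
    next
      case False
      then have "wt i m \<noteq> 2"
        using T[of i] wt_outside[OF less.prems, of i] by linarith
      then show ?thesis
        using 2(1)[of i] wt_m[of i] False by simp
    qed
    moreover have "Poly_Mapping.keys m = Poly_Mapping.keys \<mu> \<union> Poly_Mapping.keys (loops T)"
      by (subst m) (rule keys_add_nat)
    then have "Poly_Mapping.keys \<mu> \<subseteq> sym_indices N"
      using less.prems by blast
    moreover have "T \<subseteq> free N \<mu>"
    proof
      fix i assume i: "i \<in> T"
      then have "i < N" "wt i m = 2"
        using T by blast+
      then show "i \<in> free N \<mu>"
        using wt_m[of i] i by (simp add: free_def)
    qed
    moreover have "mon_degree m = mon_degree \<mu> + card T"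
      using fin by (subst m) (simp add: mon_degree_add mon_degree_loops)
    moreover have "nul N (xpow m - Poly_Mapping.single (\<mu> + loops T) (1::'k))"
      using m by simp
    ultimately show ?thesis
      unfolding matching_def by blast
  next
    case 3
    obtain j n1 where n1: "j < N" "m = n1 + edge_mon i j"
      using obtain_edge[OF less.prems] 3 by (metis zero_less_numeral)
    have "j \<noteq> i"
      using 3 n1 by (auto simp: lookup_add lookup_var_mon edge_def)
    have "wt i n1 > 0"
      using 3 n1 \<open>j \<noteq> i\<close> by (simp add: wt_add wt_edge_mon)
    then obtain k n where n: "k < N" "n1 = n + edge_mon i k"
      using obtain_edge[of n1 N i] less.prems n1 by (auto simp: keys_add_nat)
    have "k \<noteq> i"
      using 3 n1 n by (auto simp: lookup_add lookup_var_mon edge_def)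
    have "i < N"
      using wt_outside[OF less.prems, of i] 3 by linarith
    note ij = \<open>j \<noteq> i\<close>[symmetric] \<open>k \<noteq> i\<close>[symmetric] \<open>i < N\<close> \<open>j < N\<close> \<open>k < N\<close>
    \<comment> \<open>The exchange at \<open>i\<close>: its two edges become a loop at
      \<open>i\<close> and an edge between \<open>j\<close> and \<open>k\<close>, which is itself a
      loop if \<open>j = k\<close>. This accounts for the coefficient \<open>c0\<close>.\<close>
    define m' where "m' = n + edge_mon i i + edge_mon j k"
    define c0 :: 'k where "c0 = - (if j = k then 2 else 1)"
    have m: "m = n + edge_mon i j + edge_mon i k"
      using n1 n by (simp add: ac_simps)
    have keys: "Poly_Mapping.keys m' \<subseteq> sym_indices N"
      using less.prems ij unfolding m m'_def by (auto simp: keys_add_nat sym_indices_def edge_def)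
    have "wsum (\<lambda>v. of_bool (fst v \<noteq> snd v)) m' < wsum (\<lambda>v. of_bool (fst v \<noteq> snd v)) m"
      using ij unfolding m m'_def by (auto simp: wsum_add edge_def min_def max_def)
    note IH = less.hyps[OF this keys]
    have deg: "mon_degree m' = mon_degree m"
      by (simp add: m m'_def mon_degree_add)
    have step: "nul N (xpow m - Poly_Mapping.single m' c0)"
      unfolding nul_iff_xpow
    proof
      fix r
      have "det_ev N (r + m) = c0 * det_ev N (r + m')"
        using det_ev_exchange[OF ij, of "r + n", where 'k = 'k] unfolding m m'_def c0_def by (simp add: add.assoc)
      then show "Phi N (xpow r * (xpow m - Poly_Mapping.single m' c0)) = 0"
        by (simp add: right_diff_distrib Phi_diff mult_single)
    qed
    have scale: "Poly_Mapping.single m'' (c0 * c) = mconst c0 * Poly_Mapping.single m'' c" for m'' c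
      by (simp add: mconst_def mult_single)
    from IH show ?thesis
    proof
      assume "nul N (xpow m' :: 'k mpoly)"
      then have "nul N (Poly_Mapping.single m' c0)"
        using nul_mult[of N "xpow m'" "mconst c0"] scale[of m' 1] by simp
      from nul_add[OF step this] show ?thesis
        by simp
    next
      assume "\<exists>\<mu> T c. matching N \<mu> \<and> T \<subseteq> free N \<mu> \<and> mon_degree m' = mon_degree \<mu> + card T \<and>
        nul N (xpow m' - Poly_Mapping.single (\<mu> + loops T) (c::'k))"
      then obtain \<mu> T and c :: 'k where *: "matching N \<mu>" "T \<subseteq> free N \<mu>" "mon_degree m' = mon_degree \<mu> + card T"
        and nul: "nul N (xpow m' - Poly_Mapping.single (\<mu> + loops T) c)"
        by blast
      have "xpow m - Poly_Mapping.single (\<mu> + loops T) (c0 * c) =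
          (xpow m - Poly_Mapping.single m' c0) + mconst c0 * (xpow m' - Poly_Mapping.single (\<mu> + loops T) c)"
        using scale[of m' 1] by (simp add: right_diff_distrib scale)
      then have "nul N (xpow m - Poly_Mapping.single (\<mu> + loops T) (c0 * c))"
        using nul_add[OF step nul_mult[OF nul, of "mconst c0"]] by (simp only:)
      then show ?thesis
        using * deg by metis
    qed
  qed
qed

text \<open>By symmetry of the pairing the reduction applies to the test monomial as well, so only
  matchings with loops need to be tested.\<close>

lemma nulI_matching:
  fixes f :: "'k::field mpoly"
  assumes "\<And>\<mu> T. matching N \<mu> \<Longrightarrow> T \<subseteq> free N \<mu> \<Longrightarrow> Phi N (xpow (\<mu> + loops T) * f) = 0"
  shows "nul N f"
  unfolding nul_iff_xpow
proof
  fix n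
  show "Phi N (xpow n * f) = 0"
  proof (cases "Poly_Mapping.keys n \<subseteq> sym_indices N")
    case False
    then have "det_ev N (n + m) = (0::'k)" for m
      using det_ev_nonzero(2)[of N "n + m", where 'k = 'k] by (auto simp: keys_add_nat)
    then show ?thesis
      by (simp add: Phi_xpow_mult)
  next
    case True
    from xpow_reduce[OF this, where 'k = 'k] show ?thesis
    proof
      assume "nul N (xpow n :: 'k mpoly)"
      then show ?thesis
        by (simp add: nul_def mult.commute)
    next
      assume "\<exists>\<mu> T c. matching N \<mu> \<and> T \<subseteq> free N \<mu> \<and> mon_degree n = mon_degree \<mu> + card T \<and>
        nul N (xpow n - Poly_Mapping.single (\<mu> + loops T) (c::'k))"
      then obtain \<mu> T and c :: 'k where *: "matching N \<mu>" "T \<subseteq> free N \<mu>"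
        and "nul N (xpow n - Poly_Mapping.single (\<mu> + loops T) c)"
        by blast
      then have "Phi N ((xpow n - mconst c * xpow (\<mu> + loops T)) * f) = 0"
        using nul_mult_right[of N _ f] by (simp add: nul_def mconst_def mult_single) (metis mult_1)
      then show ?thesis
        using assms[OF *] by (simp add: left_diff_distrib Phi_diff mult.assoc Phi_mconst_mult)
    qed
  qed
qed

section \<open>Powers of the trace form modulo the annihilator\<close>

abbreviation trace_poly :: "nat \<Rightarrow> 'k::field mpoly" where
  "trace_poly N \<equiv> \<Sum>i<N. indet (i, i)"

lemma component_degree:
  "f \<in> sym_poly_component N k \<Longrightarrow> m \<in> Poly_Mapping.keys f \<Longrightarrow> mon_degree m = k"
  by (simp add: sym_poly_component_def)

lemma Phi_xpow_degree:
  fixes f :: "'k::field mpoly"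
  assumes "f \<in> sym_poly_component N k" "mon_degree n + k \<noteq> N"
  shows "Phi N (xpow n * f) = 0"
proof -
  have "det_ev N (n + m) = (0::'k)" if "m \<in> Poly_Mapping.keys f" for m
    using det_ev_nonzero_degree[of N "n + m", where 'k = 'k] component_degree[OF assms(1) that] assms(2)
    by (auto simp: mon_degree_add)
  then show ?thesis
    by (simp add: Phi_xpow_mult)
qed

text \<open>A further loop at a vertex already covered by \<mu> or by a loop pushes its degree above
  2, so only the vertices of \<open>S\<close> contribute. Indexing by the complement of the loops
  makes the result a removal from \<open>S\<close>, that is, \<open>up\<close>.\<close>

lemma Phi_trace_step:
  fixes f :: "'k::field mpoly"
  assumes S: "S \<subseteq> free N \<mu>"
  shows "Phi N (xpow (\<mu> + loops (free N \<mu> - S)) * (trace_poly N * f)) =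
    up (\<lambda>S. Phi N (xpow (\<mu> + loops (free N \<mu> - S)) * f)) S"
proof -
  let ?I = "free N \<mu>"
  let ?m = "\<mu> + loops (?I - S)"
  have "Phi N (xpow ?m * (trace_poly N * f)) = (\<Sum>i<N. Phi N (xpow (?m + var_mon (i, i)) * f))"
    by (simp add: sum_distrib_left sum_distrib_right Phi_sum indet_eq_xpow mult_single mult.assoc[symmetric])
  also have "\<dots> = (\<Sum>i\<in>S. Phi N (xpow (?m + var_mon (i, i)) * f))"
  proof (rule sum.mono_neutral_right)
    show "S \<subseteq> {..<N}"
      using S by (auto simp: free_def)
    show "\<forall>i\<in>{..<N} - S. Phi N (xpow (?m + var_mon (i, i)) * f) = 0"
    proof
      fix i assume i: "i \<in> {..<N} - S"
      then have "wt i ?m > 0"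
        by (cases "i \<in> ?I") (auto simp: wt_add wt_loops free_def)
      then have "wt i (?m + var_mon (i, i)) > 2"
        by (simp add: wt_add wt_var_mon)
      then show "Phi N (xpow (?m + var_mon (i, i)) * f) = 0"
        using nul_xpow_heavy[of i _ N "1::'k"] by (simp add: nul_def mult.commute)
    qed
  qed simp
  also have "\<dots> = (\<Sum>i\<in>S. Phi N (xpow (\<mu> + loops (?I - (S - {i}))) * f))"
  proof (rule sum.cong)
    fix i assume i: "i \<in> S"
    have "loops (insert i (?I - S)) = loops (?I - S) + var_mon (i, i)"
      by (rule loops_insert) (use i in auto)
    moreover have "insert i (?I - S) = ?I - (S - {i})"
      using i S by auto
    ultimately show "Phi N (xpow (?m + var_mon (i, i)) * f) = Phi N (xpow (\<mu> + loops (?I - (S - {i}))) * f)"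
      by (simp add: add.assoc)
  qed simp
  finally show ?thesis
    by (simp add: up_def)
qed

lemma Phi_trace_pow:
  fixes f :: "'k::field mpoly"
  assumes "S \<subseteq> free N \<mu>"
  shows "Phi N (xpow (\<mu> + loops (free N \<mu> - S)) * (trace_poly N ^ q * f)) =
    (up ^^ q) (\<lambda>S. Phi N (xpow (\<mu> + loops (free N \<mu> - S)) * f)) S"
  using assms
proof (induction q arbitrary: S)
  case (Suc q)
  have "Phi N (xpow (\<mu> + loops (free N \<mu> - S)) * (trace_poly N ^ Suc q * f)) =
      up (\<lambda>S. Phi N (xpow (\<mu> + loops (free N \<mu> - S)) * (trace_poly N ^ q * f))) S"
    using Phi_trace_step[OF Suc.prems, of "trace_poly N ^ q * f"] by (simp add: mult.assoc)
  also have "\<dots> = up ((up ^^ q) (\<lambda>S. Phi N (xpow (\<mu> + loops (free N \<mu> - S)) * f))) S"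
    unfolding up_def[of _ S]
  proof (rule sum.cong)
    fix i assume "i \<in> S"
    show "Phi N (xpow (\<mu> + loops (free N \<mu> - (S - {i}))) * (trace_poly N ^ q * f)) =
        (up ^^ q) (\<lambda>S. Phi N (xpow (\<mu> + loops (free N \<mu> - S)) * f)) (S - {i})"
      by (rule Suc.IH) (use Suc.prems in auto)
  qed simp
  finally show ?case
    by simp
qed simp

text \<open>The pairings with \<mu> form an element of \<open>B\<^sub>n\<close> at level
  \<open>k - mon_degree \<mu>\<close> with \<open>n = N - 2 * mon_degree \<mu>\<close>, so the
  inequality on \<open>2 * k + q\<close> is inherited. A nonempty matching shortens the range of
  integers to be inverted; this is why only the empty one can contribute to the kernel in the middle
  degree.\<close>

lemma Phi_vanishes:
  fixes f :: "'k::field mpoly"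
  assumes f: "f \<in> sym_poly_component N k" and ker: "nul N (trace_poly N ^ q * f)"
    and q: "2 * k + q \<le> N"
    and nz: "\<And>j. 0 < j \<Longrightarrow> j + mon_degree \<mu> \<le> k + q \<Longrightarrow> of_nat j \<noteq> (0::'k)"
    and \<mu>: "matching N \<mu>" and T: "T \<subseteq> free N \<mu>"
  shows "Phi N (xpow (\<mu> + loops T) * f) = 0"
proof (cases "mon_degree (\<mu> + loops T) + k = N")
  case True
  define S where "S = free N \<mu> - T"
  have TS: "T = free N \<mu> - S"
    using T by (auto simp: S_def)
  have cT: "card T + card S = card (free N \<mu>)"
    using T card_mono[OF finite_free T] by (simp add: S_def card_Diff_subset[OF finite_subset_free])
  have "finite T"
    using T finite_subset_free by blast
  then have deg: "card S + mon_degree \<mu> = k"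
    using True cT card_free[OF \<mu>] by (simp add: mon_degree_add mon_degree_loops)
  define g where "g = (\<lambda>S. Phi N (xpow (\<mu> + loops (free N \<mu> - S)) * f))"
  have "g S = 0"
  proof (rule up_pow_injective[where I = "free N \<mu>" and k = "card S" and q = q])
    show "2 * card S + q \<le> card (free N \<mu>)"
      using deg q card_free[OF \<mu>] by linarith
    show "(up ^^ q) g R = 0" if "R \<subseteq> free N \<mu>" for R
      using Phi_trace_pow[OF that, of q f] ker by (simp add: nul_def g_def)
    show "of_nat j \<noteq> (0::'k)" if "0 < j" "j \<le> card S + q" for j
      using nz[of j] that deg by simp
    show "S \<subseteq> free N \<mu>"
      by (auto simp: S_def)
  qed auto
  then show ?thesis
    by (simp add: TS g_def)
next
  case False
  then show ?thesis
    using Phi_xpow_degree[OF f] by blast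
qed

lemma trace_pow_injective:
  fixes f :: "'k::field mpoly"
  assumes "f \<in> sym_poly_component N k" "nul N (trace_poly N ^ q * f)" "2 * k + q \<le> N"
    and "\<And>j. 0 < j \<Longrightarrow> j \<le> k + q \<Longrightarrow> of_nat j \<noteq> (0::'k)"
  shows "nul N f"
  by (rule nulI_matching, rule Phi_vanishes[OF assms(1-3)]) (use assms(4) in auto)

section \<open>Lifting elements of the squarefree algebra to polynomials\<close>

definition level :: "'i set \<Rightarrow> nat \<Rightarrow> 'i set set" where
  "level I a = {T. T \<subseteq> I \<and> card T = a}"

lemma finite_level [simp]: "finite I \<Longrightarrow> finite (level I a)"
  by (rule finite_subset[of _ "Pow I"]) (auto simp: level_def)

definition level_poly :: "nat \<Rightarrow> monomial \<Rightarrow> nat \<Rightarrow> (nat set \<Rightarrow> 'k) \<Rightarrow> 'k::field mpoly" where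
  "level_poly N \<mu> a g = (\<Sum>T\<in>level (free N \<mu>) a. Poly_Mapping.single (\<mu> + loops T) (g T))"

text \<open>Modulo \<open>nul\<close>, adding a loop is possible only at a free vertex outside
  \<open>T\<close>. The remaining pairs \<open>(T, i)\<close> correspond to the pairs of a set
  \<open>insert i T\<close> and one of its elements, which gives the sum in
  \<open>up\<close>.\<close>

lemma level_poly_step:
  fixes g :: "nat set \<Rightarrow> 'k::field"
  shows "nul N (trace_poly N * level_poly N \<mu> a g - level_poly N \<mu> (Suc a) (up g))"
proof -
  let ?I = "free N \<mu>"
  let ?s = "\<lambda>T i. Poly_Mapping.single (\<mu> + loops T + var_mon (i, i)) (g T) :: 'k mpoly"
  have "trace_poly N * level_poly N \<mu> a g = (\<Sum>T\<in>level ?I a. \<Sum>i<N. ?s T i)"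
    unfolding level_poly_def sum_product
    by (subst sum.swap) (simp add: indet_eq_xpow mult_single add.commute)
  also have "\<dots> = (\<Sum>T\<in>level ?I a. (\<Sum>i\<in>{..<N} - (?I - T). ?s T i) + (\<Sum>i\<in>?I - T. ?s T i))"
    by (intro sum.cong sum.subset_diff) (auto simp: free_def)
  also have "\<dots> = (\<Sum>T\<in>level ?I a. \<Sum>i\<in>{..<N} - (?I - T). ?s T i) + (\<Sum>T\<in>level ?I a. \<Sum>i\<in>?I - T. ?s T i)"
    by (rule sum.distrib)
  also have "(\<Sum>T\<in>level ?I a. \<Sum>i\<in>?I - T. ?s T i) = level_poly N \<mu> (Suc a) (up g)"
  proof -
    have "(\<Sum>T\<in>level ?I a. \<Sum>i\<in>?I - T. ?s T i) = (\<Sum>(T, i)\<in>(SIGMA T:level ?I a. ?I - T). ?s T i)"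
      by (rule sum.Sigma) auto
    also have "\<dots> = (\<Sum>(S, i)\<in>(SIGMA S:level ?I (Suc a). S). Poly_Mapping.single (\<mu> + loops S) (g (S - {i})))"
    proof (rule sum.reindex_bij_witness[of _ "\<lambda>(S, i). (S - {i}, i)" "\<lambda>(T, i). (insert i T, i)"])
      fix x assume x: "x \<in> (SIGMA T:level ?I a. ?I - T)"
      obtain T i where Ti: "x = (T, i)" "T \<subseteq> ?I" "card T = a" "i \<in> ?I" "i \<notin> T"
        using x by (auto simp: level_def)
      have fin: "finite T"
        using Ti finite_subset_free by blast
      show "(case (case x of (T, i) \<Rightarrow> (insert i T, i)) of (S, i) \<Rightarrow> (S - {i}, i)) = x"
        using Ti by auto
      show "(case x of (T, i) \<Rightarrow> (insert i T, i)) \<in> (SIGMA S:level ?I (Suc a). S)"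
        using Ti fin by (auto simp: level_def)
      show "(case case x of (T, i) \<Rightarrow> (insert i T, i) of (S, i) \<Rightarrow> Poly_Mapping.single (\<mu> + loops S) (g (S - {i}))) =
          (case x of (T, i) \<Rightarrow> ?s T i)"
        using Ti fin by (simp add: loops_insert add.assoc)
    next
      fix y assume y: "y \<in> (SIGMA S:level ?I (Suc a). S)"
      obtain S i where Si: "y = (S, i)" "S \<subseteq> ?I" "card S = Suc a" "i \<in> S"
        using y by (auto simp: level_def)
      have fin: "finite S"
        using Si finite_subset_free by blast
      show "(case (case y of (S, i) \<Rightarrow> (S - {i}, i)) of (T, i) \<Rightarrow> (insert i T, i)) = y"
        using Si by auto
      show "(case y of (S, i) \<Rightarrow> (S - {i}, i)) \<in> (SIGMA T:level ?I a. ?I - T)"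
        using Si fin by (auto simp: level_def card_Diff_singleton)
    qed
    also have "\<dots> = (\<Sum>S\<in>level ?I (Suc a). \<Sum>i\<in>S. Poly_Mapping.single (\<mu> + loops S) (g (S - {i})))"
      by (rule sum.Sigma[symmetric]) (auto simp: level_def intro: finite_subset_free)
    also have "\<dots> = level_poly N \<mu> (Suc a) (up g)"
    proof -
      have "(\<Sum>i\<in>S. Poly_Mapping.single m (c i)) = Poly_Mapping.single m (\<Sum>i\<in>S. c i)" for S and m :: monomial and c :: "nat \<Rightarrow> 'k"
        by (induction S rule: infinite_finite_induct) (auto simp: single_add)
      then show ?thesis
        by (simp add: level_poly_def up_def)
    qed
    finally show ?thesis .
  qed
  finally have eq: "trace_poly N * level_poly N \<mu> a g - level_poly N \<mu> (Suc a) (up g) =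
      (\<Sum>T\<in>level ?I a. \<Sum>i\<in>{..<N} - (?I - T). ?s T i)"
    by simp
  show ?thesis
    unfolding eq
  proof (intro nul_sum)
    fix T i assume T: "T \<in> level ?I a" and i: "i \<in> {..<N} - (?I - T)"
    have "finite T"
      using T finite_subset_free by (auto simp: level_def)
    then have "wt i (\<mu> + loops T) > 0"
      using i by (cases "i \<in> T") (auto simp: wt_add wt_loops free_def)
    then show "nul N (?s T i)"
      by (intro nul_xpow_heavy[of i]) (simp add: wt_add wt_var_mon)
  qed
qed

lemma level_poly_pow:
  fixes g :: "nat set \<Rightarrow> 'k::field"
  shows "nul N (trace_poly N ^ q * level_poly N \<mu> a g - level_poly N \<mu> (a + q) ((up ^^ q) g))"
proof (induction q)
  case (Suc q)
  have "trace_poly N ^ Suc q * level_poly N \<mu> a g - level_poly N \<mu> (a + Suc q) ((up ^^ Suc q) g) =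
    trace_poly N * (trace_poly N ^ q * level_poly N \<mu> a g - level_poly N \<mu> (a + q) ((up ^^ q) g)) +
    (trace_poly N * level_poly N \<mu> (a + q) ((up ^^ q) g) - level_poly N \<mu> (Suc (a + q)) (up ((up ^^ q) g)))"
    by (simp add: right_diff_distrib mult.assoc)
  then show ?case
    using nul_add[OF nul_mult[OF Suc, of "trace_poly N"] level_poly_step[of N \<mu> "a + q" "(up ^^ q) g"]] by (simp only:)
qed simp

lemma sym_poly_component_zero [simp]: "0 \<in> sym_poly_component N k"
  by (simp add: sym_poly_component_def sym_poly_ring_def)

lemma sym_poly_component_add:
  "f \<in> sym_poly_component N k \<Longrightarrow> g \<in> sym_poly_component N k \<Longrightarrow> f + g \<in> sym_poly_component N k"
  using keys_add[of f g] by (fastforce simp: sym_poly_component_def sym_poly_ring_def)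

lemma sym_poly_component_sum:
  "(\<And>i. i \<in> I \<Longrightarrow> f i \<in> sym_poly_component N k) \<Longrightarrow> (\<Sum>i\<in>I. f i) \<in> sym_poly_component N k"
  by (induction I rule: infinite_finite_induct) (auto intro: sym_poly_component_add)

lemma sym_poly_component_single:
  "Poly_Mapping.keys m \<subseteq> sym_indices N \<Longrightarrow> mon_degree m = k \<Longrightarrow>
    Poly_Mapping.single m c \<in> sym_poly_component N k"
  by (simp add: sym_poly_component_def sym_poly_ring_def)

lemma sym_poly_component_mconst:
  "f \<in> sym_poly_component N k \<Longrightarrow> mconst c * f \<in> sym_poly_component N k"
  by (auto simp: sym_poly_component_def sym_poly_ring_def in_keys_iff lookup_mconst_mult)

lemma level_poly_component:
  assumes "matching N \<mu>"
  shows "level_poly N \<mu> a g \<in> sym_poly_component N (mon_degree \<mu> + a)"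
  unfolding level_poly_def
proof (intro sym_poly_component_sum sym_poly_component_single)
  fix T assume T: "T \<in> level (free N \<mu>) a"
  then have "finite T" "T \<subseteq> {..<N}"
    using finite_subset_free by (auto simp: level_def free_def)
  then show "Poly_Mapping.keys (\<mu> + loops T) \<subseteq> sym_indices N" "mon_degree (\<mu> + loops T) = mon_degree \<mu> + a"
    using T assms keys_loops by (auto simp: keys_add_nat matching_def mon_degree_add mon_degree_loops level_def)
qed

lemma component_surjI:
  fixes r h :: "'k::field mpoly"
  assumes "\<And>m. m \<in> Poly_Mapping.keys h \<Longrightarrow> \<exists>f\<in>sym_poly_component N k. nul N (r * f - xpow m)"
  shows "\<exists>f\<in>sym_poly_component N k. nul N (r * f - h)"
proof -
  have "\<forall>m\<in>Poly_Mapping.keys h. \<exists>f. f \<in> sym_poly_component N k \<and> nul N (r * f - xpow m)"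
    using assms by blast
  from bchoice[OF this] obtain F where
    F: "\<And>m. m \<in> Poly_Mapping.keys h \<Longrightarrow> F m \<in> sym_poly_component N k"
      "\<And>m. m \<in> Poly_Mapping.keys h \<Longrightarrow> nul N (r * F m - xpow m)"
    by blast
  let ?f = "\<Sum>m\<in>Poly_Mapping.keys h. mconst (Poly_Mapping.lookup h m) * F m"
  have "h = (\<Sum>m\<in>Poly_Mapping.keys h. mconst (Poly_Mapping.lookup h m) * xpow m)"
    by (subst (1) poly_mapping_eq_sum_single[of h]) (simp add: mconst_def mult_single)
  then have "r * ?f - h = r * ?f - (\<Sum>m\<in>Poly_Mapping.keys h. mconst (Poly_Mapping.lookup h m) * xpow m)"
    by (rule arg_cong)
  also have "\<dots> = (\<Sum>m\<in>Poly_Mapping.keys h. mconst (Poly_Mapping.lookup h m) * (r * F m - xpow m))"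
    by (simp only: sum_distrib_left sum_subtractf right_diff_distrib mult.left_commute)
  finally have "nul N (r * ?f - h)"
    using F by (auto intro!: nul_sum nul_mult)
  moreover have "?f \<in> sym_poly_component N k"
    using F by (auto intro!: sym_poly_component_sum sym_poly_component_mconst)
  ultimately show ?thesis
    by blast
qed

text \<open>Each monomial of \<open>h\<close> is reduced to one matching \<mu>, and the preimage
  found for it in the squarefree algebra on the free vertices of \<mu> is lifted along the same
  \<mu>.\<close>

lemma trace_pow_surjective:
  fixes h :: "'k::field mpoly"
  assumes h: "h \<in> sym_poly_component N (k + q)" and q: "N \<le> 2 * k + q"
    and nz: "\<And>j. 0 < j \<Longrightarrow> j \<le> N - k \<Longrightarrow> of_nat j \<noteq> (0::'k)"
  shows "\<exists>f\<in>sym_poly_component N k. nul N (trace_poly N ^ q * f - h)"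
proof -
  have xp: "\<exists>f\<in>sym_poly_component N k. nul N (trace_poly N ^ q * f - (xpow m :: 'k mpoly))"
    if m: "m \<in> Poly_Mapping.keys h" for m
  proof -
    have keys: "Poly_Mapping.keys m \<subseteq> sym_indices N" and deg: "mon_degree m = k + q"
      using m h by (auto simp: sym_poly_component_def sym_poly_ring_def)
    from xpow_reduce[OF keys, where 'k = 'k] show ?thesis
    proof
      assume "nul N (xpow m :: 'k mpoly)"
      then show ?thesis
        by (intro bexI[of _ 0]) (auto intro: nul_uminus)
    next
      assume "\<exists>\<mu> T c. matching N \<mu> \<and> T \<subseteq> free N \<mu> \<and> mon_degree m = mon_degree \<mu> + card T \<and>
        nul N (xpow m - Poly_Mapping.single (\<mu> + loops T) (c::'k))"
      then obtain \<mu> T and c :: 'k where \<mu>: "matching N \<mu>" and T: "T \<subseteq> free N \<mu>"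
        and degT: "mon_degree m = mon_degree \<mu> + card T"
        and nul: "nul N (xpow m - Poly_Mapping.single (\<mu> + loops T) c)"
        by blast
      let ?I = "free N \<mu>"
      have le: "card T \<le> card ?I"
        using T by (intro card_mono) auto
      \<comment> \<open>The subtraction is exact: the size of \<open>T\<close> is at most
        \<open>N - 2 * mon_degree \<mu>\<close>, and with \<open>N \<le> 2 * k + q\<close> this
        forces \<open>mon_degree \<mu> \<le> k\<close>.\<close>
      define a where "a = k - mon_degree \<mu>"
      have a: "k = mon_degree \<mu> + a" "card T = a + q"
        using le card_free[OF \<mu>] deg degT q by (auto simp: a_def)
      have "\<exists>g. \<forall>S\<subseteq>?I. card S = a + q \<longrightarrow> (up ^^ q) g S = (if S = T then c else 0)"
      proof (rule up_pow_surjective)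
        show "card ?I \<le> 2 * a + q"
          using card_free[OF \<mu>] a q by simp
        show "of_nat j \<noteq> (0::'k)" if "0 < j" "j \<le> card ?I - a" for j
          using nz[of j] that card_free[OF \<mu>] a by simp
      qed simp
      then obtain g where g: "\<And>S. S \<subseteq> ?I \<Longrightarrow> card S = a + q \<Longrightarrow> (up ^^ q) g S = (if S = T then c else 0)"
        by blast
      have "level_poly N \<mu> (a + q) ((up ^^ q) g) =
          (\<Sum>S\<in>level ?I (a + q). if S = T then Poly_Mapping.single (\<mu> + loops T) c else 0)"
        unfolding level_poly_def by (rule sum.cong) (auto simp: g level_def)
      also have "\<dots> = Poly_Mapping.single (\<mu> + loops T) c"
        using T a by (simp add: level_def)
      finally have "nul N (trace_poly N ^ q * level_poly N \<mu> a g - Poly_Mapping.single (\<mu> + loops T) c)"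
        using level_poly_pow[of N q \<mu> a g] by simp
      from nul_diff[OF this nul] have "nul N (trace_poly N ^ q * level_poly N \<mu> a g - xpow m)"
        by (simp add: algebra_simps)
      then show ?thesis
        using level_poly_component[OF \<mu>, of a g] a by auto
    qed
  qed
  then show ?thesis
    by (rule component_surjI)
qed

section \<open>The middle degree for odd \<open>N\<close>\<close>

lemma det_ev_loops_complement:
  assumes "S \<subseteq> {..<N}" "T \<subseteq> {..<N}" "card S = card T"
  shows "det_ev N (loops ({..<N} - S) + loops T) = (of_bool (S = T) :: 'k::field)"
proof (cases "S = T")
  case True
  have fin: "finite T"
    using assms finite_subset by blast
  have "loops ({..<N} - T) + loops T = loops {..<N}"
    using assms fin by (intro poly_mapping_eqI) (auto simp: lookup_add lookup_loops)
  then show ?thesis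
    using True by (simp add: det_ev_loops)
next
  case False
  have fin: "finite S" "finite T"
    using assms finite_subset by blast+
  have "\<not> T \<subseteq> S"
    using False assms fin card_subset_eq by metis
  then obtain i where "i \<in> T" "i \<notin> S"
    by blast
  then have "i < N" "wt i (loops ({..<N} - S) + loops T) \<noteq> 2"
    using assms fin by (auto simp: wt_add wt_loops)
  then show ?thesis
    using det_ev_eq_0 False by simp
qed

lemma mon_degree_eq_0_iff: "mon_degree m = 0 \<longleftrightarrow> m = 0"
proof
  assume "mon_degree m = 0"
  then have "\<forall>v\<in>Poly_Mapping.keys m. Poly_Mapping.lookup m v = 0"
    by (simp add: mon_degree_def)
  then show "m = 0"
    by (intro poly_mapping_eqI) (auto simp: in_keys_iff)
qed (simp add: mon_degree_def)

text \<open>Here \<open>v\<close> is the elementary symmetric polynomial of degree \<open>k\<close>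
  in the diagonal variables. The trace form sends it to \<open>k + 1\<close> times the next one
  modulo \<open>nul\<close>, hence to zero. Conversely a kernel element has constant pairings with
  the diagonal monomials and zero pairings with those of a nonempty matching, exactly like a
  multiple of \<open>v\<close>.\<close>

lemma trace_kernel_middle:
  fixes v :: "'k::field mpoly"
  assumes N: "N = 2 * k + 1"
    and k: "of_nat (Suc k) = (0::'k)" "\<And>j. 0 < j \<Longrightarrow> j \<le> k \<Longrightarrow> of_nat j \<noteq> (0::'k)"
  defines "v \<equiv> level_poly N 0 k (\<lambda>_. 1)"
  shows "v \<in> sym_poly_component N k" "nul N (trace_poly N * v)" "\<not> nul N v"
    and "\<And>f. f \<in> sym_poly_component N k \<Longrightarrow> nul N (trace_poly N * f) \<Longrightarrow> \<exists>c. nul N (f - mconst c * v)"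
proof -
  show v: "v \<in> sym_poly_component N k"
    using level_poly_component[of N 0 k "\<lambda>_. 1"] by (simp add: v_def mon_degree_def)
  have "level_poly N 0 (Suc k) (up (\<lambda>_. 1)) = (0 :: 'k mpoly)"
    unfolding level_poly_def using k by (intro sum.neutral) (auto simp: up_def level_def)
  then show "nul N (trace_poly N * v)"
    using level_poly_step[of N 0 k "\<lambda>_. 1::'k"] by (simp add: v_def)
  have Phi_v: "Phi N (xpow (loops ({..<N} - S)) * v) = 1" if S: "S \<subseteq> {..<N}" "card S = k" for S
  proof -
    have "Phi N (xpow (loops ({..<N} - S)) * v) = (\<Sum>T\<in>level {..<N} k. det_ev N (loops ({..<N} - S) + loops T))"
      by (simp add: v_def level_poly_def sum_distrib_left Phi_sum mult_single)
    also have "\<dots> = (\<Sum>T\<in>level {..<N} k. if S = T then 1 else 0)"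
      using S by (intro sum.cong) (auto simp: det_ev_loops_complement level_def)
    also have "\<dots> = 1"
      using S by (simp add: level_def)
    finally show ?thesis .
  qed
  have k0: "{..<k} \<subseteq> {..<N}" "card {..<k} = k"
    using N by auto
  show "\<not> nul N v"
  proof
    assume "nul N v"
    then have "Phi N (xpow (loops ({..<N} - {..<k})) * v) = 0"
      unfolding nul_def by blast
    then show False
      unfolding Phi_v[OF k0] by simp
  qed
  fix f :: "'k mpoly"
  assume f: "f \<in> sym_poly_component N k" and ker: "nul N (trace_poly N * f)"
  define g where "g S = Phi N (xpow (loops ({..<N} - S)) * f)" for S
  have g: "g S = g {..<k}" if "S \<subseteq> {..<N}" "card S = k" for S
  proof (rule up_kernel_middle[where I = "{..<N}" and k = k])
    show "up g S = 0" if "S \<subseteq> {..<N}" for S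
      using Phi_trace_step[of S N 0 f] that ker by (simp add: nul_def g_def[abs_def])
  qed (use k0 that N k in auto)
  have "nul N (f - mconst (g {..<k}) * v)"
  proof (rule nulI_matching)
    fix \<mu> T assume \<mu>: "matching N \<mu>" and T: "T \<subseteq> free N \<mu>"
    have finT: "finite T"
      using T finite_subset_free by blast
    have "Phi N (xpow (\<mu> + loops T) * f) = g {..<k} * Phi N (xpow (\<mu> + loops T) * v)"
    proof (cases "\<mu> = 0")
      case True
      define S where "S = {..<N} - T"
      have S: "T = {..<N} - S" "S \<subseteq> {..<N}" "card T = N - card S" "card S \<le> N"
        using T True finT card_mono[of "{..<N}" T] by (auto simp: S_def card_Diff_subset)
      show ?thesis
      proof (cases "card S = k")
        case True
        then show ?thesis
          using g[of S] Phi_v[of S] S \<open>\<mu> = 0\<close> by (simp add: g_def)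
      next
        case False
        then have "mon_degree (\<mu> + loops T) + k \<noteq> N"
          using S finT \<open>\<mu> = 0\<close> by (simp add: mon_degree_loops)
        then show ?thesis
          using Phi_xpow_degree f v by (metis mult_zero_right)
      qed
    next
      case False
      have "mon_degree \<mu> > 0"
        using False mon_degree_eq_0_iff by blast
      then have "card (free N \<mu>) \<noteq> N"
        using card_free[OF \<mu>] by linarith
      then have "free N \<mu> \<noteq> {..<N}"
        by (metis card_lessThan)
      then obtain i where i: "i < N" "wt i \<mu> \<noteq> 0"
        by (auto simp: free_def)
      then have "wt i \<mu> = 1"
        using \<mu> unfolding matching_def by (metis One_nat_def le_SucE le_zero_eq)
      \<comment> \<open>The vertex \<open>i\<close> is matched once and loops add even numbers, so
        its degree is odd.\<close>
      then have "wt i (\<mu> + loops T + loops T') \<noteq> 2" if "T' \<in> level {..<N} k" for T'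
        using that finT finite_subset[of T' "{..<N}"] by (auto simp: wt_add wt_loops level_def)
      then have "Phi N (xpow (\<mu> + loops T) * v) = 0"
        using det_ev_eq_0[OF i(1), where 'k = 'k]
        by (simp add: v_def level_poly_def sum_distrib_left Phi_sum mult_single)
      \<comment> \<open>As \<mu> has degree at least 1, only the integers up to \<open>k\<close> are
        inverted and the vanishing \<open>k + 1\<close> is avoided.\<close>
      moreover have "Phi N (xpow (\<mu> + loops T) * f) = 0"
        using \<open>mon_degree \<mu> > 0\<close> N k ker
        by (intro Phi_vanishes[OF f _ _ _ \<mu> T, of 1]) auto
      ultimately show ?thesis
        by simp
    qed
    then show "Phi N (xpow (\<mu> + loops T) * (f - mconst (g {..<k}) * v)) = 0"
      by (simp add: right_diff_distrib Phi_diff mult.left_commute[of _ "mconst _"] Phi_mconst_mult)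
  qed
  then show "\<exists>c. nul N (f - mconst c * v)"
    by blast
qed

section \<open>Rank of linear maps\<close>

context ring
begin

context
  fixes K :: "'a set"
  assumes K: "subfield K R"
begin

lemma dimension_mono:
  assumes "dimension n K E" "dimension m K F" "E \<subseteq> F"
  shows "n \<le> m"
proof -
  obtain Vs where Vs: "set Vs \<subseteq> carrier R" "independent K Vs" "length Vs = n" "Span K Vs = E"
    using exists_base[OF K assms(1)] by blast
  then have "set Vs \<subseteq> F"
    using Span_base_incl[OF K Vs(1)] assms(3) by blast
  then show ?thesis
    using independent_length_le_dimension[OF K assms(2) Vs(2)] Vs(3) by simp
qed

lemma dimension_eq_imp_eq:
  assumes "dimension n K E" "dimension n K F" "E \<subseteq> F"
  shows "E = F"
proof -
  obtain Vs where Vs: "set Vs \<subseteq> carrier R" "independent K Vs" "length Vs = n" "Span K Vs = E"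
    using exists_base[OF K assms(1)] by blast
  then have "set Vs \<subseteq> F"
    using Span_base_incl[OF K Vs(1)] assms(3) by blast
  then show ?thesis
    using independent_length_eq_dimension[OF K assms(2) Vs(2)] Vs(3,4) by simp
qed

lemma line_extension_subset: "E \<subseteq> line_extension K v E" if "E \<subseteq> carrier R" "v \<in> carrier R"
proof
  fix e assume "e \<in> E"
  then have "e = \<zero> \<otimes> v \<oplus> e"
    using that by auto
  moreover have "\<zero> \<in> K"
    using subfieldE(1)[OF K] subringE(2) by blast
  ultimately show "e \<in> line_extension K v E"
    using \<open>e \<in> E\<close> line_extension_mem_iff by blast
qed

lemma line_extension_absorb:
  assumes E: "dimension n K E" and v: "v \<in> E"
  shows "line_extension K v E = E"
proof
  note E_props = space_subgroup_props[OF K E]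
  show "line_extension K v E \<subseteq> E"
    using E_props(3,5) v by (auto simp: line_extension_mem_iff)
  show "E \<subseteq> line_extension K v E"
    using line_extension_subset E_props(1) v by auto
qed

text \<open>The part of rank-nullity that is needed, by adding one basis vector \<open>v\<close> at
  a time: the dimension of the image grows unless the image of \<open>v\<close> is already
  present.\<close>

lemma dimension_image:
  assumes closed: "\<And>a. a \<in> carrier R \<Longrightarrow> \<phi> a \<in> carrier R"
    and add: "\<And>a b. a \<in> carrier R \<Longrightarrow> b \<in> carrier R \<Longrightarrow> \<phi> (a \<oplus> b) = \<phi> a \<oplus> \<phi> b"
    and smult: "\<And>k a. k \<in> K \<Longrightarrow> a \<in> carrier R \<Longrightarrow> \<phi> (k \<otimes> a) = k \<otimes> \<phi> a"
    and "dimension n K E"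
  shows "\<exists>m\<le>n. dimension m K (\<phi> ` E) \<and> (m = n \<longleftrightarrow> (\<forall>a\<in>E. \<phi> a = \<zero> \<longrightarrow> a = \<zero>))"
  using assms(4)
proof (induction n arbitrary: E)
  case 0
  have "E = {\<zero>}"
    using dimension_zero[OF K 0] .
  moreover have "\<phi> \<zero> = \<zero>"
  proof -
    have "\<phi> \<zero> \<oplus> \<phi> \<zero> = \<phi> \<zero>"
      using add[of \<zero> \<zero>] by simp
    then show ?thesis
      using closed[of \<zero>] add.r_cancel_one' by auto
  qed
  ultimately show ?case
    by (auto simp: zero_dim)
next
  case (Suc n)
  obtain v E' where v: "v \<in> carrier R" "v \<notin> E'" and E': "dimension n K E'" and E: "E = line_extension K v E'"
    using dimension_backwards[OF K Suc.prems] by blast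
  obtain m where m: "m \<le> n" "dimension m K (\<phi> ` E')" "m = n \<longleftrightarrow> (\<forall>a\<in>E'. \<phi> a = \<zero> \<longrightarrow> a = \<zero>)"
    using Suc.IH[OF E'] by blast
  note E'_props = space_subgroup_props[OF K E'] and im_props = space_subgroup_props[OF K m(2)]
  have Kc: "K \<subseteq> carrier R"
    using subfieldE(3)[OF K] .
  have image: "\<phi> ` E = line_extension K (\<phi> v) (\<phi> ` E')"
  proof -
    have hom: "\<phi> (k \<otimes> v \<oplus> e) = k \<otimes> \<phi> v \<oplus> \<phi> e" if "k \<in> K" "e \<in> E'" for k e
    proof -
      have "k \<in> carrier R" "e \<in> carrier R"
        using that Kc E'_props(1) by auto
      then show ?thesis
        using add smult v that by simp
    qed
    show ?thesis
    proof (intro equalityI subsetI)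
      fix y assume "y \<in> \<phi> ` E"
      then obtain x where x: "x \<in> line_extension K v E'" "y = \<phi> x"
        unfolding E by blast
      from x(1) obtain k e where "k \<in> K" "e \<in> E'" "y = \<phi> (k \<otimes> v \<oplus> e)"
        unfolding line_extension_mem_iff x(2) by blast
      then show "y \<in> line_extension K (\<phi> v) (\<phi> ` E')"
        using hom line_extension_mem_iff by blast
    next
      fix y assume "y \<in> line_extension K (\<phi> v) (\<phi> ` E')"
      then obtain k e where ke: "k \<in> K" "e \<in> E'" "y = k \<otimes> \<phi> v \<oplus> \<phi> e"
        unfolding line_extension_mem_iff by blast
      then have "k \<otimes> v \<oplus> e \<in> E"
        unfolding E line_extension_mem_iff by blast
      then show "y \<in> \<phi> ` E"
        using hom[OF ke(1,2)] ke(3) by (metis imageI)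
    qed
  qed
  show ?case
  proof (cases "\<phi> v \<in> \<phi> ` E'")
    case True
    then have "dimension m K (\<phi> ` E)"
      using image line_extension_absorb[OF m(2)] m(2) by simp
    moreover obtain e where e: "e \<in> E'" "\<phi> v = \<phi> e"
      using True by blast
    have ec: "e \<in> carrier R"
      using e E'_props(1) by blast
    \<comment> \<open>This difference is a kernel vector of \<open>E\<close>; it is nonzero because
      \<open>v\<close> lies outside \<open>E'\<close>.\<close>
    have "\<phi> (v \<ominus> e) = \<zero>"
    proof -
      have "\<phi> (v \<ominus> e) \<oplus> \<phi> e = \<phi> ((v \<ominus> e) \<oplus> e)"
        using add[of "v \<ominus> e" e] v ec by simp
      also have "(v \<ominus> e) \<oplus> e = v"
        using v ec by (simp add: minus_eq a_assoc l_neg)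
      finally have "\<phi> (v \<ominus> e) \<oplus> \<phi> e = \<phi> e"
        using e by simp
      then show ?thesis
        using closed v ec add.l_cancel_one by simp
    qed
    moreover have "v \<ominus> e \<in> E"
    proof -
      have "v \<ominus> e = \<one> \<otimes> v \<oplus> (\<ominus> e)"
        using v by (simp add: minus_eq)
      moreover have "\<one> \<in> K"
        using subfieldE(1)[OF K] subringE(3) by blast
      ultimately show ?thesis
        unfolding E line_extension_mem_iff using E'_props(4)[OF e(1)] by blast
    qed
    moreover have "v \<ominus> e \<noteq> \<zero>"
      using v e ec by (metis r_right_minus_eq)
    ultimately show ?thesis
      using m(1) by (intro exI[of _ m]) auto
  next
    case False
    have "dimension (Suc m) K (\<phi> ` E)"
      unfolding image using False closed v m(2) by (intro Suc_dim) auto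
    moreover have "(\<forall>a\<in>E. \<phi> a = \<zero> \<longrightarrow> a = \<zero>) \<longleftrightarrow> (\<forall>a\<in>E'. \<phi> a = \<zero> \<longrightarrow> a = \<zero>)"
    proof
      assume "\<forall>a\<in>E. \<phi> a = \<zero> \<longrightarrow> a = \<zero>"
      then show "\<forall>a\<in>E'. \<phi> a = \<zero> \<longrightarrow> a = \<zero>"
        using line_extension_subset[OF E'_props(1) v(1)] E by blast
    next
      assume ker: "\<forall>a\<in>E'. \<phi> a = \<zero> \<longrightarrow> a = \<zero>"
      show "\<forall>a\<in>E. \<phi> a = \<zero> \<longrightarrow> a = \<zero>"
      proof (intro ballI impI)
        fix a assume "a \<in> E" and a0: "\<phi> a = \<zero>"
        then obtain k e where a: "a = k \<otimes> v \<oplus> e" "k \<in> K" "e \<in> E'"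
          unfolding E line_extension_mem_iff by blast
        have kc: "k \<in> carrier R" "e \<in> carrier R"
          using a Kc E'_props(1) by auto
        have sum0: "k \<otimes> \<phi> v \<oplus> \<phi> e = \<zero>"
          using a0 add smult v a kc by simp
        have "k = \<zero>"
        proof (rule ccontr)
          assume "k \<noteq> \<zero>"
          have "k \<otimes> \<phi> v = \<ominus> \<phi> e"
            using sum0 kc closed v by (simp add: minus_equality[symmetric])
          then have "k \<otimes> \<phi> v \<in> \<phi> ` E'"
            using im_props(4) a(3) by auto
          then show False
            using im_props(6)[of k "\<phi> v"] a(2) \<open>k \<noteq> \<zero>\<close> closed v False by auto
        qed
        then show "a = \<zero>"
          using a sum0 ker kc closed v by simp
      qed
    qed
    ultimately show ?thesis
      using m by (intro exI[of _ "Suc m"]) auto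
  qed
qed

context
  fixes \<phi> V W
  assumes closed: "\<And>a. a \<in> carrier R \<Longrightarrow> \<phi> a \<in> carrier R"
    and add: "\<And>a b. a \<in> carrier R \<Longrightarrow> b \<in> carrier R \<Longrightarrow> \<phi> (a \<oplus> b) = \<phi> a \<oplus> \<phi> b"
    and smult: "\<And>k a. k \<in> K \<Longrightarrow> a \<in> carrier R \<Longrightarrow> \<phi> (k \<otimes> a) = k \<otimes> \<phi> a"
    and fin: "finite_dimension K V" "finite_dimension K W"
    and sub: "\<phi> ` V \<subseteq> W"
begin

lemma dim_eqI: "dimension n K E \<Longrightarrow> dim K E = n"
  using dimI[OF K, of n E] by (simp add: over_def)

text \<open>The rank is bounded by both dimensions. It equals the first exactly for an injective map
  and the second exactly for a surjective one.\<close>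

lemma has_maximal_rank_iff:
  "has_maximal_rank R K \<phi> V W \<longleftrightarrow> (\<forall>a\<in>V. \<phi> a = \<zero> \<longrightarrow> a = \<zero>) \<or> \<phi> ` V = W"
proof -
  obtain n w where n: "dimension n K V" and w: "dimension w K W"
    using fin by (auto simp: finite_dimension_def)
  obtain m where m: "m \<le> n" "dimension m K (\<phi> ` V)" "m = n \<longleftrightarrow> (\<forall>a\<in>V. \<phi> a = \<zero> \<longrightarrow> a = \<zero>)"
    using dimension_image[OF closed add smult n] by blast
  have "m \<le> w"
    using dimension_mono[OF m(2) w sub] .
  have "has_maximal_rank R K \<phi> V W \<longleftrightarrow> m = min n w"
    using n w m(2) by (simp add: has_maximal_rank_def dim_eqI)
  also have "\<dots> \<longleftrightarrow> m = n \<or> m = w"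
    using \<open>m \<le> n\<close> \<open>m \<le> w\<close> by auto
  also have "m = w \<longleftrightarrow> \<phi> ` V = W"
    using dimension_eq_imp_eq[OF m(2) _ sub] dimension_is_inj[OF K m(2)] w by blast
  finally show ?thesis
    using m(3) by blast
qed

end

end

end

section \<open>The quotient algebra\<close>

lemma sym_poly_ring_simps [simp]:
  "f \<otimes>\<^bsub>sym_poly_ring N\<^esub> g = f * g" "f \<oplus>\<^bsub>sym_poly_ring N\<^esub> g = f + g"
  "\<one>\<^bsub>sym_poly_ring N\<^esub> = 1" "\<zero>\<^bsub>sym_poly_ring N\<^esub> = 0"
  by (simp_all add: sym_poly_ring_def)

lemma carrier_sym_poly_ring:
  "f \<in> carrier (sym_poly_ring N) \<longleftrightarrow> (\<forall>m\<in>Poly_Mapping.keys f. Poly_Mapping.keys m \<subseteq> sym_indices N)"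
  by (simp add: sym_poly_ring_def)

lemma carrier_add:
  "f \<in> carrier (sym_poly_ring N) \<Longrightarrow> g \<in> carrier (sym_poly_ring N) \<Longrightarrow> f + g \<in> carrier (sym_poly_ring N)"
  using keys_add[of f g] by (fastforce simp: carrier_sym_poly_ring)

lemma carrier_uminus: "f \<in> carrier (sym_poly_ring N) \<Longrightarrow> - f \<in> carrier (sym_poly_ring N)"
  by (simp add: carrier_sym_poly_ring in_keys_iff)

lemma carrier_diff:
  "f \<in> carrier (sym_poly_ring N) \<Longrightarrow> g \<in> carrier (sym_poly_ring N) \<Longrightarrow> f - g \<in> carrier (sym_poly_ring N)"
  using carrier_add[of f N "- g"] carrier_uminus[of g N] by simp

lemma carrier_mult:
  assumes "f \<in> carrier (sym_poly_ring N)" "g \<in> carrier (sym_poly_ring N)"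
  shows "f * g \<in> carrier (sym_poly_ring N)"
  unfolding carrier_sym_poly_ring
proof
  fix m assume "m \<in> Poly_Mapping.keys (f * g)"
  then obtain a b where "m = a + b" "a \<in> Poly_Mapping.keys f" "b \<in> Poly_Mapping.keys g"
    using keys_mult[of f g] by blast
  then show "Poly_Mapping.keys m \<subseteq> sym_indices N"
    using assms by (auto simp: carrier_sym_poly_ring keys_add_nat)
qed

lemma carrier_mconst [simp]: "mconst c \<in> carrier (sym_poly_ring N)"
  by (simp add: carrier_sym_poly_ring mconst_def)

lemma carrier_one [simp]: "1 \<in> carrier (sym_poly_ring N)"
  by (simp add: carrier_sym_poly_ring)

lemma carrier_zero [simp]: "0 \<in> carrier (sym_poly_ring N)"
  by (simp add: carrier_sym_poly_ring)

lemma carrier_power: "f \<in> carrier (sym_poly_ring N) \<Longrightarrow> f ^ q \<in> carrier (sym_poly_ring N)"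
  by (induction q) (auto intro: carrier_mult)

lemma carrier_component: "f \<in> sym_poly_component N k \<Longrightarrow> f \<in> carrier (sym_poly_ring N)"
  by (simp add: sym_poly_component_def)

lemma sym_poly_component_mult:
  assumes "f \<in> sym_poly_component N k" "g \<in> sym_poly_component N l"
  shows "f * g \<in> sym_poly_component N (k + l)"
  unfolding sym_poly_component_def
proof (intro CollectI conjI ballI)
  show "f * g \<in> carrier (sym_poly_ring N)"
    using assms by (intro carrier_mult carrier_component)
  fix m assume "m \<in> Poly_Mapping.keys (f * g)"
  then obtain a b where "m = a + b" "a \<in> Poly_Mapping.keys f" "b \<in> Poly_Mapping.keys g"
    using keys_mult[of f g] by blast
  then show "mon_degree m = k + l"
    using assms by (simp add: mon_degree_add component_degree)
qed

lemma sym_poly_component_power: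
  assumes "f \<in> sym_poly_component N 1"
  shows "f ^ q \<in> sym_poly_component N q"
proof (induction q)
  case 0
  then show ?case
    by (simp add: sym_poly_component_def mon_degree_def)
next
  case (Suc q)
  then show ?case
    using sym_poly_component_mult[OF assms Suc] by simp
qed

lemma sym_poly_component_uminus: "f \<in> sym_poly_component N k \<Longrightarrow> - f \<in> sym_poly_component N k"
  by (simp add: sym_poly_component_def carrier_uminus in_keys_iff)

lemma trace_poly_component: "trace_poly N \<in> sym_poly_component N 1"
proof (rule sym_poly_component_sum)
  fix i assume "i \<in> {..<N}"
  then show "indet (i, i) \<in> sym_poly_component N 1"
    unfolding indet_eq_xpow by (intro sym_poly_component_single) (auto simp: sym_indices_def)
qed

lemma obtain_var_mon:
  assumes "mon_degree m > 0"
  obtains v n where "m = n + var_mon v"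
proof -
  have "m \<noteq> 0"
    using assms mon_degree_eq_0_iff[of m] by auto
  then obtain v where v: "Poly_Mapping.lookup m v \<noteq> 0"
    by (auto simp: poly_mapping_eq_iff fun_eq_iff)
  have "m = (m - var_mon v) + var_mon v"
    using v by (intro poly_mapping_eqI) (auto simp: lookup_add lookup_minus lookup_var_mon)
  then show ?thesis
    using that by blast
qed

lemma finite_monomials: "finite {m. Poly_Mapping.keys m \<subseteq> sym_indices N \<and> mon_degree m = k}"
proof (induction k)
  case 0
  have "{m. Poly_Mapping.keys m \<subseteq> sym_indices N \<and> mon_degree m = 0} \<subseteq> {0}"
    by (auto simp: mon_degree_eq_0_iff)
  then show ?case
    using finite_subset by blast
next
  case (Suc k)
  let ?M = "\<lambda>k. {m. Poly_Mapping.keys m \<subseteq> sym_indices N \<and> mon_degree m = k}"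
  have fin: "finite (sym_indices N)"
    by (rule finite_subset[of _ "{..<N} \<times> {..<N}"]) (auto simp: sym_indices_def)
  have "?M (Suc k) \<subseteq> (\<Union>v\<in>sym_indices N. (\<lambda>m. m + var_mon v) ` ?M k)"
  proof
    fix m assume m: "m \<in> ?M (Suc k)"
    then have "mon_degree m > 0"
      by simp
    then obtain v n where mn: "m = n + var_mon v"
      by (rule obtain_var_mon)
    have "Poly_Mapping.keys n \<subseteq> sym_indices N" "mon_degree n = k" "v \<in> sym_indices N"
      using m mn by (auto simp: keys_add_nat mon_degree_add)
    then show "m \<in> (\<Union>v\<in>sym_indices N. (\<lambda>m. m + var_mon v) ` ?M k)"
      using mn by blast
  qed
  then show ?case
    by (rule finite_subset) (intro finite_UN_I fin finite_imageI Suc)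
qed

lemma sym_poly_ring_cring: "cring (sym_poly_ring N :: 'k::field mpoly ring)"
proof (rule cringI)
  show "abelian_group (sym_poly_ring N :: 'k mpoly ring)"
  proof (rule abelian_groupI)
    fix x :: "'k mpoly" assume "x \<in> carrier (sym_poly_ring N)"
    then show "\<exists>y\<in>carrier (sym_poly_ring N). y \<oplus>\<^bsub>sym_poly_ring N\<^esub> x = \<zero>\<^bsub>sym_poly_ring N\<^esub>"
      by (intro bexI[of _ "- x"]) (auto intro: carrier_uminus)
  qed (auto intro: carrier_add simp: ac_simps)
  show "Group.comm_monoid (sym_poly_ring N :: 'k mpoly ring)"
    by (rule comm_monoidI) (auto intro: carrier_mult simp: ac_simps)
qed (auto simp: distrib_right)

text \<open>The assumption covers characteristic zero and odd characteristic at once; it is what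
  identifies the annihilator with the radical \<open>nul\<close>.\<close>

locale sym_det_algebra =
  fixes N :: nat and ty :: "'k::field itself"
  assumes two_neq_0: "(2::'k) \<noteq> 0"
begin

abbreviation R :: "'k mpoly ring" where "R \<equiv> sym_poly_ring N"
abbreviation A :: "'k mpoly set ring" where "A \<equiv> sym_alg N"
abbreviation K :: "'k mpoly set set" where "K \<equiv> ground_field N"
abbreviation G :: "nat \<Rightarrow> 'k mpoly set set" where "G \<equiv> sym_alg_component N"
abbreviation res :: "'k mpoly \<Rightarrow> 'k mpoly set" where "res \<equiv> residue_class N"

lemmas carrier_component' = carrier_component[where 'a = 'k]
  and carrier_mult' = carrier_mult[where 'a = 'k]
  and carrier_diff' = carrier_diff[where 'a = 'k]
  and carrier_add' = carrier_add[where 'a = 'k]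
  and sym_poly_component_mconst' = sym_poly_component_mconst[where 'a = 'k]
  and sym_poly_component_add' = sym_poly_component_add[where 'a = 'k]
  and sym_poly_component_uminus' = sym_poly_component_uminus[where 'a = 'k]
  and sym_poly_component_zero' = sym_poly_component_zero[where 'a = 'k]

lemma Ann_iff: "f \<in> Ann N \<longleftrightarrow> f \<in> carrier R \<and> nul N (f :: 'k mpoly)"
  using nul_iff_poly_diff[OF two_neq_0] by (simp add: Ann_def)

interpretation R: cring R
  by (rule sym_poly_ring_cring)

lemma a_inv_R: "f \<in> carrier R \<Longrightarrow> \<ominus>\<^bsub>R\<^esub> f = - f"
  by (rule R.minus_equality) (auto intro: carrier_uminus)

lemma Ann_ideal: "ideal (Ann N) R"
proof (rule idealI)
  show "subgroup (Ann N) (add_monoid R)"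
  proof (rule R.add.subgroupI)
    show "Ann N \<noteq> ({} :: 'k mpoly set)"
      using Ann_iff[of 0] by auto
    fix a :: "'k mpoly" assume a: "a \<in> Ann N"
    then have "a \<in> carrier R" "nul N a"
      using Ann_iff by auto
    then show "\<ominus>\<^bsub>R\<^esub> a \<in> Ann N"
      using a_inv_R[of a] by (simp add: Ann_iff carrier_uminus nul_uminus)
  next
    fix a b :: "'k mpoly" assume "a \<in> Ann N" "b \<in> Ann N"
    then show "a \<oplus>\<^bsub>R\<^esub> b \<in> Ann N"
      by (simp add: Ann_iff carrier_add' nul_add)
  qed (auto simp: Ann_iff)
qed (auto simp: Ann_iff R.ring_axioms intro: carrier_mult' nul_mult nul_mult_right)

interpretation I: ideal "Ann N" R
  by (rule Ann_ideal)

interpretation A: cring A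
  unfolding sym_alg_def by (rule I.quotient_is_cring[OF sym_poly_ring_cring])

interpretation hom: ring_hom_ring R A res
  unfolding sym_alg_def residue_class_def[abs_def] by (rule I.rcos_ring_hom_ring)

lemma res_add: "f \<in> carrier R \<Longrightarrow> g \<in> carrier R \<Longrightarrow> res (f + g) = res f \<oplus>\<^bsub>A\<^esub> res g"
  using hom.hom_add by simp

lemma res_mult: "f \<in> carrier R \<Longrightarrow> g \<in> carrier R \<Longrightarrow> res (f * g) = res f \<otimes>\<^bsub>A\<^esub> res g"
  using hom.hom_mult by simp

lemma res_closed: "f \<in> carrier R \<Longrightarrow> res f \<in> carrier A"
  using hom.hom_closed by simp

lemma res_zero: "res 0 = \<zero>\<^bsub>A\<^esub>"
  using hom.hom_zero by simp

lemma res_one: "res 1 = \<one>\<^bsub>A\<^esub>"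
  using hom.hom_one by simp

lemma res_power: "f \<in> carrier R \<Longrightarrow> res (f ^ q) = res f [^]\<^bsub>A\<^esub> q"
proof (induction q)
  case (Suc q)
  then show ?case
    using res_mult[OF carrier_power[OF Suc.prems] Suc.prems] by (simp add: mult.commute)
qed (simp add: res_one)

lemma res_uminus: "f \<in> carrier R \<Longrightarrow> res (- f) = \<ominus>\<^bsub>A\<^esub> res f"
  using hom.hom_a_inv[of f] a_inv_R by simp

lemma res_eq_zero_iff: "f \<in> carrier R \<Longrightarrow> res f = \<zero>\<^bsub>A\<^esub> \<longleftrightarrow> nul N f"
proof -
  assume f: "f \<in> carrier R"
  have zero: "\<zero>\<^bsub>A\<^esub> = Ann N"
    by (simp add: sym_alg_def FactRing_def)
  show ?thesis
  proof
    assume "res f = \<zero>\<^bsub>A\<^esub>"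
    then have "f \<in> Ann N"
      using I.a_rcos_self[OF f] by (simp add: zero residue_class_def)
    then show "nul N f"
      by (simp add: Ann_iff)
  next
    assume "nul N f"
    then show "res f = \<zero>\<^bsub>A\<^esub>"
      using f by (simp add: zero residue_class_def Ann_iff I.a_rcos_const)
  qed
qed

lemma res_eq_iff: "f \<in> carrier R \<Longrightarrow> g \<in> carrier R \<Longrightarrow> res f = res g \<longleftrightarrow> nul N (f - g)"
proof -
  assume fg: "f \<in> carrier R" "g \<in> carrier R"
  have "res f = res (f - g) \<oplus>\<^bsub>A\<^esub> res g"
    using res_add[of "f - g" g] fg carrier_diff' by simp
  then have "res f = res g \<longleftrightarrow> res (f - g) = \<zero>\<^bsub>A\<^esub>"
    using A.add.l_cancel_one[of "res g" "res (f - g)"] fg carrier_diff' res_closed by simp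
  then show ?thesis
    using res_eq_zero_iff fg carrier_diff' by simp
qed

lemma not_nul_loops: "\<not> nul N (xpow (loops {..<N}) :: 'k mpoly)"
proof
  assume "nul N (xpow (loops {..<N}) :: 'k mpoly)"
  then have "Phi N (1 * xpow (loops {..<N}) :: 'k mpoly) = 0"
    unfolding nul_def by blast
  then show False
    by (simp add: det_ev_loops)
qed

lemma not_nul_one: "\<not> nul N (1 :: 'k mpoly)"
  using nul_mult[of N 1 "xpow (loops {..<N})"] not_nul_loops by auto

text \<open>The constants remain a field because 1 is not null, which follows from the nonzero
  pairing with the product of the diagonal variables.\<close>

lemma K_subfield: "subfield K A"
proof (rule A.subfieldI)
  have mc: "mconst a + mconst b = (mconst (a + b) :: 'k mpoly)" "mconst a * mconst b = (mconst (a * b) :: 'k mpoly)"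
    "- mconst a = (mconst (- a) :: 'k mpoly)" "(1 :: 'k mpoly) = mconst 1" "(0 :: 'k mpoly) = mconst 0" for a b
    by (simp_all add: mconst_def single_add mult_single single_uminus)
  have KI: "res (mconst c) \<in> K" for c
    by (simp add: ground_field_def)
  have "subring K A"
  proof (rule A.subringI)
    show "K \<subseteq> carrier A"
      using res_closed by (auto simp: ground_field_def)
    show "\<one>\<^bsub>A\<^esub> \<in> K"
      using KI[of 1] by (simp add: mc(4)[symmetric] res_one)
    fix h assume "h \<in> K"
    then obtain a where a: "h = res (mconst a)"
      by (auto simp: ground_field_def)
    show "\<ominus>\<^bsub>A\<^esub> h \<in> K"
      using KI[of "- a"] res_uminus[of "mconst a"] by (simp add: a mc)
    fix h' assume "h' \<in> K"
    then obtain b where b: "h' = res (mconst b)"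
      by (auto simp: ground_field_def)
    show "h \<otimes>\<^bsub>A\<^esub> h' \<in> K"
      using KI[of "a * b"] res_mult[of "mconst a" "mconst b"] by (simp add: a b mc)
    show "h \<oplus>\<^bsub>A\<^esub> h' \<in> K"
      using KI[of "a + b"] res_add[of "mconst a" "mconst b"] by (simp add: a b mc)
  qed
  then show "subcring K A"
    by (rule A.subcringI')
  show "Units (A\<lparr>carrier := K\<rparr>) = K - {\<zero>\<^bsub>A\<^esub>}"
  proof (intro equalityI subsetI)
    fix x assume "x \<in> Units (A\<lparr>carrier := K\<rparr>)"
    then obtain y where xy: "x \<in> K" "y \<in> K" "y \<otimes>\<^bsub>A\<^esub> x = \<one>\<^bsub>A\<^esub>"
      by (auto simp: Units_def)
    have "x \<noteq> \<zero>\<^bsub>A\<^esub>"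
    proof
      assume "x = \<zero>\<^bsub>A\<^esub>"
      moreover have "y \<in> carrier A"
        using xy res_closed by (auto simp: ground_field_def)
      ultimately have "res 1 = \<zero>\<^bsub>A\<^esub>"
        using xy by (simp add: res_one)
      then show False
        using res_eq_zero_iff[of 1] not_nul_one by simp
    qed
    then show "x \<in> K - {\<zero>\<^bsub>A\<^esub>}"
      using xy by simp
  next
    fix x assume x: "x \<in> K - {\<zero>\<^bsub>A\<^esub>}"
    then obtain a where a: "x = res (mconst a)"
      by (auto simp: ground_field_def)
    have "a \<noteq> 0"
    proof
      assume "a = 0"
      then have "x = \<zero>\<^bsub>A\<^esub>"
        by (simp add: a mc(5)[symmetric] res_zero)
      then show False
        using x by blast
    qed
    then have "res (mconst (inverse a)) \<otimes>\<^bsub>A\<^esub> x = \<one>\<^bsub>A\<^esub>" "x \<otimes>\<^bsub>A\<^esub> res (mconst (inverse a)) = \<one>\<^bsub>A\<^esub>"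
      using res_mult[of "mconst a" "mconst (inverse a)"] res_mult[of "mconst (inverse a)" "mconst a"]
      by (simp_all add: a mc(2) mc(4)[symmetric] res_one)
    then show "x \<in> Units (A\<lparr>carrier := K\<rparr>)"
      using x KI[of "inverse a"] by (auto simp: Units_def)
  qed
qed

lemma G_subset: "G k \<subseteq> carrier A"
  using res_closed carrier_component' by (auto simp: sym_alg_component_def)

lemma G_finite_dimension: "A.finite_dimension K (G k)"
proof -
  define M where "M = {m. Poly_Mapping.keys m \<subseteq> sym_indices N \<and> mon_degree m = k}"
  obtain ms where ms: "set ms = M"
    using finite_list[OF finite_monomials[of N k]] unfolding M_def by blast
  let ?Us = "map (\<lambda>m. res (xpow m)) ms"
  have xc: "xpow m \<in> carrier R" if "m \<in> M" for m
    using that by (simp add: M_def carrier_sym_poly_ring)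
  have Us: "set ?Us \<subseteq> carrier A"
    using ms xc res_closed by auto
  note Span_props = A.Span_subgroup_props[OF K_subfield Us]
  \<comment> \<open>In this sense a subalgebra is a linear subspace; closure under products is not
    part of the notion.\<close>
  have "subalgebra K (G k) A"
  proof (rule subalgebra.intro)
    show "subgroup (G k) (add_monoid A)"
    proof (rule A.add.subgroupI)
      show "G k \<noteq> {}"
        unfolding sym_alg_component_def using sym_poly_component_zero'[of N k] by blast
      fix a assume "a \<in> G k"
      then obtain f where f: "f \<in> sym_poly_component N k" "a = res f"
        by (auto simp: sym_alg_component_def)
      have "\<ominus>\<^bsub>A\<^esub> a = res (- f)"
        using f res_uminus carrier_component' by simp
      then show "\<ominus>\<^bsub>A\<^esub> a \<in> G k"
        using f sym_poly_component_uminus' by (simp add: sym_alg_component_def)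
      fix b assume "b \<in> G k"
      then obtain g where g: "g \<in> sym_poly_component N k" "b = res g"
        by (auto simp: sym_alg_component_def)
      have "a \<oplus>\<^bsub>A\<^esub> b = res (f + g)"
        using f g res_add carrier_component' by simp
      then show "a \<oplus>\<^bsub>A\<^esub> b \<in> G k"
        using f g sym_poly_component_add' by (simp add: sym_alg_component_def)
    qed (use G_subset in auto)
    show "subalgebra_axioms K (G k) A"
    proof
      fix a b assume "a \<in> K" "b \<in> G k"
      then obtain c f where c: "a = res (mconst c)" and f: "f \<in> sym_poly_component N k" "b = res f"
        by (auto simp: sym_alg_component_def ground_field_def)
      have "a \<otimes>\<^bsub>A\<^esub> b = res (mconst c * f)"
        using c f res_mult carrier_component' by simp
      then show "a \<otimes>\<^bsub>A\<^esub> b \<in> G k"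
        using f sym_poly_component_mconst' by (simp add: sym_alg_component_def)
    qed
  qed
  moreover have "G k \<subseteq> A.Span K ?Us"
  proof
    fix a assume "a \<in> G k"
    then obtain f where f: "f \<in> sym_poly_component N k" "a = res f"
      by (auto simp: sym_alg_component_def)
    define F where "F X = (\<Sum>m\<in>X. mconst (Poly_Mapping.lookup f m) * xpow m)" for X
    have "res (F X) \<in> A.Span K ?Us \<and> F X \<in> carrier R" if "finite X" "X \<subseteq> M" for X
      using that
    proof (induction X rule: finite_induct)
      case empty
      then show ?case
        using Span_props(2) by (simp add: F_def res_zero)
    next
      case (insert m X)
      let ?t = "mconst (Poly_Mapping.lookup f m) * xpow m"
      have m: "xpow m \<in> carrier R" and IH: "res (F X) \<in> A.Span K ?Us" "F X \<in> carrier R"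
        using insert xc by auto
      have "res (xpow m) \<in> A.Span K ?Us"
        using A.Span_base_incl[OF K_subfield Us] ms insert.prems by auto
      then have "res (mconst (Poly_Mapping.lookup f m)) \<otimes>\<^bsub>A\<^esub> res (xpow m) \<in> A.Span K ?Us"
        by (intro A.Span_smult_closed[OF K_subfield Us]) (auto simp: ground_field_def)
      then have "res ?t \<in> A.Span K ?Us"
        using res_mult[of "mconst (Poly_Mapping.lookup f m)" "xpow m"] m by simp
      moreover have "?t \<in> carrier R"
        using m by (intro carrier_mult') auto
      moreover have "F (insert m X) = ?t + F X"
        using insert by (simp add: F_def)
      ultimately show ?case
        using IH res_add[of ?t "F X"] Span_props(3) carrier_add' by simp
    qed
    moreover have "f = F (Poly_Mapping.keys f)"
      by (subst (1) poly_mapping_eq_sum_single[of f]) (simp add: F_def mconst_def mult_single)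
    moreover have "Poly_Mapping.keys f \<subseteq> M"
      using f by (auto simp: M_def sym_poly_component_def carrier_sym_poly_ring)
    ultimately show "a \<in> A.Span K ?Us"
      using f by (metis finite_keys)
  qed
  ultimately show ?thesis
    using A.subalbegra_incl_imp_finite_dimension[OF K_subfield A.Span_finite_dimension[OF K_subfield Us]] by blast
qed

text \<open>This removes dimensions and cosets from the Lefschetz conditions: what remains is
  injectivity or surjectivity for polynomials modulo \<open>nul\<close>.\<close>

lemma maximal_rank_iff:
  assumes r: "r \<in> sym_poly_component N q"
  shows "has_maximal_rank A K (\<lambda>a. res r \<otimes>\<^bsub>A\<^esub> a) (G k) (G (k + q)) \<longleftrightarrow>
    (\<forall>f\<in>sym_poly_component N k. nul N (r * f) \<longrightarrow> nul N f) \<or>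
    (\<forall>h\<in>sym_poly_component N (k + q). \<exists>f\<in>sym_poly_component N k. nul N (r * f - h))"
proof -
  let ?\<phi> = "\<lambda>a. res r \<otimes>\<^bsub>A\<^esub> a"
  have rc: "r \<in> carrier R" "res r \<in> carrier A"
    using r carrier_component' res_closed by auto
  have Kc: "K \<subseteq> carrier A"
    using res_closed by (auto simp: ground_field_def)
  have \<phi>_res: "?\<phi> (res f) = res (r * f)" if "f \<in> sym_poly_component N k" for f
    using that rc carrier_component' res_mult by simp
  have mult_comp: "r * f \<in> sym_poly_component N (k + q)" if "f \<in> sym_poly_component N k" for f
    using sym_poly_component_mult[OF r that] by (simp add: add.commute)
  have sub: "?\<phi> ` G k \<subseteq> G (k + q)"
    using \<phi>_res mult_comp by (auto simp: sym_alg_component_def)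
  have "has_maximal_rank A K ?\<phi> (G k) (G (k + q)) \<longleftrightarrow>
      (\<forall>a\<in>G k. ?\<phi> a = \<zero>\<^bsub>A\<^esub> \<longrightarrow> a = \<zero>\<^bsub>A\<^esub>) \<or> ?\<phi> ` G k = G (k + q)"
  proof (rule A.has_maximal_rank_iff[OF K_subfield])
    fix c a assume "c \<in> K" "a \<in> carrier A"
    then show "?\<phi> (c \<otimes>\<^bsub>A\<^esub> a) = c \<otimes>\<^bsub>A\<^esub> ?\<phi> a"
      using rc Kc by (intro A.m_lcomm) auto
  qed (use rc sub G_finite_dimension A.r_distr in auto)
  also have "(\<forall>a\<in>G k. ?\<phi> a = \<zero>\<^bsub>A\<^esub> \<longrightarrow> a = \<zero>\<^bsub>A\<^esub>) \<longleftrightarrow>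
      (\<forall>f\<in>sym_poly_component N k. nul N (r * f) \<longrightarrow> nul N f)"
  proof -
    have "(?\<phi> (res f) = \<zero>\<^bsub>A\<^esub> \<longrightarrow> res f = \<zero>\<^bsub>A\<^esub>) \<longleftrightarrow> (nul N (r * f) \<longrightarrow> nul N f)"
      if f: "f \<in> sym_poly_component N k" for f
      using \<phi>_res[OF f] res_eq_zero_iff[of f] res_eq_zero_iff[of "r * f"] f mult_comp[OF f] carrier_component' by simp
    then show ?thesis
      by (simp add: sym_alg_component_def)
  qed
  also have "?\<phi> ` G k = G (k + q) \<longleftrightarrow>
      (\<forall>h\<in>sym_poly_component N (k + q). \<exists>f\<in>sym_poly_component N k. nul N (r * f - h))"
  proof -
    have "?\<phi> ` G k = G (k + q) \<longleftrightarrow> G (k + q) \<subseteq> ?\<phi> ` G k"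
      using sub by blast
    also have "\<dots> \<longleftrightarrow> (\<forall>h\<in>sym_poly_component N (k + q). \<exists>f\<in>sym_poly_component N k. res h = ?\<phi> (res f))"
      by (auto simp: sym_alg_component_def image_subset_iff image_iff)
    also have "\<dots> \<longleftrightarrow> (\<forall>h\<in>sym_poly_component N (k + q). \<exists>f\<in>sym_poly_component N k. nul N (r * f - h))"
    proof (intro ball_cong bex_cong refl)
      fix h f :: "'k mpoly" assume h: "h \<in> sym_poly_component N (k + q)" and f: "f \<in> sym_poly_component N k"
      show "res h = ?\<phi> (res f) \<longleftrightarrow> nul N (r * f - h)"
        using \<phi>_res[OF f] res_eq_iff[of "r * f" h] h mult_comp[OF f] carrier_component' by auto
    qed
    finally show ?thesis .
  qed
  finally show ?thesis .
qed

lemma strong_lefschetz_element_iff: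
  assumes l: "l \<in> sym_poly_component N 1"
  shows "strong_lefschetz_element A K G (res l) \<longleftrightarrow> (\<forall>k q.
    (\<forall>f\<in>sym_poly_component N k. nul N (l ^ q * f) \<longrightarrow> nul N f) \<or>
    (\<forall>h\<in>sym_poly_component N (k + q). \<exists>f\<in>sym_poly_component N k. nul N (l ^ q * f - h)))"
  using maximal_rank_iff[OF sym_poly_component_power[OF l]] l carrier_component'[OF l]
  by (simp add: strong_lefschetz_element_def res_power sym_alg_component_def)

lemma weak_lefschetz_element_iff:
  assumes l: "l \<in> sym_poly_component N 1"
  shows "weak_lefschetz_element A K G (res l) \<longleftrightarrow> (\<forall>k.
    (\<forall>f\<in>sym_poly_component N k. nul N (l * f) \<longrightarrow> nul N f) \<or>
    (\<forall>h\<in>sym_poly_component N (k + 1). \<exists>f\<in>sym_poly_component N k. nul N (l * f - h)))"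
  using maximal_rank_iff[OF l] l by (simp add: weak_lefschetz_element_def sym_alg_component_def)

text \<open>The kernel is the line spanned by the class of \<open>v\<close>, realized as a one-step
  extension of the zero space.\<close>

lemma kernel_dimension_one:
  assumes v: "v \<in> sym_poly_component N k" "nul N (r * v)" "\<not> nul N v"
    and r: "r \<in> carrier R"
    and ker: "\<And>f. f \<in> sym_poly_component N k \<Longrightarrow> nul N (r * f) \<Longrightarrow> \<exists>c. nul N (f - mconst c * v)"
  shows "A.dimension 1 K {a \<in> G k. res r \<otimes>\<^bsub>A\<^esub> a = \<zero>\<^bsub>A\<^esub>}"
proof -
  have vc: "v \<in> carrier R"
    using v carrier_component' by blast
  have "A.dimension (Suc 0) K (A.line_extension K (res v) {\<zero>\<^bsub>A\<^esub>})"
    using v vc res_closed res_eq_zero_iff by (intro A.Suc_dim A.zero_dim) auto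
  moreover have "A.line_extension K (res v) {\<zero>\<^bsub>A\<^esub>} = {a \<in> G k. res r \<otimes>\<^bsub>A\<^esub> a = \<zero>\<^bsub>A\<^esub>}"
  proof (intro equalityI subsetI)
    fix a assume "a \<in> A.line_extension K (res v) {\<zero>\<^bsub>A\<^esub>}"
    then obtain c where "a = res (mconst c) \<otimes>\<^bsub>A\<^esub> res v \<oplus>\<^bsub>A\<^esub> \<zero>\<^bsub>A\<^esub>"
      by (auto simp: A.line_extension_mem_iff ground_field_def)
    then have a: "a = res (mconst c * v)"
      using vc res_mult res_closed by simp
    have "nul N (r * (mconst c * v))"
      using nul_mult[OF v(2), of "mconst c"] by (simp add: mult.left_commute)
    then have "res r \<otimes>\<^bsub>A\<^esub> a = \<zero>\<^bsub>A\<^esub>"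
      using a r vc res_mult[of r "mconst c * v"] res_eq_zero_iff[of "r * (mconst c * v)"] carrier_mult' by simp
    then show "a \<in> {a \<in> G k. res r \<otimes>\<^bsub>A\<^esub> a = \<zero>\<^bsub>A\<^esub>}"
      using a sym_poly_component_mconst'[OF v(1)] by (simp add: sym_alg_component_def)
  next
    fix a assume "a \<in> {a \<in> G k. res r \<otimes>\<^bsub>A\<^esub> a = \<zero>\<^bsub>A\<^esub>}"
    then obtain f where f: "f \<in> sym_poly_component N k" "a = res f" "res r \<otimes>\<^bsub>A\<^esub> res f = \<zero>\<^bsub>A\<^esub>"
      by (auto simp: sym_alg_component_def)
    have fc: "f \<in> carrier R"
      using f carrier_component' by blast
    then have "nul N (r * f)"
      using f r res_mult[of r f] res_eq_zero_iff[of "r * f"] carrier_mult' by simp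
    then obtain c where "nul N (f - mconst c * v)"
      using ker f by blast
    then have "a = res (mconst c) \<otimes>\<^bsub>A\<^esub> res v"
      using f fc vc res_eq_iff[of f "mconst c * v"] res_mult[of "mconst c" v] carrier_mult' by simp
    then have "a = res (mconst c) \<otimes>\<^bsub>A\<^esub> res v \<oplus>\<^bsub>A\<^esub> \<zero>\<^bsub>A\<^esub>"
      using vc res_closed by simp
    then show "a \<in> A.line_extension K (res v) {\<zero>\<^bsub>A\<^esub>}"
      unfolding A.line_extension_mem_iff by (auto simp: ground_field_def)
  qed
  ultimately show ?thesis
    by simp
qed

end

section \<open>Lefschetz properties\<close>

lemma add_power_prime:
  fixes x y :: "'a::comm_ring_1"
  assumes p: "prime p" "of_nat p = (0::'a)"
  shows "(x + y) ^ p = x ^ p + y ^ p"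
proof -
  have "of_nat (p choose k) * x ^ k * y ^ (p - k) = 0" if "k \<in> {..p} - {0, p}" for k
  proof -
    have "p dvd (p choose k)"
      using that p(1) by (intro dvd_choose_prime) (auto simp: prime_gt_0_nat)
    then have "of_nat (p choose k) = (0::'a)"
      using p(2) by (auto elim!: dvdE)
    then show ?thesis
      by simp
  qed
  then have "(x + y) ^ p = (\<Sum>k\<in>{0, p}. of_nat (p choose k) * x ^ k * y ^ (p - k))"
    unfolding binomial_ring by (intro sum.mono_neutral_right) auto
  then show ?thesis
    using prime_gt_0_nat[OF p(1)] by (simp add: add.commute)
qed

lemma sum_power_prime:
  fixes f :: "'i \<Rightarrow> 'a::comm_ring_1"
  assumes p: "prime p" "of_nat p = (0::'a)"
  shows "(\<Sum>i\<in>I. f i) ^ p = (\<Sum>i\<in>I. f i ^ p)"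
  by (induction I rule: infinite_finite_induct)
    (use prime_gt_0_nat[OF p(1)] in \<open>auto simp: zero_power add_power_prime[OF p]\<close>)

lemma single_power_wt:
  fixes c :: "'k::field"
  shows "\<exists>m'. Poly_Mapping.single m c ^ n = Poly_Mapping.single m' (c ^ n) \<and> (\<forall>i. wt i m' = n * wt i m)"
proof (induction n)
  case 0
  have "Poly_Mapping.single m c ^ 0 = Poly_Mapping.single 0 (c ^ 0)"
    by simp
  then show ?case
    using wt_zero by (metis mult_0)
next
  case (Suc n)
  then obtain m' where "Poly_Mapping.single m c ^ n = Poly_Mapping.single m' (c ^ n)" "\<And>i. wt i m' = n * wt i m"
    by blast
  then show ?case
    by (intro exI[of _ "m + m'"]) (simp add: mult_single wt_add)
qed

text \<open>After Frobenius only \<open>p\<close>-th powers of single variables remain, and each has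
  degree at least \<open>p > 2\<close> at an endpoint of its edge.\<close>

lemma linear_form_power_nul:
  fixes l :: "'k::field mpoly"
  assumes l: "l \<in> sym_poly_component N 1" and p: "prime p" "p > 2" "of_nat p = (0::'k)"
  shows "nul N (l ^ p)"
proof -
  have p0: "of_nat p = (0 :: 'k mpoly)"
    using p(3) by (metis single_of_nat single_zero)
  have "l ^ p = (\<Sum>m\<in>Poly_Mapping.keys l. Poly_Mapping.single m (Poly_Mapping.lookup l m)) ^ p"
    using poly_mapping_eq_sum_single[of l] by simp
  also have "\<dots> = (\<Sum>m\<in>Poly_Mapping.keys l. Poly_Mapping.single m (Poly_Mapping.lookup l m) ^ p)"
    by (rule sum_power_prime[OF p(1) p0])
  finally have lp: "l ^ p = (\<Sum>m\<in>Poly_Mapping.keys l. Poly_Mapping.single m (Poly_Mapping.lookup l m) ^ p)" .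
  have "nul N (Poly_Mapping.single m (Poly_Mapping.lookup l m) ^ p)" if m: "m \<in> Poly_Mapping.keys l" for m
  proof -
    have "m \<noteq> 0"
      using component_degree[OF l m] mon_degree_eq_0_iff[of m] by auto
    then obtain v where "Poly_Mapping.lookup m v \<noteq> 0"
      by (auto simp: poly_mapping_eq_iff fun_eq_iff)
    then have "wt (fst v) m \<ge> 1"
      using lookup_le_wt[of m v] by linarith
    then have "p * wt (fst v) m > 2"
      using p(2) by (metis less_le_trans mult_le_mono2 nat_mult_1_right)
    moreover obtain m' where m': "Poly_Mapping.single m (Poly_Mapping.lookup l m) ^ p = Poly_Mapping.single m' (Poly_Mapping.lookup l m ^ p)"
      and "\<And>i. wt i m' = p * wt i m"
      using single_power_wt[of m "Poly_Mapping.lookup l m" p] by blast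
    ultimately show ?thesis
      unfolding m' by (intro nul_xpow_heavy[of "fst v"]) simp
  qed
  then show ?thesis
    unfolding lp by (intro nul_sum)
qed

context sym_det_algebra
begin

lemma loops_component: "(xpow (loops {..<N}) :: 'k mpoly) \<in> sym_poly_component N N"
  by (intro sym_poly_component_single keys_loops) (auto simp: mon_degree_loops)

text \<open>
  If \<open>L\<^sup>s = 0\<close> with \<open>s\<close> minimal, then \<open>L : A\<^bsub>s-1\<^esub> \<rightarrow> A\<^bsub>s\<^esub>\<close> is not injective. Were it surjective, then
  \<open>A\<^bsub>N\<^esub> = L\<^bsup>N+1-s\<^esup> A\<^bsub>s-1\<^esub>\<close>, because \<open>A\<close> is generated in degree one; but this space vanishes.
\<close>

lemma not_weak_lefschetz_element:
  assumes l: "l \<in> sym_poly_component N 1" and lp: "nul N (l ^ p :: 'k mpoly)" and p: "2 * p \<le> N + 1" "N \<ge> 1"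
  shows "\<not> weak_lefschetz_element A K G (res l)"
proof
  assume weak: "weak_lefschetz_element A K G (res l)"
  define s where "s = (LEAST s. nul N (l ^ s))"
  have ls: "nul N (l ^ s)" and sp: "s \<le> p"
    using LeastI[of "\<lambda>s. nul N (l ^ s)", OF lp] Least_le[of "\<lambda>s. nul N (l ^ s)", OF lp] by (simp_all add: s_def)
  have s0: "s \<noteq> 0"
    using ls not_nul_one by (metis power_0)
  \<comment> \<open>By minimality of \<open>s\<close>, this power is a nonzero element of degree
    \<open>s - 1\<close> in the kernel, which rules out the injective alternative.\<close>
  then have "\<not> nul N (l ^ (s - 1))"
    unfolding s_def by (intro not_less_Least) (simp add: s_def[symmetric])
  moreover have "l ^ (s - 1) \<in> sym_poly_component N (s - 1)"
    by (rule sym_poly_component_power[OF l])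
  moreover have "nul N (l * l ^ (s - 1))"
    using ls s0 by (simp add: power_eq_if)
  ultimately have surj: "\<exists>f\<in>sym_poly_component N (s - 1). nul N (l * f - h)"
    if "h \<in> sym_poly_component N s" for h :: "'k mpoly"
    using weak that s0 unfolding weak_lefschetz_element_iff[OF l] by (metis Suc_eq_plus1 Suc_pred' neq0_conv)
  have surj_pow: "\<exists>f\<in>sym_poly_component N (s - 1). nul N (l ^ t * f - h)"
    if "h \<in> sym_poly_component N (s - 1 + t)" for t and h :: "'k mpoly"
    using that
  proof (induction t arbitrary: h)
    case 0
    then show ?case
      by (intro bexI[of _ h]) auto
  next
    case (Suc t)
    show ?case
    proof (rule component_surjI)
      fix m assume m: "m \<in> Poly_Mapping.keys h"
      have deg: "mon_degree m = s + t" and keys: "Poly_Mapping.keys m \<subseteq> sym_indices N"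
        using Suc.prems m s0 by (auto simp: sym_poly_component_def carrier_sym_poly_ring)
      have "mon_degree m > 0"
        using deg s0 by simp
      then obtain v n where mn: "m = n + var_mon v"
        by (rule obtain_var_mon)
      have n: "(xpow n :: 'k mpoly) \<in> sym_poly_component N (s - 1 + t)"
        using deg keys s0 unfolding mn by (intro sym_poly_component_single) (auto simp: keys_add_nat mon_degree_add)
      have v: "(xpow (var_mon v) :: 'k mpoly) \<in> sym_poly_component N 1"
        using keys unfolding mn by (intro sym_poly_component_single) (auto simp: keys_add_nat)
      obtain f where f: "f \<in> sym_poly_component N (s - 1)" "nul N (l ^ t * f - xpow n)"
        using Suc.IH[OF n] by blast
      have "xpow (var_mon v) * f \<in> sym_poly_component N s"
        using sym_poly_component_mult[OF v f(1)] s0 by simp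
      from surj[OF this] obtain f' where f': "f' \<in> sym_poly_component N (s - 1)" "nul N (l * f' - xpow (var_mon v) * f)"
        by blast
      \<comment> \<open>The factor \<open>n\<close> is first replaced by \<open>l ^ t * f\<close>;
        then the leftover variable times \<open>f\<close> is divisible by \<open>l\<close> because
        it has degree \<open>s\<close>.\<close>
      have "l ^ Suc t * f' - xpow m =
          l ^ t * (l * f' - xpow (var_mon v) * f) + xpow (var_mon v) * (l ^ t * f - xpow n)"
        by (simp add: mn algebra_simps mult_single)
      then have "nul N (l ^ Suc t * f' - xpow m)"
        using nul_add[OF nul_mult[OF f'(2), of "l ^ t"] nul_mult[OF f(2), of "xpow (var_mon v)"]] by (simp only:)
      then show "\<exists>f\<in>sym_poly_component N (s - 1). nul N (l ^ Suc t * f - xpow m)"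
        using f' by blast
    qed
  qed
  \<comment> \<open>From \<open>2 * s \<le> 2 * p \<le> N + 1\<close> one gets
    \<open>s \<le> t\<close>, so \<open>l ^ t\<close> contains the null factor
    \<open>l ^ s\<close>.\<close>
  define t where "t = N + 1 - s"
  have t: "s - 1 + t = N" "t = s + (t - s)"
    using p sp s0 by (auto simp: t_def)
  obtain f where "nul N (l ^ t * f - xpow (loops {..<N}))"
    using surj_pow[of "xpow (loops {..<N})" t] loops_component t(1) by auto
  moreover have "nul N (l ^ t * f)"
    using nul_mult_right[OF ls, of "l ^ (t - s) * f"] t(2) by (metis mult.assoc power_add)
  ultimately have "nul N (xpow (loops {..<N}) :: 'k mpoly)"
    using nul_diff[of N "l ^ t * f" "l ^ t * f - xpow (loops {..<N})"] by simp
  then show False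
    using not_nul_loops by blast
qed

text \<open>The power \<open>l ^ N\<close> maps degree 0 to degree \<open>N\<close>. Both contain a
  nonzero class, so a zero map between them is neither injective nor surjective.\<close>

lemma not_strong_lefschetz_element:
  assumes l: "l \<in> sym_poly_component N 1" and lN: "nul N (l ^ N :: 'k mpoly)"
  shows "\<not> strong_lefschetz_element A K G (res l)"
proof
  assume "strong_lefschetz_element A K G (res l)"
  then consider "\<forall>f\<in>sym_poly_component N 0. nul N (l ^ N * f) \<longrightarrow> nul N f"
    | "\<forall>h\<in>sym_poly_component N N. \<exists>f\<in>sym_poly_component N 0. nul N (l ^ N * f - h)"
    unfolding strong_lefschetz_element_iff[OF l] by (metis add_0)
  then show False
  proof cases
    case 1
    moreover have "(1 :: 'k mpoly) \<in> sym_poly_component N 0"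
      by (simp add: sym_poly_component_def mon_degree_def)
    ultimately show False
      using lN not_nul_one by (metis mult.right_neutral)
  next
    case 2
    then obtain f where "nul N (l ^ N * f - xpow (loops {..<N}))"
      using loops_component by blast
    then have "nul N (xpow (loops {..<N}) :: 'k mpoly)"
      using nul_diff[OF nul_mult_right[OF lN, of f]] by fastforce
    then show False
      using not_nul_loops by blast
  qed
qed

lemma trace_form_eq: "trace_form N = res (trace_poly N)"
  by (simp add: trace_form_def)

lemma trace_strong_lefschetz:
  assumes nz: "\<And>j. 0 < j \<Longrightarrow> j \<le> N \<Longrightarrow> of_nat j \<noteq> (0::'k)"
  shows "strong_lefschetz_element A K G (trace_form N)"
  unfolding trace_form_eq strong_lefschetz_element_iff[OF trace_poly_component]
proof (intro allI)
  fix k q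
  show "(\<forall>f\<in>sym_poly_component N k. nul N ((trace_poly N :: 'k mpoly) ^ q * f) \<longrightarrow> nul N f) \<or>
    (\<forall>h\<in>sym_poly_component N (k + q). \<exists>f\<in>sym_poly_component N k. nul N ((trace_poly N :: 'k mpoly) ^ q * f - h))"
  proof (cases "2 * k + q \<le> N")
    case True
    have "nul N f" if "f \<in> sym_poly_component N k" "nul N (trace_poly N ^ q * f)" for f :: "'k mpoly"
      using that True nz by (intro trace_pow_injective[of f N k q]) auto
    then show ?thesis
      by blast
  next
    case False
    have "\<exists>f\<in>sym_poly_component N k. nul N (trace_poly N ^ q * f - h)"
      if "h \<in> sym_poly_component N (k + q)" for h :: "'k mpoly"
      using that False nz by (intro trace_pow_surjective) auto
    then show ?thesis
      by blast
  qed
qed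

text \<open>For \<open>q = 1\<close> the largest integer to be inverted is \<open>k + 1\<close> when
  \<open>2 * k + 1 \<le> N\<close>, and \<open>N - k\<close> when \<open>N \<le> 2 * k\<close>;
  twice either one is at most \<open>N + 1\<close>.\<close>

lemma trace_weak_lefschetz:
  assumes nz: "\<And>j. 0 < j \<Longrightarrow> 2 * j \<le> N + 1 \<Longrightarrow> of_nat j \<noteq> (0::'k)"
  shows "weak_lefschetz_element A K G (trace_form N)"
  unfolding trace_form_eq weak_lefschetz_element_iff[OF trace_poly_component]
proof (intro allI)
  fix k
  show "(\<forall>f\<in>sym_poly_component N k. nul N ((trace_poly N :: 'k mpoly) * f) \<longrightarrow> nul N f) \<or>
    (\<forall>h\<in>sym_poly_component N (k + 1). \<exists>f\<in>sym_poly_component N k. nul N ((trace_poly N :: 'k mpoly) * f - h))"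
  proof (cases "2 * k + 1 \<le> N")
    case True
    have "nul N f" if "f \<in> sym_poly_component N k" "nul N (trace_poly N * f)" for f :: "'k mpoly"
      using that True nz by (intro trace_pow_injective[of f N k 1]) auto
    then show ?thesis
      by blast
  next
    case False
    have "\<exists>f\<in>sym_poly_component N k. nul N (trace_poly N ^ 1 * f - h)"
      if "h \<in> sym_poly_component N (k + 1)" for h :: "'k mpoly"
      using that False nz by (intro trace_pow_surjective) auto
    then show ?thesis
      by simp
  qed
qed

lemma trace_kernel_dimension:
  assumes N: "N = 2 * k + 1"
    and k: "of_nat (Suc k) = (0::'k)" "\<And>j. 0 < j \<Longrightarrow> j \<le> k \<Longrightarrow> of_nat j \<noteq> (0::'k)"
  shows "ring.dimension A 1 K {a \<in> G k. trace_form N \<otimes>\<^bsub>A\<^esub> a = \<zero>\<^bsub>A\<^esub>}"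
  unfolding trace_form_eq
  by (rule kernel_dimension_one[OF trace_kernel_middle(1-3)[OF N k] carrier_component[OF trace_poly_component]
    trace_kernel_middle(4)[OF N k]])

end

theorem theorem1p3:
  fixes N p :: nat
    and A :: "'k::field mpoly set ring"
    and K :: "'k mpoly set set"
    and G :: "nat \<Rightarrow> 'k mpoly set set"
    and ell :: "'k mpoly set"
  defines "A \<equiv> sym_alg N"
    and "K \<equiv> ground_field N"
    and "G \<equiv> sym_alg_component N"
    and "ell \<equiv> trace_form N"
  assumes "N \<ge> 1"
  shows
    "(odd p \<and> CHAR('k) = p \<longrightarrow>
        (weak_lefschetz_property A K G \<longleftrightarrow> N \<le> 2 * p - 2) \<and>
        (strong_lefschetz_property A K G \<longleftrightarrow> N < p) \<and>
        (weak_lefschetz_property A K G \<longrightarrow> weak_lefschetz_element A K G ell) \<and>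
        (strong_lefschetz_property A K G \<longrightarrow> strong_lefschetz_element A K G ell) \<and>
        (N = 2 * p - 1 \<longrightarrow>
           ring.dimension A 1 K {a \<in> G (p - 1). ell \<otimes>\<^bsub>A\<^esub> a = \<zero>\<^bsub>A\<^esub>})) \<and>
     (CHAR('k) = 0 \<longrightarrow> strong_lefschetz_element A K G ell)"
proof (intro conjI impI)
  assume char: "CHAR('k) = 0"
  then have nz: "of_nat j \<noteq> (0::'k)" if "0 < j" for j
    using that by (simp add: of_nat_eq_0_iff_char_dvd)
  interpret sym_det_algebra N "TYPE('k)"
    using nz[of 2] by unfold_locales simp
  show "strong_lefschetz_element A K G ell"
    unfolding A_def K_def G_def ell_def using nz by (intro trace_strong_lefschetz) auto
next
  assume "odd p \<and> CHAR('k) = p"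
  then have odd: "odd p" and char: "CHAR('k) = p"
    by auto
  \<comment> \<open>Oddness excludes characteristic zero, and a nonzero characteristic of a field is
    prime.\<close>
  have prime: "prime p"
    using prime_CHAR_semidom[where 'a = 'k] odd char by (metis gr0I even_zero)
  then have p: "p > 2" "p \<ge> 1"
    using odd prime_ge_2_nat[OF prime] by (cases "p = 2"; simp)+
  have p0: "of_nat p = (0::'k)"
    using char of_nat_CHAR by metis
  have nz: "of_nat j \<noteq> (0::'k)" if "0 < j" "j < p" for j
    using that char by (auto simp: of_nat_eq_0_iff_char_dvd dest: dvd_imp_le)
  interpret sym_det_algebra N "TYPE('k)"
    using nz[of 2] p by unfold_locales simp
  have lin: "\<exists>l\<in>sym_poly_component N 1. L = res l" if "L \<in> G 1" for L
    using that unfolding G_def sym_alg_component_def by blast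
  have weak_ell: "weak_lefschetz_element A K G ell" if "N \<le> 2 * p - 2"
    unfolding A_def K_def G_def ell_def
  proof (rule trace_weak_lefschetz)
    fix j assume "0 < j" "2 * j \<le> N + 1"
    \<comment> \<open>Here \<open>2 * j \<le> N + 1 \<le> 2 * p - 1\<close>, so
      \<open>j < p\<close>.\<close>
    then show "of_nat j \<noteq> (0::'k)"
      using that p by (intro nz) auto
  qed
  have strong_ell: "strong_lefschetz_element A K G ell" if "N < p"
    unfolding A_def K_def G_def ell_def using that nz by (intro trace_strong_lefschetz) auto
  have weak: "N \<le> 2 * p - 2" if "weak_lefschetz_property A K G"
  proof (rule ccontr)
    assume N: "\<not> N \<le> 2 * p - 2"
    obtain L where L: "weak_lefschetz_element A K G L"
      using \<open>weak_lefschetz_property A K G\<close> by (auto simp: weak_lefschetz_property_def)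
    then obtain l where l: "l \<in> sym_poly_component N 1" "L = res l"
      using lin L unfolding weak_lefschetz_element_def by blast
    have "2 * p \<le> N + 1"
      using N p by linarith
    then show False
      using not_weak_lefschetz_element[OF l(1) linear_form_power_nul[OF l(1) prime p(1) p0]] L \<open>N \<ge> 1\<close>
      unfolding l(2) A_def K_def G_def by blast
  qed
  have strong: "N < p" if "strong_lefschetz_property A K G"
  proof (rule ccontr)
    assume N: "\<not> N < p"
    obtain L where L: "strong_lefschetz_element A K G L"
      using \<open>strong_lefschetz_property A K G\<close> by (auto simp: strong_lefschetz_property_def)
    then obtain l where l: "l \<in> sym_poly_component N 1" "L = res l"
      using lin L unfolding strong_lefschetz_element_def by blast
    have "l ^ N = l ^ p * l ^ (N - p)"
      using N by (simp add: power_add[symmetric])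
    then have "nul N (l ^ N)"
      using nul_mult_right[OF linear_form_power_nul[OF l(1) prime p(1) p0]] by simp
    then show False
      using not_strong_lefschetz_element[OF l(1)] L unfolding l(2) A_def K_def G_def by simp
  qed
  show "weak_lefschetz_property A K G \<longleftrightarrow> N \<le> 2 * p - 2"
    using weak weak_ell by (auto simp: weak_lefschetz_property_def)
  show "strong_lefschetz_property A K G \<longleftrightarrow> N < p"
    using strong strong_ell by (auto simp: strong_lefschetz_property_def)
  show "weak_lefschetz_element A K G ell" if "weak_lefschetz_property A K G"
    using weak weak_ell that by blast
  show "strong_lefschetz_element A K G ell" if "strong_lefschetz_property A K G"
    using strong strong_ell that by blast
  \<comment> \<open>The middle degree is \<open>k = p - 1\<close>: then
    \<open>N = 2 * k + 1\<close>, the successor of \<open>k\<close> is \<open>p\<close>, and all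
    smaller positive integers are invertible.\<close>
  show "ring.dimension A 1 K {a \<in> G (p - 1). ell \<otimes>\<^bsub>A\<^esub> a = \<zero>\<^bsub>A\<^esub>}" if "N = 2 * p - 1"
    unfolding A_def K_def G_def ell_def using that p p0 nz by (intro trace_kernel_dimension) auto
qed

end
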